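(* For functions $a,b$ and a real number $c$ (evaluated with cross-fitting when they are estimators) let $$\widehat V_N(a,b,c)=N^{-1}\sum_{i=1}^N\Big[a(X_i)-c+\frac{R_i}{b(X_i)}\{Y_i-a(X_i)\}\Big]^2 .$$ (a) (Known propensity score.) Suppose ignorability $R\perp\!\!\!\perp Y\mid X$, the Basic Assumption and the Tail Condition (stated in the context) hold, $Na_N\to\infty$, and for all $k\le\mathbb K$, $\mathbb E_X\big[\frac{a_N}{\pi_N(X)}\{\hat m(X;\mathbb S_{-k})-\mu(X)\}^2\big]=O_p(c_{\mu,N}^2)$ with $c_{\mu,N}=o(1)$. Let $\tilde\theta=N^{-1}\sum_{i=1}^N\big[\hat m(X_i)+\frac{R_i}{\pi_N(X_i)}\{Y_i-\hat m(X_i)\}\big]$, $V_N(\mu)=\mathrm{Var}\{\psi_{\mu,\pi}(Z)\}$ and $\widehat V_N(\mu)=\widehat V_N(\hat m,\pi_N,\tilde\theta)$. Then, as $N\to\infty$, $\widehat V_N(\mu)=V_N(\mu)\{1+o_p(1)\}$. (b) (Unknown propensity score.) Suppose ignorability, the Basic Assumption and the Tail Condition hold, $Na_N\to\infty$, $\mu(\cdot)=m(\cdot)$, $e_N(\cdot)=\pi_N(\cdot)$, and for all $k\le\mathbb K$ $$\mathbb E_X\Big[\tfrac{a_N}{\pi_N(X)}\{\hat m(X;\mathbb S_{-k})-\mu(X)\}^2\Big]=O_p(c_{\mu,N}^2),\qquad \mathbb E_X\Big[\tfrac{a_N}{\pi_N(X)}\Big\{1-\tfrac{e_N(X)}{\hat\pi_N(X;\mathbb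 S_{-k})}\Big\}^2\Big]=O_p(c_{e,N}^2),$$ $$\mathbb E_X\{\hat m(X;\mathbb S_{-k})-\mu(X)\}^2=O_p(r_{\mu,N}^2),\qquad \mathbb E_X\Big\{1-\tfrac{e_N(X)}{\hat\pi_N(X;\mathbb S_{-k})}\Big\}^2=O_p(r_{e,N}^2),$$ with $c_{\mu,N},c_{e,N},r_{\mu,N},r_{e,N}=o(1)$ and $r_{\mu,N}r_{e,N}=o(1/\sqrt{Na_N})$. Suppose further that for some constant $\delta>0$ $$N^{-\delta/2}a_N^{1+\delta/2}\,\mathbb E\{|\psi_{\mu,\pi}(Z)|^{2+\delta}\}\to0\quad(N\to\infty),$$ and that for all $k\le\mathbb K$ $$\mathbb E_X\Big[\frac{a_N}{\pi_N(X)}\Big\{1-\frac{\pi_N(X)}{\hat\pi_N(X;\mathbb S_{-k})}\Big\}^2\{\hat m(X;\mathbb S_{-k})-m(X)\}^2\Big]=o_p(1).$$ Let $\hat\theta_{\mathrm{DRSS}}=N^{-1}\sum_{i=1}^N\big[\hat m(X_i)+\frac{R_i}{\hat\pi_N(X_i)}\{Y_i-\hat m(X_i)\}\big]$, $V_N(\mu,e)=\mathrm{Var}\big\{\mu(X)+\frac{R}{e_N(X)}\{Y-\mu(X)\}-\theta_0\big\}$ and $\widehat V_N(\mu,e)=\widehat V_N(\hat m,\hat\pi_N,\hat\theta_{\mathrm{DRSS}})$. Then, as $N\to\infty$, $\widehat V_N(\mu,e)=V_N(\mu,e)\{1+o_p(1)\}$.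
   Context: Setting. For each $N$ the data $\mathbb S=\{Z_i=(R_i,R_iY_i,X_i)\}_{i=1}^N$ are i.i.d. copies of $Z=(R,RY,X)$, with $R\in\{0,1\}$, $Y\in\mathbb R$, $X\in\mathbb R^p$; $\mathcal X$ is the support of the law $\mathbb P_X$ of $X$. The law of $R$ given $X$ (and $p$) may depend on $N$ (triangular array). $\theta_0=\mathbb E(Y)$, $m(x)=\mathbb E(Y\mid X=x)$, $\pi_N(x)=\mathbb P(R=1\mid X=x)$, $\mathbb E\{\pi_N^{-1}(X)\}<\infty$ for each $N$, $a_N:=[\mathbb E\{\pi_N^{-1}(X)\}]^{-1}$ (which may tend to $0$). Cross-fitting. For a fixed integer $\mathbb K\ge2$, $\{\mathcal I_k\}_{k=1}^{\mathbb K}$ is a random partition of $\{1,\dots,N\}$ (independent of the data) into folds of equal size; $\mathbb S_{-k}=\{Z_i:i\notin\mathcal I_k\}$; $\hat m(\cdot;\mathbb S_{-k})$ and $\hat\pi_N(\cdot;\mathbb S_{-k})$ are estimators of $m$ and $\pi_N$ built from $\mathbb S_{-k}$ only; $\hat m(X_i):=\hat m(X_i;\mathbb S_{-k(i)})$, $\hat\pi_N(X_i):=\hat\pi_N(X_i;\mathbb S_{-k(i)})$, where $k(i)$ is the unique $k$ with $i\in\mathcal I_k$. $\mathbb E_X$ denotes expectation over an independent copy of $X$ with the training data held fixed. $\mu(\cdot)$ and $e_N(\cdot)$ are nonrandom functions (limits of $\hat m$, $\hat\pi_N$); in (a) $\mu\neq m$ is allowed. $\psi_{\mu,\pi}(Z)=\mu(X)+\frac{R}{\pi_N(X)}\{Y-\mu(X)\}-\theta_0$.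 Basic Assumption. (a) $Z$ has finite second moments and $\mathrm{Var}(X)$ is positive definite. (b) There are constants $0<\sigma_{\zeta,1}^2$, $\sigma_{\zeta,2}^2<\infty$ (not depending on $N$) with $\mathbb E[\{Y-m(X)\}^2\mid X=x]\ge\sigma_{\zeta,1}^2$ and $\mathbb E[\{Y-\mu(X)\}^2\mid X=x]\le\sigma_{\zeta,2}^2$ for all $x\in\mathcal X$, and $\mathrm{Var}(Y)\le\sigma_{\zeta,2}^2$. Tail Condition. For every $c>0$, $a_N^{\,1}$-normalised Lindeberg-type condition exactly as follows: $a_N^{-1}\,\mathbb E[\psi_{\mu,\pi}^2(Z)\mathbf 1\{|\psi_{\mu,\pi}(Z)|>c\sqrt{N/a_N}\}]\to0$ as $N\to\infty$. *)

theory Defs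
  imports "HOL-Probability.Probability" "HOL-Library.Landau_Symbols"
begin

type_synonym covariate = "nat \<Rightarrow> real"
type_synonym obs = "real \<times> real \<times> covariate"
type_synonym estimator = "nat set \<Rightarrow> (nat \<Rightarrow> obs) \<Rightarrow> covariate \<Rightarrow> real"

text \<open>The dimension p may vary with the sample size, so vectors in R^p are functions on
  the coordinate indices below p (extensional, as in the library's finite product spaces).\<close>

definition cov_space :: "nat \<Rightarrow> covariate measure" where
  "cov_space p = Pi\<^sub>M {..<p} (\<lambda>_. borel)"

definition obs_space :: "nat \<Rightarrow> obs measure" where
  "obs_space p = borel \<Otimes>\<^sub>M (borel \<Otimes>\<^sub>M cov_space p)"

definition obs :: "('a \<Rightarrow> real) \<Rightarrow> ('a \<Rightarrow> real) \<Rightarrow> ('a \<Rightarrow> covariate) \<Rightarrow> 'a \<Rightarrow> obs" where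
  "obs R Y X = (\<lambda>\<omega>. (R \<omega>, R \<omega> * Y \<omega>, X \<omega>))"

definition support :: "'a measure \<Rightarrow> nat \<Rightarrow> ('a \<Rightarrow> covariate) \<Rightarrow> covariate set" where
  "support M p X = {x \<in> space (cov_space p). \<forall>r>0.
     measure M {\<omega> \<in> space M. L2_set (\<lambda>j. X \<omega> j - x j) {..<p} < r} > 0}"

subsection \<open>Conditioning on the covariate\<close>

definition sigma_of :: "'a measure \<Rightarrow> nat \<Rightarrow> ('a \<Rightarrow> covariate) \<Rightarrow> 'a measure" where
  "sigma_of M p X = vimage_algebra (space M) X (cov_space p)"

text \<open>A function g is a version of x |-> E[f | X = x].  The second notion is the one for
  nonnegative f; it takes extended values and needs no integrability.\<close>

definition cond_mean ::
  "'a measure \<Rightarrow> nat \<Rightarrow> ('a \<Rightarrow> covariate) \<Rightarrow> ('a \<Rightarrow> real) \<Rightarrow> (covariate \<Rightarrow> real) \<Rightarrow> bool" where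
  "cond_mean M p X f g \<longleftrightarrow> integrable M f \<and> g \<in> borel_measurable (cov_space p) \<and>
     (AE \<omega> in M. real_cond_exp M (sigma_of M p X) f \<omega> = g (X \<omega>))"

definition cond_mean_nonneg ::
  "'a measure \<Rightarrow> nat \<Rightarrow> ('a \<Rightarrow> covariate) \<Rightarrow> ('a \<Rightarrow> real) \<Rightarrow> (covariate \<Rightarrow> ennreal) \<Rightarrow> bool" where
  "cond_mean_nonneg M p X f g \<longleftrightarrow> g \<in> borel_measurable (cov_space p) \<and>
     (AE \<omega> in M. nn_cond_exp M (sigma_of M p X) (\<lambda>\<omega>. ennreal (f \<omega>)) \<omega> = g (X \<omega>))"

text \<open>Ignorability: R and Y are conditionally independent given X.\<close>

definition ignorable ::
  "'a measure \<Rightarrow> nat \<Rightarrow> ('a \<Rightarrow> real) \<Rightarrow> ('a \<Rightarrow> real) \<Rightarrow> ('a \<Rightarrow> covariate) \<Rightarrow> bool" where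
  "ignorable M p R Y X \<longleftrightarrow> (\<forall>A\<in>sets borel. \<forall>B\<in>sets borel. AE \<omega> in M.
     real_cond_exp M (sigma_of M p X) (\<lambda>\<omega>. indicator A (R \<omega>) * indicator B (Y \<omega>)) \<omega> =
     real_cond_exp M (sigma_of M p X) (\<lambda>\<omega>. indicator A (R \<omega>)) \<omega> *
     real_cond_exp M (sigma_of M p X) (\<lambda>\<omega>. indicator B (Y \<omega>)) \<omega>)"

subsection \<open>Population quantities\<close>

text \<open>The reciprocal in the last clause is the one of ennreal (inverse 0 = \<infinity>), so the clause
  also says that the propensity score ps is almost surely positive.\<close>

definition population :: "'a measure \<Rightarrow> nat \<Rightarrow> ('a \<Rightarrow> real) \<Rightarrow> ('a \<Rightarrow> real) \<Rightarrow> ('a \<Rightarrow> covariate) \<Rightarrow>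
    (covariate \<Rightarrow> real) \<Rightarrow> (covariate \<Rightarrow> real) \<Rightarrow> bool" where
  "population M p R Y X m ps \<longleftrightarrow>
     prob_space M \<and>
     R \<in> borel_measurable M \<and> Y \<in> borel_measurable M \<and> X \<in> measurable M (cov_space p) \<and>
     (\<forall>\<omega>\<in>space M. R \<omega> \<in> {0, 1}) \<and>
     cond_mean M p X Y m \<and>
     cond_mean M p X (\<lambda>\<omega>. indicator {1} (R \<omega>)) ps \<and>
     (\<integral>\<^sup>+\<omega>. inverse (ennreal (ps (X \<omega>))) \<partial>M) < \<infinity>"

definition aN :: "'a measure \<Rightarrow> ('a \<Rightarrow> covariate) \<Rightarrow> (covariate \<Rightarrow> real) \<Rightarrow> real" where
  "aN M X ps = 1 / enn2real (\<integral>\<^sup>+\<omega>. inverse (ennreal (ps (X \<omega>))) \<partial>M)"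

definition psi :: "'a measure \<Rightarrow> ('a \<Rightarrow> real) \<Rightarrow> ('a \<Rightarrow> real) \<Rightarrow> ('a \<Rightarrow> covariate) \<Rightarrow>
    (covariate \<Rightarrow> real) \<Rightarrow> (covariate \<Rightarrow> real) \<Rightarrow> 'a \<Rightarrow> real" where
  "psi M R Y X mu e \<omega> =
     mu (X \<omega>) + R \<omega> / e (X \<omega>) * (Y \<omega> - mu (X \<omega>)) - prob_space.expectation M Y"

definition covariance :: "'a measure \<Rightarrow> ('a \<Rightarrow> real) \<Rightarrow> ('a \<Rightarrow> real) \<Rightarrow> real" where
  "covariance M f g = prob_space.expectation M
     (\<lambda>\<omega>. (f \<omega> - prob_space.expectation M f) * (g \<omega> - prob_space.expectation M g))"

text \<open>Square integrability of Y is the finiteness implicit in Var(Y) \<le> s2.  The pointwise bounds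
  on the support are imposed on some version of the conditional expectation.\<close>

definition basic_assumption :: "real \<Rightarrow> real \<Rightarrow> 'a measure \<Rightarrow> nat \<Rightarrow> ('a \<Rightarrow> real) \<Rightarrow> ('a \<Rightarrow> real) \<Rightarrow>
    ('a \<Rightarrow> covariate) \<Rightarrow> (covariate \<Rightarrow> real) \<Rightarrow> (covariate \<Rightarrow> real) \<Rightarrow> bool" where
  "basic_assumption s1 s2 M p R Y X m mu \<longleftrightarrow>
     integrable M (\<lambda>\<omega>. (R \<omega>)\<^sup>2) \<and> integrable M (\<lambda>\<omega>. (R \<omega> * Y \<omega>)\<^sup>2) \<and>
     (\<forall>j<p. integrable M (\<lambda>\<omega>. (X \<omega> j)\<^sup>2)) \<and>
     (\<forall>v::nat \<Rightarrow> real. (\<exists>j<p. v j \<noteq> 0) \<longrightarrow>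
        0 < (\<Sum>j<p. \<Sum>l<p. v j * covariance M (\<lambda>\<omega>. X \<omega> j) (\<lambda>\<omega>. X \<omega> l) * v l)) \<and>
     (\<exists>g. cond_mean_nonneg M p X (\<lambda>\<omega>. (Y \<omega> - m (X \<omega>))\<^sup>2) g \<and>
        (\<forall>x\<in>support M p X. ennreal s1 \<le> g x)) \<and>
     (\<exists>g. cond_mean_nonneg M p X (\<lambda>\<omega>. (Y \<omega> - mu (X \<omega>))\<^sup>2) g \<and>
        (\<forall>x\<in>support M p X. g x \<le> ennreal s2)) \<and>
     integrable M (\<lambda>\<omega>. (Y \<omega>)\<^sup>2) \<and> prob_space.variance M Y \<le> s2"

subsection \<open>Sampling and cross-fitting\<close>

text \<open>Only the observed triples are required to be i.i.d.; nothing is assumed about the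
  unobserved outcomes.  The fold assignment is random, and independent of the data.\<close>

definition sample :: "nat \<Rightarrow> 'a measure \<Rightarrow> nat \<Rightarrow> ('a \<Rightarrow> obs) \<Rightarrow> (nat \<Rightarrow> 'a \<Rightarrow> obs) \<Rightarrow> bool" where
  "sample N M p Z Zs \<longleftrightarrow>
     prob_space.indep_vars M (\<lambda>_. obs_space p) Zs {..<N} \<and>
     (\<forall>i<N. distr M (obs_space p) (Zs i) = distr M (obs_space p) Z)"

definition folds :: "nat \<Rightarrow> nat \<Rightarrow> 'a measure \<Rightarrow> nat \<Rightarrow> (nat \<Rightarrow> 'a \<Rightarrow> obs) \<Rightarrow>
    (nat \<Rightarrow> 'a \<Rightarrow> nat set) \<Rightarrow> bool" where
  "folds K N M p Zs I \<longleftrightarrow>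
     (\<forall>k<K. I k \<in> measurable M (count_space UNIV)) \<and>
     (\<forall>\<omega>\<in>space M. disjoint_family_on (\<lambda>k. I k \<omega>) {..<K} \<and> (\<Union>k<K. I k \<omega>) = {..<N} \<and>
        (\<forall>k<K. \<forall>l<K. card (I k \<omega>) = card (I l \<omega>))) \<and>
     prob_space.indep_set M
       (sets (vimage_algebra (space M) (\<lambda>\<omega>. \<lambda>k\<in>{..<K}. I k \<omega>) (Pi\<^sub>M {..<K} (\<lambda>_. count_space UNIV))))
       (sets (vimage_algebra (space M) (\<lambda>\<omega>. \<lambda>i\<in>{..<N}. Zs i \<omega>) (Pi\<^sub>M {..<N} (\<lambda>_. obs_space p))))"

text \<open>An estimator is a function of the training data, that is, of a family of observations
  indexed by the training set, and of the evaluation point.\<close>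

definition estimator :: "nat \<Rightarrow> nat \<Rightarrow> estimator \<Rightarrow> bool" where
  "estimator N p est \<longleftrightarrow> (\<forall>T\<subseteq>{..<N}. (\<lambda>(D, x). est T D x) \<in>
     borel_measurable (Pi\<^sub>M T (\<lambda>_. obs_space p) \<Otimes>\<^sub>M cov_space p))"

text \<open>The estimator trained without fold k, and its cross-fitted values at the sample points.\<close>

definition trained :: "estimator \<Rightarrow> nat \<Rightarrow> (nat \<Rightarrow> 'a \<Rightarrow> obs) \<Rightarrow> (nat \<Rightarrow> 'a \<Rightarrow> nat set) \<Rightarrow>
    nat \<Rightarrow> 'a \<Rightarrow> covariate \<Rightarrow> real" where
  "trained est N Zs I k \<omega> = est ({..<N} - I k \<omega>) (\<lambda>i\<in>{..<N} - I k \<omega>. Zs i \<omega>)"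

definition cross_fit :: "estimator \<Rightarrow> nat \<Rightarrow> nat \<Rightarrow> (nat \<Rightarrow> 'a \<Rightarrow> obs) \<Rightarrow>
    (nat \<Rightarrow> 'a \<Rightarrow> nat set) \<Rightarrow> (nat \<Rightarrow> 'a \<Rightarrow> covariate) \<Rightarrow> 'a \<Rightarrow> nat \<Rightarrow> real" where
  "cross_fit est K N Zs I Xs \<omega> i =
     trained est N Zs I (THE k. k < K \<and> i \<in> I k \<omega>) \<omega> (Xs i \<omega>)"

text \<open>In the next two definitions a and b are the values of the nuisance functions at the N sample
  points.  Where b vanishes, division follows the convention of the library.\<close>

definition theta_hat :: "nat \<Rightarrow> (nat \<Rightarrow> real) \<Rightarrow> (nat \<Rightarrow> real) \<Rightarrow> (nat \<Rightarrow> real) \<Rightarrow> (nat \<Rightarrow> real) \<Rightarrow> real" where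
  "theta_hat N r y a b = (\<Sum>i<N. a i + r i / b i * (y i - a i)) / real N"

definition V_hat :: "nat \<Rightarrow> (nat \<Rightarrow> real) \<Rightarrow> (nat \<Rightarrow> real) \<Rightarrow> (nat \<Rightarrow> real) \<Rightarrow> (nat \<Rightarrow> real) \<Rightarrow> real \<Rightarrow> real" where
  "V_hat N r y a b c = (\<Sum>i<N. (a i - c + r i / b i * (y i - a i))\<^sup>2) / real N"

definition E_X :: "'a measure \<Rightarrow> nat \<Rightarrow> ('a \<Rightarrow> covariate) \<Rightarrow> (covariate \<Rightarrow> real) \<Rightarrow> ennreal" where
  "E_X M p X f = (\<integral>\<^sup>+x. ennreal (f x) \<partial>distr M (cov_space p) X)"

subsection \<open>Asymptotics\<close>

text \<open>Folds of equal size exist only if K divides N, so N tends to infinity along multiples of K.\<close>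

definition multiples :: "nat \<Rightarrow> nat filter" where
  "multiples K = inf at_top (principal {N. K dvd N})"

definition Op :: "nat filter \<Rightarrow> (nat \<Rightarrow> 'a measure) \<Rightarrow> (nat \<Rightarrow> 'a \<Rightarrow> ennreal) \<Rightarrow> (nat \<Rightarrow> real) \<Rightarrow> bool" where
  "Op F M W b \<longleftrightarrow> (\<forall>\<epsilon>>0. \<exists>C>0. \<forall>\<^sub>F N in F.
     measure (M N) {\<omega> \<in> space (M N). W N \<omega> > ennreal (C * b N)} < \<epsilon>)"

definition op1 :: "nat filter \<Rightarrow> (nat \<Rightarrow> 'a measure) \<Rightarrow> (nat \<Rightarrow> 'a \<Rightarrow> ennreal) \<Rightarrow> bool" where
  "op1 F M W \<longleftrightarrow> (\<forall>\<epsilon>>0.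
     ((\<lambda>N. measure (M N) {\<omega> \<in> space (M N). W N \<omega> > ennreal \<epsilon>}) \<longlongrightarrow> 0) F)"

definition ratio_consistent ::
  "nat filter \<Rightarrow> (nat \<Rightarrow> 'a measure) \<Rightarrow> (nat \<Rightarrow> 'a \<Rightarrow> real) \<Rightarrow> (nat \<Rightarrow> real) \<Rightarrow> bool" where
  "ratio_consistent F M Vh V \<longleftrightarrow> (\<exists>W.
     (\<forall>\<^sub>F N in F. W N \<in> borel_measurable (M N) \<and>
        (\<forall>\<omega>\<in>space (M N). Vh N \<omega> = V N * (1 + W N \<omega>))) \<and>
     op1 F M (\<lambda>N \<omega>. ennreal \<bar>W N \<omega>\<bar>))"

end

(* Write h = mhat - mu, D = 1 - pi / pihat and w = R / pi.  The estimated score differs from psi by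
   h (1 - w) - w D (Y - mu) + w D h.  By ignorability, weighting by w does not change the mean of a
   function of (Y, X), so a times the expected square of this difference is controlled by the three
   weighted risks E_X[a h^2 / pi], E_X[a D^2 / pi] and E_X[a D^2 h^2 / pi]; cross-fitting makes the
   same bound hold for the empirical mean, since test points are independent of the training data.
   Part (a) is the case D = 0.  Moreover E psi = 0 and
     E psi^2 = Var Y + E[(1 / pi - 1) (Y - mu)^2],
   which lies between s1 / a and 2 s2 / a, so it suffices to show that a times the error of the
   variance estimator vanishes in probability.  The empirical mean of psi^2 is handled by truncating
   at the level c sqrt(N / a) of the tail condition, that of psi by its variance. *)

theory Submission
  imports Defs
begin

text \<open>Two obstacles shape the argument. First, the risks are small only in probability and may
  have infinite expectation over the training data. Markov's inequality is therefore applied after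
  restricting to the event that the risk of a fold is at most a level \<open>h\<close>; the
  complement is paid for by exactly the probabilities that occur in \<open>Op\<close> and
  \<open>op1\<close>. Second, the lower bound \<open>s1\<close> concerns residuals around
  \<open>m\<close>, while the variance involves residuals around \<open>mu\<close>, which may differ
  from \<open>m\<close>. The link is that the conditional mean minimises the weighted square error;
  since the weight is unbounded, this is proved for truncated weights first. The product term w D h
  needs a risk of its own, because two small mean squares do not bound the mean of the product of
  the squares. All estimates hold at a fixed \<open>N\<close> with explicit constants. Limits enter
  only at the end, where the tolerance \<open>s1 * \<epsilon>\<close> is divided among four error
  terms.\<close>

subsection \<open>The doubly robust score\<close>

text \<open>The second component of an observation is the product R * Y, so the score depends on the
  observed data only.\<close>

definition score :: "(covariate \<Rightarrow> real) \<Rightarrow> (covariate \<Rightarrow> real) \<Rightarrow> obs \<Rightarrow> real" where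
  "score f g = (\<lambda>(r, w, x). f x + (w - r * f x) / g x)"

lemma score_obs: "score f g (obs R Y X \<omega>) = f (X \<omega>) + R \<omega> / g (X \<omega>) * (Y \<omega> - f (X \<omega>))"
  by (simp add: score_def obs_def algebra_simps diff_divide_distrib)

lemma score_measurable [measurable]:
  assumes [measurable]: "f \<in> borel_measurable (cov_space p)" "g \<in> borel_measurable (cov_space p)"
  shows "score f g \<in> borel_measurable (obs_space p)"
  unfolding score_def obs_space_def by measurable

section \<open>Support of the covariate law\<close>

lemma L2_ball_measurable [measurable]:
  assumes [measurable]: "X \<in> measurable M (cov_space p)"
  shows "{\<omega> \<in> space M. L2_set (\<lambda>j. X \<omega> j - x j) {..<p} < r} \<in> sets M"
proof -
  have [measurable]: "(\<lambda>\<omega>. X \<omega> j) \<in> borel_measurable M" if "j \<in> {..<p}" for j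
    using measurable_compose[OF assms[unfolded cov_space_def] measurable_component_singleton[OF that]] .
  show ?thesis unfolding L2_set_def by measurable
qed

text \<open>This rests on the separability of R^p: a point outside the support lies in a null ball with
  rational centre and radius.\<close>

lemma (in prob_space) AE_in_support:
  assumes X [measurable]: "X \<in> measurable M (cov_space p)"
  shows "AE \<omega> in M. X \<omega> \<in> support M p X"
proof -
  let ?B = "\<lambda>q s. {\<omega> \<in> space M. L2_set (\<lambda>j. X \<omega> j - q j) {..<p} < s}"
  define C where "C = {(q, s). q \<in> ({..<p} \<rightarrow>\<^sub>E \<rat>) \<and> s \<in> \<rat> \<and> prob (?B q s) = 0}"
  have "countable (({..<p} \<rightarrow>\<^sub>E \<rat>) \<times> (\<rat>::real set))"
    by (intro countable_SIGMA countable_PiE) (auto simp: countable_rat)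
  then have "countable C"
    by (rule countable_subset[rotated]) (auto simp: C_def)
  moreover have "AE \<omega> in M. \<omega> \<notin> ?B (fst c) (snd c)" if "c \<in> C" for c
  proof (rule AE_not_in[OF null_setsI])
    show "emeasure M (?B (fst c) (snd c)) = 0"
      using that by (simp add: C_def case_prod_beta emeasure_eq_measure)
    show "?B (fst c) (snd c) \<in> sets M"
      by (rule L2_ball_measurable[OF X])
  qed
  ultimately have "AE \<omega> in M. \<forall>c\<in>C. \<omega> \<notin> ?B (fst c) (snd c)"
    by (subst AE_ball_countable) auto
  then show ?thesis
  proof (rule AE_mp, intro AE_I2 impI)
    fix \<omega> assume \<omega>: "\<omega> \<in> space M" and *: "\<forall>c\<in>C. \<omega> \<notin> ?B (fst c) (snd c)"
    let ?x = "X \<omega>"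
    have x: "?x \<in> space (cov_space p)"
      by (rule measurable_space[OF X \<omega>])
    show "?x \<in> support M p X"
    proof (rule ccontr)
      assume "?x \<notin> support M p X"
      then obtain r where r: "r > 0" "prob (?B ?x r) = 0"
        using x unfolding support_def by (auto simp: not_less measure_le_0_iff)
      obtain s where s: "s \<in> \<rat>" "0 < s" "s < r / 2"
        using Rats_dense_in_real[of 0 "r/2"] r by auto
      \<comment> \<open>With accuracy s / (p + 1) in each coordinate, the p errors add up to
        strictly less than s, also for p = 0.\<close>
      have "\<exists>q\<in>\<rat>. \<bar>?x j - q\<bar> < s / (real p + 1)" for j
      proof -
        have "?x j < ?x j + s / (real p + 1)"
          using s by simp
        from Rats_dense_in_real[OF this] obtain q where "q \<in> \<rat>" "?x j < q" "q < ?x j + s / (real p + 1)"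
          by blast
        then show ?thesis
          by (intro bexI[of _ q]) linarith+
      qed
      then obtain q0 where q0: "\<And>j. q0 j \<in> \<rat>" "\<And>j. \<bar>?x j - q0 j\<bar> < s / (real p + 1)"
        by metis
      \<comment> \<open>The centres in \<open>C\<close> are extensional, which is what keeps
        \<open>C\<close> countable; hence the restriction.\<close>
      define q where "q = restrict q0 {..<p}"
      have "L2_set (\<lambda>j. ?x j - q j) {..<p} \<le> (\<Sum>j<p. \<bar>?x j - q j\<bar>)"
        by (rule L2_set_le_sum_abs)
      also have "\<dots> \<le> (\<Sum>j<p. s / (real p + 1))"
        by (intro sum_mono less_imp_le) (simp add: q_def q0(2))
      also have "\<dots> < s"
        using s by (simp add: field_simps)
      finally have near: "L2_set (\<lambda>j. ?x j - q j) {..<p} < s" .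
      have "?B q s \<subseteq> ?B ?x r"
      proof safe
        fix \<eta> assume "L2_set (\<lambda>j. X \<eta> j - q j) {..<p} < s"
        moreover have "L2_set (\<lambda>j. X \<eta> j - ?x j) {..<p} =
            L2_set (\<lambda>j. (X \<eta> j - q j) + (q j - ?x j)) {..<p}"
          by simp
        moreover have "\<dots> \<le> L2_set (\<lambda>j. X \<eta> j - q j) {..<p} + L2_set (\<lambda>j. q j - ?x j) {..<p}"
          by (rule L2_set_triangle_ineq)
        moreover have "L2_set (\<lambda>j. q j - ?x j) {..<p} = L2_set (\<lambda>j. ?x j - q j) {..<p}"
          by (simp add: L2_set_def power2_commute)
        ultimately show "L2_set (\<lambda>j. X \<eta> j - ?x j) {..<p} < r"
          using near s by linarith
      qed
      then have "prob (?B q s) \<le> prob (?B ?x r)"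
        by (intro finite_measure_mono) auto
      then have "prob (?B q s) = 0"
        using r(2) by (simp add: measure_le_0_iff)
      then have "(q, s) \<in> C"
        using q0 s by (simp add: C_def q_def)
      with * have "\<omega> \<notin> ?B (fst (q, s)) (snd (q, s))"
        by blast
      then have "\<omega> \<notin> ?B q s"
        by simp
      then show False
        using near \<omega> by blast
    qed
  qed
qed

section \<open>Products and differences of square-integrable functions\<close>

lemma integrable_mult_L2:
  fixes f g :: "'a \<Rightarrow> real"
  assumes [measurable]: "f \<in> borel_measurable M" "g \<in> borel_measurable M"
    and "integrable M (\<lambda>\<omega>. (f \<omega>)\<^sup>2)" "integrable M (\<lambda>\<omega>. (g \<omega>)\<^sup>2)"
  shows "integrable M (\<lambda>\<omega>. f \<omega> * g \<omega>)"
proof (rule Bochner_Integration.integrable_bound)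
  show "integrable M (\<lambda>\<omega>. (f \<omega>)\<^sup>2 + (g \<omega>)\<^sup>2)"
    using assms by simp
  have "\<bar>x * y\<bar> \<le> x\<^sup>2 + y\<^sup>2" for x y :: real
  proof -
    have "2 * (\<bar>x\<bar> * \<bar>y\<bar>) \<le> x\<^sup>2 + y\<^sup>2"
      using sum_squares_bound[of "\<bar>x\<bar>" "\<bar>y\<bar>"] by (simp add: mult.assoc)
    moreover have "0 \<le> \<bar>x\<bar> * \<bar>y\<bar>"
      by simp
    ultimately show ?thesis
      unfolding abs_mult by linarith
  qed
  then show "AE \<omega> in M. norm (f \<omega> * g \<omega>) \<le> norm ((f \<omega>)\<^sup>2 + (g \<omega>)\<^sup>2)"
    by simp
qed measurable

lemma integrable_diff_L2:
  fixes f g :: "'a \<Rightarrow> real"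
  assumes [measurable]: "f \<in> borel_measurable M" "g \<in> borel_measurable M"
    and "integrable M (\<lambda>\<omega>. (f \<omega>)\<^sup>2)" "integrable M (\<lambda>\<omega>. (g \<omega>)\<^sup>2)"
  shows "integrable M (\<lambda>\<omega>. (f \<omega> - g \<omega>)\<^sup>2)"
proof -
  have "integrable M (\<lambda>\<omega>. (f \<omega>)\<^sup>2 + (g \<omega>)\<^sup>2 - 2 * (f \<omega> * g \<omega>))"
    using assms integrable_mult_L2[OF assms] by simp
  then show ?thesis
    by (simp add: power2_diff mult.assoc)
qed

subsection \<open>Moments of the score\<close>

locale dr_population = prob_space M for M :: "'a measure" +
  fixes p :: nat and R Y :: "'a \<Rightarrow> real" and X :: "'a \<Rightarrow> covariate"
    and m ps mu :: "covariate \<Rightarrow> real" and s1 s2 :: real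
  assumes pop: "population M p R Y X m ps"
    and ign: "ignorable M p R Y X"
    and basic: "basic_assumption s1 s2 M p R Y X m mu"
    and mu [measurable]: "mu \<in> borel_measurable (cov_space p)"
    and s1: "s1 > 0" and s2: "s2 > 0"
begin

section \<open>Conditioning on the covariate; range of the propensity score and of
  \<open>a\<close>\<close>

abbreviation G where "G \<equiv> sigma_of M p X"
abbreviation a where "a \<equiv> aN M X ps"

lemma R_meas [measurable]: "R \<in> borel_measurable M"
  and Y_meas [measurable]: "Y \<in> borel_measurable M"
  and X_meas [measurable]: "X \<in> measurable M (cov_space p)"
  and m_meas [measurable]: "m \<in> borel_measurable (cov_space p)"
  and ps_meas [measurable]: "ps \<in> borel_measurable (cov_space p)"
  and R01: "\<omega> \<in> space M \<Longrightarrow> R \<omega> = 0 \<or> R \<omega> = 1"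
  and Y_int: "integrable M Y"
  using pop by (auto simp: population_def cond_mean_def)

lemma Y2_int: "integrable M (\<lambda>\<omega>. (Y \<omega>)\<^sup>2)"
  and var_Y: "variance Y \<le> s2"
  using basic by (auto simp: basic_assumption_def)

lemma subalg: "subalgebra M G"
  unfolding subalgebra_def sigma_of_def
  by (auto simp: sets_vimage_algebra2[OF measurable_space[OF X_meas, THEN funcsetI]]
      intro: measurable_sets)

sublocale G: sigma_finite_subalgebra M G
  by (rule finite_measure_subalgebra_is_sigma_finite) (unfold_locales, rule subalg)

lemma X_G: "X \<in> measurable G (cov_space p)"
  unfolding sigma_of_def
  by (rule measurable_vimage_algebra1) (use measurable_space[OF X_meas] in auto)

lemma G_fun: "g \<in> borel_measurable (cov_space p) \<Longrightarrow> (\<lambda>\<omega>. g (X \<omega>)) \<in> borel_measurable G"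
  by (rule measurable_compose[OF X_G])

lemma cond_m: "AE \<omega> in M. real_cond_exp M G Y \<omega> = m (X \<omega>)"
  and cond_ps: "AE \<omega> in M. real_cond_exp M G (\<lambda>\<omega>. indicator {1} (R \<omega>)) \<omega> = ps (X \<omega>)"
  using pop by (auto simp: population_def cond_mean_def)

lemma ind_int: "integrable M (\<lambda>\<omega>. indicator {1} (R \<omega>) :: real)"
  by (rule integrable_const_bound[where B=1]) (auto split: split_indicator)

lemma ps_int: "integrable M (\<lambda>\<omega>. ps (X \<omega>))"
  by (rule integrable_cong_AE_imp[OF G.real_cond_exp_int(1)[OF ind_int]]) (use cond_ps in auto)

text \<open>An integrable function is finite almost everywhere, and \<open>ennreal\<close> sends
  every nonpositive number to 0, whose inverse is infinite.\<close>

lemma ps_pos: "AE \<omega> in M. 0 < ps (X \<omega>)"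
proof -
  have "AE \<omega> in M. inverse (ennreal (ps (X \<omega>))) \<noteq> \<infinity>"
    using pop by (intro nn_integral_noteq_infinite) (auto simp: population_def)
  then show ?thesis
    by eventually_elim (auto simp: not_le[symmetric] ennreal_neg)
qed

lemma ps_le_1: "AE \<omega> in M. ps (X \<omega>) \<le> 1"
proof -
  have "AE \<omega> in M. real_cond_exp M G (\<lambda>\<omega>. indicator {1} (R \<omega>)) \<omega> \<le> 1"
    by (rule G.real_cond_exp_le_c) (auto intro!: ind_int split: split_indicator)
  with cond_ps show ?thesis by eventually_elim auto
qed

lemma nn_inverse_ps: "(\<integral>\<^sup>+\<omega>. ennreal (1 / ps (X \<omega>)) \<partial>M) = ennreal (1 / a)"
proof -
  have "(\<integral>\<^sup>+\<omega>. ennreal (1 / ps (X \<omega>)) \<partial>M) = (\<integral>\<^sup>+\<omega>. inverse (ennreal (ps (X \<omega>))) \<partial>M)"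
    by (rule nn_integral_cong_AE) (use ps_pos in \<open>eventually_elim, simp add: inverse_ennreal field_simps\<close>)
  also have "\<dots> = ennreal (1 / a)"
    using pop by (simp add: aN_def population_def)
  finally show ?thesis .
qed

lemma inverse_ps_int: "integrable M (\<lambda>\<omega>. 1 / ps (X \<omega>))"
  by (rule integrableI_nonneg) (use ps_pos nn_inverse_ps in auto)

lemma inverse_a: "1 \<le> 1 / a"
proof -
  have "ennreal 1 = (\<integral>\<^sup>+\<omega>. 1 \<partial>M)"
    by (simp add: emeasure_space_1)
  also have "\<dots> \<le> (\<integral>\<^sup>+\<omega>. ennreal (1 / ps (X \<omega>)) \<partial>M)"
    by (rule nn_integral_mono_AE)
      (use ps_pos ps_le_1 in \<open>eventually_elim, auto simp: field_simps simp flip: ennreal_1\<close>)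
  finally show ?thesis
    by (subst (asm) nn_inverse_ps) (subst (asm) ennreal_le_iff, auto simp: aN_def)
qed

text \<open>As 1 / 0 = 0, the bound 1 \<le> 1 / a excludes a = 0 as well as negative values.\<close>

lemma a_pos: "0 < a" and a_le_1: "a \<le> 1"
  using inverse_a by (auto simp: le_divide_eq split: if_splits)

lemma integral_inverse_ps: "(\<integral>\<omega>. 1 / ps (X \<omega>) \<partial>M) = 1 / a"
  by (rule integral_eq_nn_integral[THEN trans]) (use ps_pos nn_inverse_ps a_pos in auto)

section \<open>Inverse propensity weighting as a change of measure\<close>

lemma ipw_rectangle:
  assumes [measurable]: "A \<in> sets borel" "B \<in> sets (cov_space p)"
  shows "(\<integral>\<^sup>+\<omega>. ennreal (R \<omega>) * indicator A (Y \<omega>) * indicator B (X \<omega>) \<partial>M) =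
    (\<integral>\<^sup>+\<omega>. ennreal (ps (X \<omega>)) * indicator A (Y \<omega>) * indicator B (X \<omega>) \<partial>M)"
proof -
  let ?R = "\<lambda>\<omega>. indicator {1} (R \<omega>) :: real" and ?A = "\<lambda>\<omega>. indicator A (Y \<omega>) :: real"
    and ?B = "\<lambda>\<omega>. indicator B (X \<omega>) :: real"
  have "{1::real} \<in> sets borel" by simp
  then have ign': "AE \<omega> in M. real_cond_exp M G (\<lambda>\<omega>. ?R \<omega> * ?A \<omega>) \<omega> =
     real_cond_exp M G ?R \<omega> * real_cond_exp M G ?A \<omega>"
    using ign unfolding ignorable_def by (auto simp: assms(1))
  have int1: "integrable M (\<lambda>\<omega>. ?B \<omega> * (?R \<omega> * ?A \<omega>))"
    by (rule integrable_const_bound[where B=1]) (auto split: split_indicator)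
  have int2: "integrable M (\<lambda>\<omega>. (?B \<omega> * ps (X \<omega>)) * ?A \<omega>)"
    by (rule Bochner_Integration.integrable_bound[OF ps_int]) (auto split: split_indicator)
  \<comment> \<open>Condition on X to let ignorability split the product, replace the conditional
    mean of R by \<open>ps\<close>, and remove the conditioning of the remaining factor, since
    \<open>?B\<close> and \<open>ps\<close> are functions of X.\<close>
  have "(\<integral>\<omega>. ?B \<omega> * (?R \<omega> * ?A \<omega>) \<partial>M) = (\<integral>\<omega>. ?B \<omega> * real_cond_exp M G (\<lambda>\<omega>. ?R \<omega> * ?A \<omega>) \<omega> \<partial>M)"
    by (rule G.real_cond_exp_intg(2)[OF int1, symmetric])
      (auto intro: G_fun[of "indicator B"])
  also have "\<dots> = (\<integral>\<omega>. (?B \<omega> * ps (X \<omega>)) * real_cond_exp M G ?A \<omega> \<partial>M)"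
    by (rule integral_cong_AE) (use ign' cond_ps in \<open>auto intro: borel_measurable_cond_exp2\<close>)
  also have "\<dots> = (\<integral>\<omega>. (?B \<omega> * ps (X \<omega>)) * ?A \<omega> \<partial>M)"
    by (rule G.real_cond_exp_intg(2)[OF int2])
      (auto intro: G_fun[of "\<lambda>x. indicator B x * ps x"])
  finally have eq: "(\<integral>\<omega>. ?B \<omega> * (?R \<omega> * ?A \<omega>) \<partial>M) = (\<integral>\<omega>. (?B \<omega> * ps (X \<omega>)) * ?A \<omega> \<partial>M)" .
  have "(\<integral>\<^sup>+\<omega>. ennreal (R \<omega>) * indicator A (Y \<omega>) * indicator B (X \<omega>) \<partial>M) =
      (\<integral>\<^sup>+\<omega>. ennreal (?B \<omega> * (?R \<omega> * ?A \<omega>)) \<partial>M)"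
    by (rule nn_integral_cong) (auto split: split_indicator dest: R01)
  also have "\<dots> = ennreal (\<integral>\<omega>. ?B \<omega> * (?R \<omega> * ?A \<omega>) \<partial>M)"
    by (rule nn_integral_eq_integral[OF int1]) auto
  also have "\<dots> = (\<integral>\<^sup>+\<omega>. ennreal ((?B \<omega> * ps (X \<omega>)) * ?A \<omega>) \<partial>M)"
    unfolding eq
    by (rule nn_integral_eq_integral[OF int2, symmetric])
      (use ps_pos in \<open>eventually_elim, auto split: split_indicator\<close>)
  also have "\<dots> = (\<integral>\<^sup>+\<omega>. ennreal (ps (X \<omega>)) * indicator A (Y \<omega>) * indicator B (X \<omega>) \<partial>M)"
    by (rule nn_integral_cong) (auto split: split_indicator)
  finally show ?thesis .
qed

text \<open>Rectangles are an intersection-stable generator, so agreement on them suffices once the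
  total mass is finite. The weights are R and \<open>ps\<close>, with the division by
  \<open>ps\<close> postponed, because R \<le> 1 makes this mass visibly finite.\<close>

lemma weighted_distr:
  "distr (density M (\<lambda>\<omega>. ennreal (R \<omega>))) (borel \<Otimes>\<^sub>M cov_space p) (\<lambda>\<omega>. (Y \<omega>, X \<omega>)) =
   distr (density M (\<lambda>\<omega>. ennreal (ps (X \<omega>)))) (borel \<Otimes>\<^sub>M cov_space p) (\<lambda>\<omega>. (Y \<omega>, X \<omega>))"
  (is "?L = ?R")
proof (rule measure_eqI_generator_eq)
  let ?E = "{A \<times> B | A B. A \<in> sets borel \<and> B \<in> sets (cov_space p)} :: (real \<times> covariate) set set"
  let ?\<Omega> = "space borel \<times> space (cov_space p) :: (real \<times> covariate) set"
  have rect: "emeasure (distr (density M (\<lambda>\<omega>. ennreal (w \<omega>))) (borel \<Otimes>\<^sub>M cov_space p) (\<lambda>\<omega>. (Y \<omega>, X \<omega>))) (A \<times> B) =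
    (\<integral>\<^sup>+\<omega>. ennreal (w \<omega>) * indicator A (Y \<omega>) * indicator B (X \<omega>) \<partial>M)"
    if [measurable]: "A \<in> sets borel" "B \<in> sets (cov_space p)" "w \<in> borel_measurable M" for A B w
    by (subst emeasure_distr, measurable, subst emeasure_density, measurable)
      (auto intro!: nn_integral_cong split: split_indicator)
  show "Int_stable ?E" by (rule Int_stable_pair_measure_generator)
  show "?E \<subseteq> Pow ?\<Omega>" using sets.sets_into_space by fastforce
  show "emeasure ?L Z = emeasure ?R Z" if "Z \<in> ?E" for Z
    using that ipw_rectangle by (auto simp: rect)
  show "sets ?L = sigma_sets ?\<Omega> ?E" "sets ?R = sigma_sets ?\<Omega> ?E"
    by (simp_all add: sets_pair_measure)
  show "range (\<lambda>_::nat. ?\<Omega>) \<subseteq> ?E" using sets.top by blast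
  show "(\<Union>i::nat. ?\<Omega>) = ?\<Omega>" by auto
  have "emeasure ?L ?\<Omega> \<le> (\<integral>\<^sup>+\<omega>. 1 \<partial>M)"
    by (subst rect, simp, simp, measurable, rule nn_integral_mono)
      (auto split: split_indicator dest: R01)
  then show "emeasure ?L ?\<Omega> \<noteq> \<infinity>" for i :: nat
    by (auto simp: emeasure_space_1 top_unique)
qed

text \<open>The factor 1 / ps is a function of X and can be absorbed into the integrand. After R has
  been exchanged for \<open>ps\<close>, it cancels \<open>ps\<close>, which is positive almost
  surely.\<close>

lemma nn_ipw:
  assumes [measurable]: "f \<in> borel_measurable (borel \<Otimes>\<^sub>M cov_space p)"
  shows "(\<integral>\<^sup>+\<omega>. ennreal (R \<omega> / ps (X \<omega>)) * f (Y \<omega>, X \<omega>) \<partial>M) = (\<integral>\<^sup>+\<omega>. f (Y \<omega>, X \<omega>) \<partial>M)"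
proof -
  let ?f = "\<lambda>(y, x). ennreal (1 / ps x) * f (y, x)"
  have f: "?f \<in> borel_measurable (borel \<Otimes>\<^sub>M cov_space p)"
    by measurable
  have *: "(\<integral>\<^sup>+\<omega>. ennreal (w \<omega>) * ?f (Y \<omega>, X \<omega>) \<partial>M) =
      (\<integral>\<^sup>+z. ?f z \<partial>distr (density M (\<lambda>\<omega>. ennreal (w \<omega>))) (borel \<Otimes>\<^sub>M cov_space p) (\<lambda>\<omega>. (Y \<omega>, X \<omega>)))"
    if [measurable]: "w \<in> borel_measurable M" for w
  proof -
    have "(\<integral>\<^sup>+z. ?f z \<partial>distr (density M (\<lambda>\<omega>. ennreal (w \<omega>))) (borel \<Otimes>\<^sub>M cov_space p) (\<lambda>\<omega>. (Y \<omega>, X \<omega>))) =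
        (\<integral>\<^sup>+\<omega>. ?f (Y \<omega>, X \<omega>) \<partial>density M (\<lambda>\<omega>. ennreal (w \<omega>)))"
      by (rule nn_integral_distr) (use f in auto)
    also have "\<dots> = (\<integral>\<^sup>+\<omega>. ennreal (w \<omega>) * ?f (Y \<omega>, X \<omega>) \<partial>M)"
      by (rule nn_integral_density) measurable
    finally show ?thesis by simp
  qed
  have "(\<integral>\<^sup>+\<omega>. ennreal (R \<omega> / ps (X \<omega>)) * f (Y \<omega>, X \<omega>) \<partial>M) = (\<integral>\<^sup>+\<omega>. ennreal (R \<omega>) * ?f (Y \<omega>, X \<omega>) \<partial>M)"
    by (rule nn_integral_cong_AE)
      (use ps_pos AE_space in \<open>eventually_elim, auto dest!: R01\<close>)
  also have "\<dots> = (\<integral>\<^sup>+\<omega>. ennreal (ps (X \<omega>)) * ?f (Y \<omega>, X \<omega>) \<partial>M)"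
    by (simp only: * R_meas measurable_compose[OF X_meas ps_meas] weighted_distr)
  also have "\<dots> = (\<integral>\<^sup>+\<omega>. f (Y \<omega>, X \<omega>) \<partial>M)"
    by (rule nn_integral_cong_AE)
      (use ps_pos in \<open>eventually_elim, auto simp: mult.assoc[symmetric] ennreal_mult'[symmetric]\<close>)
  finally show ?thesis .
qed

text \<open>An identity of laws transfers integrability and integrals of signed functions too, which
  the identity for nonnegative integrands does not do directly.\<close>

lemma ipw_distr:
  "distr (density M (\<lambda>\<omega>. ennreal (R \<omega> / ps (X \<omega>)))) (borel \<Otimes>\<^sub>M cov_space p) (\<lambda>\<omega>. (Y \<omega>, X \<omega>)) =
   distr M (borel \<Otimes>\<^sub>M cov_space p) (\<lambda>\<omega>. (Y \<omega>, X \<omega>))" (is "?L = ?R")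
proof (rule measure_eqI)
  fix A assume "A \<in> sets ?L"
  then have [measurable]: "A \<in> sets (borel \<Otimes>\<^sub>M cov_space p)" by simp
  have "emeasure ?L A = (\<integral>\<^sup>+\<omega>. ennreal (R \<omega> / ps (X \<omega>)) * indicator A (Y \<omega>, X \<omega>) \<partial>M)"
    by (subst emeasure_distr, measurable, subst emeasure_density, measurable)
      (auto intro!: nn_integral_cong split: split_indicator)
  also have "\<dots> = (\<integral>\<^sup>+\<omega>. indicator A (Y \<omega>, X \<omega>) \<partial>M)"
    by (rule nn_ipw) measurable
  also have "\<dots> = emeasure ?R A"
    by (subst nn_integral_distr[of "\<lambda>\<omega>. (Y \<omega>, X \<omega>)" M "borel \<Otimes>\<^sub>M cov_space p" "indicator A", symmetric]) auto
  finally show "emeasure ?L A = emeasure ?R A" .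
qed simp

lemma
  fixes f :: "real \<times> covariate \<Rightarrow> real"
  assumes [measurable]: "f \<in> borel_measurable (borel \<Otimes>\<^sub>M cov_space p)"
    and int: "integrable M (\<lambda>\<omega>. f (Y \<omega>, X \<omega>))"
  shows ipw_integrable: "integrable M (\<lambda>\<omega>. R \<omega> / ps (X \<omega>) * f (Y \<omega>, X \<omega>))"
    and ipw_integral: "(\<integral>\<omega>. R \<omega> / ps (X \<omega>) * f (Y \<omega>, X \<omega>) \<partial>M) = (\<integral>\<omega>. f (Y \<omega>, X \<omega>) \<partial>M)"
proof -
  let ?D = "density M (\<lambda>\<omega>. ennreal (R \<omega> / ps (X \<omega>)))"
  have nn: "AE \<omega> in M. 0 \<le> R \<omega> / ps (X \<omega>)"
    using ps_pos AE_space by eventually_elim (use R01 in force)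
  have "integrable ?D (\<lambda>\<omega>. f (Y \<omega>, X \<omega>))"
    using int by (subst integrable_distr_eq[where g="\<lambda>\<omega>. (Y \<omega>, X \<omega>)" and N="borel \<Otimes>\<^sub>M cov_space p", symmetric],
        measurable, subst ipw_distr, subst integrable_distr_eq) auto
  then show "integrable M (\<lambda>\<omega>. R \<omega> / ps (X \<omega>) * f (Y \<omega>, X \<omega>))"
    by (subst (asm) integrable_density) (use nn in auto)
  have "(\<integral>\<omega>. R \<omega> / ps (X \<omega>) * f (Y \<omega>, X \<omega>) \<partial>M) = (\<integral>\<omega>. f (Y \<omega>, X \<omega>) \<partial>?D)"
    by (subst integral_density) (use nn in auto)
  also have "\<dots> = (\<integral>\<omega>. f (Y \<omega>, X \<omega>) \<partial>M)"
    by (subst (1 2) integral_distr[where g="\<lambda>\<omega>. (Y \<omega>, X \<omega>)" and N="borel \<Otimes>\<^sub>M cov_space p", symmetric],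
        simp_all add: ipw_distr)
  finally show "(\<integral>\<omega>. R \<omega> / ps (X \<omega>) * f (Y \<omega>, X \<omega>) \<partial>M) = (\<integral>\<omega>. f (Y \<omega>, X \<omega>) \<partial>M)" .
qed

section \<open>Weighted second moments of residuals\<close>

lemma residual_upper:
  assumes [measurable]: "w \<in> borel_measurable (cov_space p)"
  shows "(\<integral>\<^sup>+\<omega>. w (X \<omega>) * ennreal ((Y \<omega> - mu (X \<omega>))\<^sup>2) \<partial>M) \<le> ennreal s2 * (\<integral>\<^sup>+\<omega>. w (X \<omega>) \<partial>M)"
proof -
  obtain g where g: "cond_mean_nonneg M p X (\<lambda>\<omega>. (Y \<omega> - mu (X \<omega>))\<^sup>2) g"
      "\<forall>x\<in>support M p X. g x \<le> ennreal s2"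
    using basic by (auto simp: basic_assumption_def)
  let ?c = "nn_cond_exp M G (\<lambda>\<omega>. ennreal ((Y \<omega> - mu (X \<omega>))\<^sup>2))"
  have "(\<integral>\<^sup>+\<omega>. w (X \<omega>) * ennreal ((Y \<omega> - mu (X \<omega>))\<^sup>2) \<partial>M) = (\<integral>\<^sup>+\<omega>. w (X \<omega>) * ?c \<omega> \<partial>M)"
    by (rule G.nn_cond_exp_intg[symmetric]) (auto intro: G_fun[OF assms])
  \<comment> \<open>The bound on the conditional second moment is available on the support only, and
    \<open>X\<close> lies there almost surely.\<close>
  also have "\<dots> \<le> (\<integral>\<^sup>+\<omega>. ennreal s2 * w (X \<omega>) \<partial>M)"
    using g(1) AE_in_support[OF X_meas]
    by (intro nn_integral_mono_AE)
      (auto simp: cond_mean_nonneg_def mult.commute[of "ennreal s2"] intro!: mult_left_mono g(2)[rule_format])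
  also have "\<dots> = ennreal s2 * (\<integral>\<^sup>+\<omega>. w (X \<omega>) \<partial>M)"
    by (rule nn_integral_cmult) measurable
  finally show ?thesis .
qed

lemma residual_lower_m:
  assumes [measurable]: "w \<in> borel_measurable (cov_space p)"
  shows "ennreal s1 * (\<integral>\<^sup>+\<omega>. w (X \<omega>) \<partial>M) \<le> (\<integral>\<^sup>+\<omega>. w (X \<omega>) * ennreal ((Y \<omega> - m (X \<omega>))\<^sup>2) \<partial>M)"
proof -
  obtain g where g: "cond_mean_nonneg M p X (\<lambda>\<omega>. (Y \<omega> - m (X \<omega>))\<^sup>2) g"
      "\<forall>x\<in>support M p X. ennreal s1 \<le> g x"
    using basic by (auto simp: basic_assumption_def)
  let ?c = "nn_cond_exp M G (\<lambda>\<omega>. ennreal ((Y \<omega> - m (X \<omega>))\<^sup>2))"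
  have "ennreal s1 * (\<integral>\<^sup>+\<omega>. w (X \<omega>) \<partial>M) = (\<integral>\<^sup>+\<omega>. ennreal s1 * w (X \<omega>) \<partial>M)"
    by (rule nn_integral_cmult[symmetric]) measurable
  also have "\<dots> \<le> (\<integral>\<^sup>+\<omega>. w (X \<omega>) * ?c \<omega> \<partial>M)"
    using g(1) AE_in_support[OF X_meas]
    by (intro nn_integral_mono_AE)
      (auto simp: cond_mean_nonneg_def mult.commute[of "ennreal s1"] intro!: mult_left_mono g(2)[rule_format])
  also have "\<dots> = (\<integral>\<^sup>+\<omega>. w (X \<omega>) * ennreal ((Y \<omega> - m (X \<omega>))\<^sup>2) \<partial>M)"
    by (rule G.nn_cond_exp_intg) (auto intro: G_fun[OF assms])
  finally show ?thesis .
qed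

text \<open>Jensen's inequality for conditional expectations.\<close>

lemma m2_int: "integrable M (\<lambda>\<omega>. (m (X \<omega>))\<^sup>2)"
proof -
  have "integrable M (\<lambda>\<omega>. (real_cond_exp M G Y \<omega>)\<^sup>2)"
    by (rule G.integrable_convex_cond_exp[where X=Y and I=UNIV and q="\<lambda>x. x\<^sup>2"])
      (auto intro: Y_int Y2_int convex_power2)
  then show ?thesis
    by (rule integrable_cong_AE_imp) (use cond_m in auto)
qed

text \<open>Around any function \<open>nu\<close> of X the weighted square error exceeds that around
  \<open>m\<close> by the weighted mean of (m - nu)^2: the cross term vanishes because Y - m has
  conditional mean 0. Boundedness of the weight makes every term of this expansion
  integrable.\<close>

lemma residual_lower_bounded:
  assumes [measurable]: "w \<in> borel_measurable (cov_space p)" "nu \<in> borel_measurable (cov_space p)"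
    and w: "\<And>x. 0 \<le> w x" "\<And>x. w x \<le> B"
    and int: "integrable M (\<lambda>\<omega>. (Y \<omega> - nu (X \<omega>))\<^sup>2)"
  shows "ennreal s1 * (\<integral>\<^sup>+\<omega>. ennreal (w (X \<omega>)) \<partial>M) \<le>
    (\<integral>\<^sup>+\<omega>. ennreal (w (X \<omega>) * (Y \<omega> - nu (X \<omega>))\<^sup>2) \<partial>M)"
proof -
  let ?d = "\<lambda>\<omega>. m (X \<omega>) - nu (X \<omega>)"
  have bdd: "integrable M (\<lambda>\<omega>. w (X \<omega>) * f \<omega>)" if "integrable M f" for f
  proof (rule Bochner_Integration.integrable_bound)
    show "integrable M (\<lambda>\<omega>. B * f \<omega>)"
      using that by simp
    show "(\<lambda>\<omega>. w (X \<omega>) * f \<omega>) \<in> borel_measurable M"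
      using that by measurable
    show "AE \<omega> in M. norm (w (X \<omega>) * f \<omega>) \<le> norm (B * f \<omega>)"
      using w order_trans[OF w] by (auto simp: abs_mult intro!: mult_right_mono)
  qed
  have Ym: "integrable M (\<lambda>\<omega>. (Y \<omega> - m (X \<omega>))\<^sup>2)"
    by (rule integrable_diff_L2) (auto intro: Y2_int m2_int)
  \<comment> \<open>The difference of the two residuals is m - nu, which thus inherits their square
    integrability.\<close>
  have "integrable M (\<lambda>\<omega>. ((Y \<omega> - nu (X \<omega>)) - (Y \<omega> - m (X \<omega>)))\<^sup>2)"
    by (rule integrable_diff_L2) (use int Ym in auto)
  then have d2: "integrable M (\<lambda>\<omega>. (?d \<omega>)\<^sup>2)"
    by simp
  have dY: "integrable M (\<lambda>\<omega>. w (X \<omega>) * ?d \<omega> * Y \<omega>)"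
    unfolding mult.assoc by (intro bdd integrable_mult_L2 d2 Y2_int) auto
  have dm: "integrable M (\<lambda>\<omega>. w (X \<omega>) * ?d \<omega> * m (X \<omega>))"
    unfolding mult.assoc by (intro bdd integrable_mult_L2 d2 m2_int) auto
  have "(\<integral>\<omega>. w (X \<omega>) * ?d \<omega> * Y \<omega> \<partial>M) =
      (\<integral>\<omega>. w (X \<omega>) * ?d \<omega> * real_cond_exp M G Y \<omega> \<partial>M)"
    by (rule G.real_cond_exp_intg(2)[symmetric])
      (auto intro: dY G_fun[of "\<lambda>x. w x * (m x - nu x)"])
  also have "\<dots> = (\<integral>\<omega>. w (X \<omega>) * ?d \<omega> * m (X \<omega>) \<partial>M)"
    by (rule integral_cong_AE) (use cond_m in \<open>auto intro: borel_measurable_cond_exp2\<close>)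
  finally have cross: "(\<integral>\<omega>. w (X \<omega>) * ?d \<omega> * Y \<omega> \<partial>M) = (\<integral>\<omega>. w (X \<omega>) * ?d \<omega> * m (X \<omega>) \<partial>M)" .
  have "(\<integral>\<omega>. w (X \<omega>) * (Y \<omega> - m (X \<omega>))\<^sup>2 \<partial>M) \<le>
      (\<integral>\<omega>. w (X \<omega>) * (Y \<omega> - m (X \<omega>))\<^sup>2 \<partial>M) + (\<integral>\<omega>. w (X \<omega>) * (?d \<omega>)\<^sup>2 \<partial>M) +
      2 * ((\<integral>\<omega>. w (X \<omega>) * ?d \<omega> * Y \<omega> \<partial>M) - (\<integral>\<omega>. w (X \<omega>) * ?d \<omega> * m (X \<omega>) \<partial>M))"
    using w by (simp add: cross)
  also have "\<dots> = (\<integral>\<omega>. w (X \<omega>) * (Y \<omega> - m (X \<omega>))\<^sup>2 + w (X \<omega>) * (?d \<omega>)\<^sup>2 +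
      2 * (w (X \<omega>) * ?d \<omega> * Y \<omega> - w (X \<omega>) * ?d \<omega> * m (X \<omega>)) \<partial>M)"
    using bdd[OF Ym] bdd[OF d2] dY dm by simp
  also have "\<dots> = (\<integral>\<omega>. w (X \<omega>) * (Y \<omega> - nu (X \<omega>))\<^sup>2 \<partial>M)"
    by (rule Bochner_Integration.integral_cong) (auto simp: power2_eq_square algebra_simps)
  finally have le: "(\<integral>\<omega>. w (X \<omega>) * (Y \<omega> - m (X \<omega>))\<^sup>2 \<partial>M) \<le> (\<integral>\<omega>. w (X \<omega>) * (Y \<omega> - nu (X \<omega>))\<^sup>2 \<partial>M)" .
  have "ennreal s1 * (\<integral>\<^sup>+\<omega>. ennreal (w (X \<omega>)) \<partial>M) \<le>
      (\<integral>\<^sup>+\<omega>. ennreal (w (X \<omega>)) * ennreal ((Y \<omega> - m (X \<omega>))\<^sup>2) \<partial>M)"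
    by (rule residual_lower_m) measurable
  also have "\<dots> = (\<integral>\<^sup>+\<omega>. ennreal (w (X \<omega>) * (Y \<omega> - m (X \<omega>))\<^sup>2) \<partial>M)"
    using w by (simp add: ennreal_mult)
  also have "\<dots> = ennreal (\<integral>\<omega>. w (X \<omega>) * (Y \<omega> - m (X \<omega>))\<^sup>2 \<partial>M)"
    by (rule nn_integral_eq_integral[OF bdd[OF Ym]]) (use w in auto)
  also have "\<dots> \<le> ennreal (\<integral>\<omega>. w (X \<omega>) * (Y \<omega> - nu (X \<omega>))\<^sup>2 \<partial>M)"
    by (rule ennreal_leI[OF le])
  also have "\<dots> = (\<integral>\<^sup>+\<omega>. ennreal (w (X \<omega>) * (Y \<omega> - nu (X \<omega>))\<^sup>2) \<partial>M)"
    by (rule nn_integral_eq_integral[OF bdd[OF int], symmetric]) (use w in auto)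
  finally show ?thesis .
qed

text \<open>The weight 1 / ps - 1 of the variance formula is unbounded. The previous bound is
  applied to \<open>min w n\<close> and passes to the limit by monotone convergence, its right-hand
  side staying below the integral with the full weight.\<close>

lemma residual_lower:
  assumes [measurable]: "w \<in> borel_measurable (cov_space p)" "nu \<in> borel_measurable (cov_space p)"
    and w: "\<And>x. 0 \<le> w x"
    and int: "integrable M (\<lambda>\<omega>. (Y \<omega> - nu (X \<omega>))\<^sup>2)"
  shows "ennreal s1 * (\<integral>\<^sup>+\<omega>. ennreal (w (X \<omega>)) \<partial>M) \<le>
    (\<integral>\<^sup>+\<omega>. ennreal (w (X \<omega>) * (Y \<omega> - nu (X \<omega>))\<^sup>2) \<partial>M)" (is "_ \<le> ?r")
proof -
  have "(\<lambda>n. \<integral>\<^sup>+\<omega>. ennreal (min (w (X \<omega>)) (real n)) \<partial>M) \<longlonglongrightarrow> (\<integral>\<^sup>+\<omega>. ennreal (w (X \<omega>)) \<partial>M)"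
  proof (rule nn_integral_LIMSEQ)
    show "incseq (\<lambda>n \<omega>. ennreal (min (w (X \<omega>)) (real n)))"
      by (auto simp: incseq_def le_fun_def intro!: ennreal_leI)
    fix \<omega>
    obtain n0 :: nat where "w (X \<omega>) \<le> real n0"
      using real_arch_simple by blast
    then have "\<forall>\<^sub>F n in sequentially. ennreal (min (w (X \<omega>)) (real n)) = ennreal (w (X \<omega>))"
      by (intro eventually_sequentiallyI[of n0]) (auto simp: min_def)
    then show "(\<lambda>n. ennreal (min (w (X \<omega>)) (real n))) \<longlonglongrightarrow> ennreal (w (X \<omega>))"
      by (rule tendsto_eventually)
  qed auto
  then have "(\<lambda>n. ennreal s1 * (\<integral>\<^sup>+\<omega>. ennreal (min (w (X \<omega>)) (real n)) \<partial>M)) \<longlonglongrightarrow>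
      ennreal s1 * (\<integral>\<^sup>+\<omega>. ennreal (w (X \<omega>)) \<partial>M)"
    by (intro tendsto_mult_ennreal tendsto_const) (use s1 in auto)
  then show ?thesis
  proof (rule LIMSEQ_le_const2, intro exI allI impI)
    fix n :: nat
    have "ennreal s1 * (\<integral>\<^sup>+\<omega>. ennreal (min (w (X \<omega>)) (real n)) \<partial>M) \<le>
        (\<integral>\<^sup>+\<omega>. ennreal (min (w (X \<omega>)) (real n) * (Y \<omega> - nu (X \<omega>))\<^sup>2) \<partial>M)"
      by (rule residual_lower_bounded[where B="real n"]) (use w int in auto)
    also have "\<dots> \<le> ?r"
      by (intro nn_integral_mono ennreal_leI mult_right_mono) auto
    finally show "ennreal s1 * (\<integral>\<^sup>+\<omega>. ennreal (min (w (X \<omega>)) (real n)) \<partial>M) \<le> ?r" .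
  qed
qed

section \<open>Mean and variance of the influence function\<close>

abbreviation \<theta> where "\<theta> \<equiv> expectation Y"
abbreviation \<psi> where "\<psi> \<equiv> psi M R Y X mu ps"

text \<open>The upper residual bound with weight 1 / ps, whose integral is 1 / a.\<close>

lemma residual_ps_int: "integrable M (\<lambda>\<omega>. (Y \<omega> - mu (X \<omega>))\<^sup>2 / ps (X \<omega>))"
  and residual_ps_le: "(\<integral>\<omega>. (Y \<omega> - mu (X \<omega>))\<^sup>2 / ps (X \<omega>) \<partial>M) \<le> s2 / a"
proof -
  have nn: "AE \<omega> in M. 0 \<le> (Y \<omega> - mu (X \<omega>))\<^sup>2 / ps (X \<omega>)"
    using ps_pos by eventually_elim auto
  have "(\<integral>\<^sup>+\<omega>. ennreal ((Y \<omega> - mu (X \<omega>))\<^sup>2 / ps (X \<omega>)) \<partial>M) =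
      (\<integral>\<^sup>+\<omega>. ennreal (1 / ps (X \<omega>)) * ennreal ((Y \<omega> - mu (X \<omega>))\<^sup>2) \<partial>M)"
    by (rule nn_integral_cong_AE) (use ps_pos in \<open>eventually_elim, simp flip: ennreal_mult'\<close>)
  also have "\<dots> \<le> ennreal s2 * ennreal (1 / a)"
    using residual_upper[of "\<lambda>x. ennreal (1 / ps x)"] by (simp add: nn_inverse_ps)
  also have "\<dots> = ennreal (s2 / a)"
    using s2 by (simp flip: ennreal_mult')
  finally have le: "(\<integral>\<^sup>+\<omega>. ennreal ((Y \<omega> - mu (X \<omega>))\<^sup>2 / ps (X \<omega>)) \<partial>M) \<le> ennreal (s2 / a)" .
  show int: "integrable M (\<lambda>\<omega>. (Y \<omega> - mu (X \<omega>))\<^sup>2 / ps (X \<omega>))"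
    by (rule integrableI_nonneg) (use nn le_less_trans[OF le] in auto)
  show "(\<integral>\<omega>. (Y \<omega> - mu (X \<omega>))\<^sup>2 / ps (X \<omega>) \<partial>M) \<le> s2 / a"
    using le s2 a_pos by (subst (asm) nn_integral_eq_integral[OF int nn]) simp
qed

lemma residual_int: "integrable M (\<lambda>\<omega>. (Y \<omega> - mu (X \<omega>))\<^sup>2)"
proof (rule Bochner_Integration.integrable_bound[OF residual_ps_int])
  show "AE \<omega> in M. norm ((Y \<omega> - mu (X \<omega>))\<^sup>2) \<le> norm ((Y \<omega> - mu (X \<omega>))\<^sup>2 / ps (X \<omega>))"
    using ps_pos ps_le_1 by eventually_elim (auto simp: divide_simps mult_left_le)
qed measurable

lemma centred_int: "integrable M (\<lambda>\<omega>. (Y \<omega> - \<theta>)\<^sup>2)"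
  by (rule integrable_diff_L2) (auto intro: Y2_int)

lemma psi_measurable [measurable]: "\<psi> \<in> borel_measurable M"
  unfolding psi_def by measurable

text \<open>With w = R / ps one has psi = (Y - \<theta>) + (w - 1) (Y - mu). The first term is
  centred, and the weight w does not change the mean of Y - mu.\<close>

lemma psi_mean: "expectation \<psi> = 0"
proof -
  let ?f = "\<lambda>(y, x). y - mu x"
  have int: "integrable M (\<lambda>\<omega>. ?f (Y \<omega>, X \<omega>))"
    using square_integrable_imp_integrable[OF _ residual_int] by simp
  have eq: "\<psi> = (\<lambda>\<omega>. (Y \<omega> - \<theta>) + (R \<omega> / ps (X \<omega>) * ?f (Y \<omega>, X \<omega>) - ?f (Y \<omega>, X \<omega>)))"
    by (auto simp: psi_def)
  have f: "?f \<in> borel_measurable (borel \<Otimes>\<^sub>M cov_space p)"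
    by measurable
  have comb: "expectation (\<lambda>\<omega>. (Y \<omega> - \<theta>) + (A \<omega> - B \<omega>)) = expectation A - expectation B"
    if "integrable M A" "integrable M B" for A B
    using that Y_int by (simp add: prob_space)
  show "expectation \<psi> = 0"
    unfolding eq using comb[OF ipw_integrable[OF f int] int] ipw_integral[OF f int] by linarith
qed

text \<open>Since R is 0 or 1, w^2 = w / ps, so (w - 1)^2 = w / ps - 2 w + 1. Every term of the
  expanded square is then either a function of (Y, X) or w times such a function, and inverse
  weighting removes w. The cross term with Y - \<theta> integrates to 0.\<close>

lemma psi2_int: "integrable M (\<lambda>\<omega>. (\<psi> \<omega>)\<^sup>2)"
  and psi2_integral: "(\<integral>\<omega>. (\<psi> \<omega>)\<^sup>2 \<partial>M) =
    variance Y + (\<integral>\<omega>. (1 / ps (X \<omega>) - 1) * (Y \<omega> - mu (X \<omega>))\<^sup>2 \<partial>M)"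
proof -
  let ?f2 = "\<lambda>(y, x). (y - \<theta>) * (y - mu x)" and ?f3 = "\<lambda>(y, x). (y - mu x)\<^sup>2"
    and ?f4 = "\<lambda>(y, x). (y - mu x)\<^sup>2 / ps x" and ?w = "\<lambda>\<omega>. R \<omega> / ps (X \<omega>)"
    and ?Z = "\<lambda>\<omega>. (Y \<omega>, X \<omega>)"
  have f2: "?f2 \<in> borel_measurable (borel \<Otimes>\<^sub>M cov_space p)" "integrable M (\<lambda>\<omega>. ?f2 (?Z \<omega>))"
    using integrable_mult_L2[OF _ _ centred_int residual_int] by simp_all
  have f3: "?f3 \<in> borel_measurable (borel \<Otimes>\<^sub>M cov_space p)" "integrable M (\<lambda>\<omega>. ?f3 (?Z \<omega>))"
    using residual_int by simp_all
  have f4: "?f4 \<in> borel_measurable (borel \<Otimes>\<^sub>M cov_space p)" "integrable M (\<lambda>\<omega>. ?f4 (?Z \<omega>))"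
    using residual_ps_int by simp_all
  define rhs where "rhs \<omega> = (Y \<omega> - \<theta>)\<^sup>2 + 2 * (?w \<omega> * ?f2 (?Z \<omega>) - ?f2 (?Z \<omega>)) +
      (?w \<omega> * ?f4 (?Z \<omega>) - 2 * (?w \<omega> * ?f3 (?Z \<omega>)) + ?f3 (?Z \<omega>))" for \<omega>
  have eq: "(\<psi> \<omega>)\<^sup>2 = rhs \<omega>" if "\<omega> \<in> space M" for \<omega>
    using R01[OF that]
    by (auto simp: psi_def rhs_def power2_eq_square algebra_simps diff_divide_distrib add_divide_distrib)
  have comb: "integrable M (\<lambda>\<omega>. A \<omega> + 2 * (B \<omega> - C \<omega>) + (D \<omega> - 2 * E \<omega> + F \<omega>)) \<and>
      (\<integral>\<omega>. A \<omega> + 2 * (B \<omega> - C \<omega>) + (D \<omega> - 2 * E \<omega> + F \<omega>) \<partial>M) = expectation A +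
        2 * (expectation B - expectation C) + (expectation D - 2 * expectation E + expectation F)"
    if "integrable M A" "integrable M B" "integrable M C" "integrable M D" "integrable M E" "integrable M F"
    for A B C D E F :: "'a \<Rightarrow> real"
    using that by simp
  note ints = comb[OF centred_int ipw_integrable[OF f2] f2(2) ipw_integrable[OF f4] ipw_integrable[OF f3] f3(2)]
  have "integrable M rhs"
    unfolding rhs_def using ints by blast
  then show "integrable M (\<lambda>\<omega>. (\<psi> \<omega>)\<^sup>2)"
    using eq by (simp cong: Bochner_Integration.integrable_cong)
  have "(\<integral>\<omega>. (\<psi> \<omega>)\<^sup>2 \<partial>M) = (\<integral>\<omega>. rhs \<omega> \<partial>M)"
    by (rule Bochner_Integration.integral_cong) (auto simp: eq)
  also have "\<dots> = variance Y + 2 * ((\<integral>\<omega>. ?w \<omega> * ?f2 (?Z \<omega>) \<partial>M) - (\<integral>\<omega>. ?f2 (?Z \<omega>) \<partial>M)) +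
      ((\<integral>\<omega>. ?w \<omega> * ?f4 (?Z \<omega>) \<partial>M) - 2 * (\<integral>\<omega>. ?w \<omega> * ?f3 (?Z \<omega>) \<partial>M) + (\<integral>\<omega>. ?f3 (?Z \<omega>) \<partial>M))"
    unfolding rhs_def using ints by blast
  also have "\<dots> = variance Y + ((\<integral>\<omega>. ?f4 (?Z \<omega>) \<partial>M) - (\<integral>\<omega>. ?f3 (?Z \<omega>) \<partial>M))"
    unfolding ipw_integral[OF f2] ipw_integral[OF f3] ipw_integral[OF f4] by simp
  also have "(\<integral>\<omega>. ?f4 (?Z \<omega>) \<partial>M) - (\<integral>\<omega>. ?f3 (?Z \<omega>) \<partial>M) =
      (\<integral>\<omega>. (1 / ps (X \<omega>) - 1) * (Y \<omega> - mu (X \<omega>))\<^sup>2 \<partial>M)"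
    using f3(2) f4(2) by (subst Bochner_Integration.integral_diff[symmetric]) (auto simp: algebra_simps)
  finally show "(\<integral>\<omega>. (\<psi> \<omega>)\<^sup>2 \<partial>M) =
    variance Y + (\<integral>\<omega>. (1 / ps (X \<omega>) - 1) * (Y \<omega> - mu (X \<omega>))\<^sup>2 \<partial>M)" .
qed

lemma var_psi: "variance \<psi> = (\<integral>\<omega>. (\<psi> \<omega>)\<^sup>2 \<partial>M)"
  by (simp add: psi_mean)

text \<open>One s2 / a comes from the residual term, the other from Var Y \<le> s2 \<le> s2 /
  a.\<close>

lemma var_psi_upper: "variance \<psi> \<le> 2 * s2 / a"
proof -
  have "(\<integral>\<omega>. (1 / ps (X \<omega>) - 1) * (Y \<omega> - mu (X \<omega>))\<^sup>2 \<partial>M) \<le>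
      (\<integral>\<omega>. (Y \<omega> - mu (X \<omega>))\<^sup>2 / ps (X \<omega>) \<partial>M)"
    using residual_int residual_ps_int by (intro integral_mono) (auto simp: algebra_simps)
  also note residual_ps_le
  also have "s2 \<le> s2 / a"
    using s2 a_pos a_le_1 by (simp add: field_simps)
  ultimately show ?thesis
    unfolding var_psi psi2_integral using var_Y by linarith
qed

text \<open>The lower residual bound is used twice: with weight 1 and the constant function \<theta>
  it gives Var Y \<ge> s1, and with weight 1 / ps - 1 it gives s1 (1 / a - 1). The sum is exactly s1
  / a.\<close>

lemma var_psi_lower: "s1 / a \<le> variance \<psi>"
proof -
  \<comment> \<open>The residual bound asks for a weight that is nonnegative everywhere, but 1 / ps
    - 1 is so only almost surely along \<open>X\<close>.\<close>
  let ?w = "\<lambda>x. max 0 (1 / ps x - 1)" and ?U = "\<lambda>\<omega>. (1 / ps (X \<omega>) - 1) * (Y \<omega> - mu (X \<omega>))\<^sup>2"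
  have w: "AE \<omega> in M. ?w (X \<omega>) = 1 / ps (X \<omega>) - 1"
    using ps_pos ps_le_1 by eventually_elim (auto simp: field_simps)
  have "ennreal s1 = ennreal s1 * (\<integral>\<^sup>+\<omega>. ennreal 1 \<partial>M)"
    by (simp add: emeasure_space_1)
  also have "\<dots> \<le> (\<integral>\<^sup>+\<omega>. ennreal (1 * (Y \<omega> - \<theta>)\<^sup>2) \<partial>M)"
    by (rule residual_lower[of "\<lambda>_. 1" "\<lambda>_. \<theta>"]) (use centred_int in auto)
  also have "\<dots> = ennreal (variance Y)"
    by (subst nn_integral_eq_integral) (use centred_int in auto)
  finally have 1: "s1 \<le> variance Y"
    by (simp add: ennreal_le_iff variance_positive)
  have U: "integrable M ?U"
    using residual_int residual_ps_int by (simp add: algebra_simps)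
  have wint: "integrable M (\<lambda>\<omega>. 1 / ps (X \<omega>) - 1)"
    using inverse_ps_int by simp
  have nn: "AE \<omega> in M. 0 \<le> 1 / ps (X \<omega>) - 1"
    using w by eventually_elim linarith
  have "ennreal (s1 * (1 / a - 1)) = ennreal s1 * ennreal (\<integral>\<omega>. 1 / ps (X \<omega>) - 1 \<partial>M)"
    using s1 inverse_ps_int by (simp add: integral_inverse_ps prob_space ennreal_mult')
  also have "\<dots> = ennreal s1 * (\<integral>\<^sup>+\<omega>. ennreal (1 / ps (X \<omega>) - 1) \<partial>M)"
    by (subst nn_integral_eq_integral[OF wint nn]) simp
  also have "\<dots> = ennreal s1 * (\<integral>\<^sup>+\<omega>. ennreal (?w (X \<omega>)) \<partial>M)"
    by (intro arg_cong2[where f="(*)"] refl nn_integral_cong_AE) (use w in auto)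
  also have "\<dots> \<le> (\<integral>\<^sup>+\<omega>. ennreal (?w (X \<omega>) * (Y \<omega> - mu (X \<omega>))\<^sup>2) \<partial>M)"
    by (rule residual_lower) (use residual_int in auto)
  also have "\<dots> = (\<integral>\<^sup>+\<omega>. ennreal (?U \<omega>) \<partial>M)"
    by (rule nn_integral_cong_AE) (use w in auto)
  also have "\<dots> = ennreal (\<integral>\<omega>. ?U \<omega> \<partial>M)"
    by (rule nn_integral_eq_integral[OF U]) (use nn in auto)
  finally have "s1 * (1 / a - 1) \<le> (\<integral>\<omega>. ?U \<omega> \<partial>M)"
    using nn by (subst (asm) ennreal_le_iff) (auto intro!: integral_nonneg_AE)
  then show ?thesis
    unfolding var_psi psi2_integral using 1 by (simp add: algebra_simps)
qed

text \<open>Squaring a sum of three terms costs the factor 3. The term h (1 - w) is charged once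
  without and once with the weight w, and both charges have the same mean, hence 6. In the term w D
  (Y - mu) the residual is integrated out at the price \<open>s2\<close>.\<close>

lemma score_diff_bound:
  assumes [measurable]: "f \<in> borel_measurable (cov_space p)" "g \<in> borel_measurable (cov_space p)"
  shows "(\<integral>\<^sup>+\<omega>. ennreal ((score f g (obs R Y X \<omega>) - score mu ps (obs R Y X \<omega>))\<^sup>2) \<partial>M) \<le>
    6 * (\<integral>\<^sup>+\<omega>. ennreal (1 / ps (X \<omega>) * (f (X \<omega>) - mu (X \<omega>))\<^sup>2) \<partial>M) +
    3 * ennreal s2 * (\<integral>\<^sup>+\<omega>. ennreal (1 / ps (X \<omega>) * (1 - ps (X \<omega>) / g (X \<omega>))\<^sup>2) \<partial>M) +
    3 * (\<integral>\<^sup>+\<omega>. ennreal (1 / ps (X \<omega>) * (1 - ps (X \<omega>) / g (X \<omega>))\<^sup>2 * (f (X \<omega>) - mu (X \<omega>))\<^sup>2) \<partial>M)"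
    (is "?L \<le> 6 * ?A + 3 * ennreal s2 * ?B + 3 * ?C")
proof -
  let ?h = "\<lambda>x. f x - mu x" and ?D = "\<lambda>x. 1 - ps x / g x" and ?w = "\<lambda>\<omega>. R \<omega> / ps (X \<omega>)"
  let ?a = "\<lambda>x. 1 / ps x * (?h x)\<^sup>2" and ?b = "\<lambda>(y, x). 1 / ps x * (?D x)\<^sup>2 * (y - mu x)\<^sup>2"
    and ?c = "\<lambda>x. 1 / ps x * (?D x)\<^sup>2 * (?h x)\<^sup>2"
  have sq3: "(x + y + z)\<^sup>2 \<le> 3 * (x\<^sup>2 + y\<^sup>2 + z\<^sup>2)" for x y z :: real
    using zero_le_power2[of "x - y"] zero_le_power2[of "y - z"] zero_le_power2[of "x - z"]
    unfolding power2_eq_square by (simp add: algebra_simps)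
  have "AE \<omega> in M. (score f g (obs R Y X \<omega>) - score mu ps (obs R Y X \<omega>))\<^sup>2 \<le>
      3 * (?a (X \<omega>) + ?w \<omega> * ?a (X \<omega>) + ?w \<omega> * ?b (Y \<omega>, X \<omega>) + ?w \<omega> * ?c (X \<omega>))"
    using ps_pos ps_le_1 AE_space
  proof eventually_elim
    case (elim \<omega>)
    let ?x = "X \<omega>"
    have w: "?w \<omega> = 0 \<or> ?w \<omega> = 1 / ps ?x"
      using R01[of \<omega>] elim by auto
    have "score f g (obs R Y X \<omega>) - score mu ps (obs R Y X \<omega>) =
        ?h ?x * (1 - ?w \<omega>) + (- (?w \<omega> * ?D ?x * (Y \<omega> - mu ?x))) + ?w \<omega> * ?D ?x * ?h ?x"
    proof -
      \<comment> \<open>This remains true where \<open>g\<close> vanishes, since both sides are then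
        0 by the convention for division.\<close>
      have "R \<omega> / g ?x = ?w \<omega> * (1 - ?D ?x)"
        using elim by simp
      moreover have "u + w * (1 - d) * (y - u) - (v + w * (y - v)) =
          (u - v) * (1 - w) + (- (w * d * (y - v))) + w * d * (u - v)" for u v w d y :: real
        by (simp add: algebra_simps)
      ultimately show ?thesis
        unfolding score_obs by metis
    qed
    moreover have "(\<dots>)\<^sup>2 \<le> 3 * ((?h ?x * (1 - ?w \<omega>))\<^sup>2 + (- (?w \<omega> * ?D ?x * (Y \<omega> - mu ?x)))\<^sup>2 + (?w \<omega> * ?D ?x * ?h ?x)\<^sup>2)"
      by (rule sq3)
    moreover have "(?w \<omega> * ?D ?x * (Y \<omega> - mu ?x))\<^sup>2 = ?w \<omega> * ?b (Y \<omega>, X \<omega>)"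
      using w by (auto simp: power_mult_distrib power2_eq_square)
    moreover have "(?w \<omega> * ?D ?x * ?h ?x)\<^sup>2 = ?w \<omega> * ?c (X \<omega>)"
      using w by (auto simp: power_mult_distrib power2_eq_square)
    moreover have "(?h ?x * (1 - ?w \<omega>))\<^sup>2 \<le> ?a ?x + ?w \<omega> * ?a ?x"
    proof -
      \<comment> \<open>For w = 0 this reads 1 \<le> 1 / ps. For w = 1 / ps the left side is (1 / ps
        - 1)^2, at most 1 / ps^2.\<close>
      have "(1 - ?w \<omega>)\<^sup>2 \<le> 1 / ps ?x + ?w \<omega> * (1 / ps ?x)"
        using w elim by (auto simp: power2_eq_square field_simps)
      from mult_left_mono[OF this, of "(?h ?x)\<^sup>2"]
      have "(?h ?x)\<^sup>2 * (1 - ?w \<omega>)\<^sup>2 \<le> (?h ?x)\<^sup>2 * (1 / ps ?x + ?w \<omega> * (1 / ps ?x))"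
        by simp
      also have "\<dots> = ?a ?x + ?w \<omega> * ?a ?x"
        by (simp add: algebra_simps)
      finally show ?thesis
        unfolding power_mult_distrib .
    qed
    ultimately show ?case
      by simp
  qed
  then have "?L \<le> (\<integral>\<^sup>+\<omega>. ennreal (3 * (?a (X \<omega>) + ?w \<omega> * ?a (X \<omega>) + ?w \<omega> * ?b (Y \<omega>, X \<omega>) + ?w \<omega> * ?c (X \<omega>))) \<partial>M)"
    by (intro nn_integral_mono_AE) (auto intro: ennreal_leI)
  also have "\<dots> = (\<integral>\<^sup>+\<omega>. 3 * (ennreal (?a (X \<omega>)) + ennreal (?w \<omega>) * ennreal (?a (X \<omega>)) +
      ennreal (?w \<omega>) * ennreal (?b (Y \<omega>, X \<omega>)) + ennreal (?w \<omega>) * ennreal (?c (X \<omega>))) \<partial>M)"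
  proof (rule nn_integral_cong_AE)
    show "AE \<omega> in M. ennreal (3 * (?a (X \<omega>) + ?w \<omega> * ?a (X \<omega>) + ?w \<omega> * ?b (Y \<omega>, X \<omega>) + ?w \<omega> * ?c (X \<omega>))) =
      3 * (ennreal (?a (X \<omega>)) + ennreal (?w \<omega>) * ennreal (?a (X \<omega>)) +
      ennreal (?w \<omega>) * ennreal (?b (Y \<omega>, X \<omega>)) + ennreal (?w \<omega>) * ennreal (?c (X \<omega>)))"
      using ps_pos AE_space
    proof eventually_elim
      case (elim \<omega>)
      then have "0 \<le> ?w \<omega>" using R01[of \<omega>] by auto
      moreover have "0 \<le> ?a (X \<omega>)" "0 \<le> ?b (Y \<omega>, X \<omega>)" "0 \<le> ?c (X \<omega>)"
        using elim by auto
      moreover have "ennreal (3 * (\<alpha> + w * \<alpha> + w * \<beta> + w * \<gamma>)) =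
          3 * (ennreal \<alpha> + ennreal w * ennreal \<alpha> + ennreal w * ennreal \<beta> + ennreal w * ennreal \<gamma>)"
        if "0 \<le> w" "0 \<le> \<alpha>" "0 \<le> \<beta>" "0 \<le> \<gamma>" for w \<alpha> \<beta> \<gamma> :: real
        using that by (simp add: ennreal_mult ennreal_plus)
      ultimately show ?case
        by blast
    qed
  qed
  also have "\<dots> = 3 * ((\<integral>\<^sup>+\<omega>. ennreal (?a (X \<omega>)) \<partial>M) + (\<integral>\<^sup>+\<omega>. ennreal (?w \<omega>) * ennreal (?a (X \<omega>)) \<partial>M) +
      (\<integral>\<^sup>+\<omega>. ennreal (?w \<omega>) * ennreal (?b (Y \<omega>, X \<omega>)) \<partial>M) + (\<integral>\<^sup>+\<omega>. ennreal (?w \<omega>) * ennreal (?c (X \<omega>)) \<partial>M))"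
    by (simp add: nn_integral_cmult nn_integral_add)
  also have "(\<integral>\<^sup>+\<omega>. ennreal (?w \<omega>) * ennreal (?a (X \<omega>)) \<partial>M) = ?A"
    using nn_ipw[of "\<lambda>(y, x). ennreal (?a x)"] by simp
  also have "(\<integral>\<^sup>+\<omega>. ennreal (?w \<omega>) * ennreal (?c (X \<omega>)) \<partial>M) = ?C"
    using nn_ipw[of "\<lambda>(y, x). ennreal (?c x)"] by simp
  also have "(\<integral>\<^sup>+\<omega>. ennreal (?w \<omega>) * ennreal (?b (Y \<omega>, X \<omega>)) \<partial>M) = (\<integral>\<^sup>+\<omega>. ennreal (?b (Y \<omega>, X \<omega>)) \<partial>M)"
    by (rule nn_ipw) measurable
  also have "\<dots> = (\<integral>\<^sup>+\<omega>. ennreal (1 / ps (X \<omega>) * (?D (X \<omega>))\<^sup>2) * ennreal ((Y \<omega> - mu (X \<omega>))\<^sup>2) \<partial>M)"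
    by (subst ennreal_mult''[symmetric]) simp_all
  also have "3 * (?A + ?A + \<dots> + ?C) \<le> 3 * (?A + ?A + ennreal s2 * ?B + ?C)"
    by (intro mult_left_mono add_mono order.refl residual_upper[of "\<lambda>x. ennreal (1 / ps x * (?D x)\<^sup>2)"])
      auto
  also have "\<dots> = 6 * ?A + 3 * ennreal s2 * ?B + 3 * ?C"
  proof -
    have "3 * (?A + ?A + z + y) = 6 * ?A + 3 * z + 3 * y" for z y :: ennreal
    proof -
      have "?A + ?A = 2 * ?A" by (simp add: mult_2)
      then show ?thesis by (simp add: distrib_left mult.assoc[symmetric])
    qed
    then show ?thesis by (simp add: mult.assoc)
  qed
  finally show ?thesis .
qed

end

subsection \<open>Independent samples and cross-fitting\<close>

text \<open>Independence makes the joint law a product, and Tonelli's theorem applies. The outer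
  variable stays on \<open>M\<close>, so that the inner integral can be read as an expectation with
  the training data held fixed.\<close>

lemma (in prob_space) indep_var_nn_integral:
  assumes ind: "indep_var S A T B" and f [measurable]: "f \<in> borel_measurable (S \<Otimes>\<^sub>M T)"
  shows "(\<integral>\<^sup>+\<omega>. f (A \<omega>, B \<omega>) \<partial>M) = (\<integral>\<^sup>+\<omega>. \<integral>\<^sup>+t. f (A \<omega>, t) \<partial>distr M T B \<partial>M)"
proof -
  have A [measurable]: "A \<in> measurable M S" and B [measurable]: "B \<in> measurable M T"
    using ind by (auto dest: indep_var_rv1 indep_var_rv2)
  interpret B: prob_space "distr M T B"
    by (rule prob_space_distr[OF B])
  have f': "f \<in> borel_measurable (S \<Otimes>\<^sub>M distr M T B)"
    "f \<in> borel_measurable (distr M S A \<Otimes>\<^sub>M distr M T B)"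
    by measurable
  have "(\<integral>\<^sup>+\<omega>. f (A \<omega>, B \<omega>) \<partial>M) = (\<integral>\<^sup>+z. f z \<partial>distr M (S \<Otimes>\<^sub>M T) (\<lambda>\<omega>. (A \<omega>, B \<omega>)))"
    by (subst nn_integral_distr) auto
  also have "\<dots> = (\<integral>\<^sup>+z. f z \<partial>(distr M S A \<Otimes>\<^sub>M distr M T B))"
    using ind unfolding indep_var_distribution_eq by simp
  also have "\<dots> = (\<integral>\<^sup>+s. \<integral>\<^sup>+t. f (s, t) \<partial>distr M T B \<partial>distr M S A)"
    by (rule B.nn_integral_fst[OF f'(2), symmetric])
  also have "\<dots> = (\<integral>\<^sup>+\<omega>. \<integral>\<^sup>+t. f (A \<omega>, t) \<partial>distr M T B \<partial>M)"
    by (rule nn_integral_distr[OF A]) (use B.borel_measurable_nn_integral_fst[OF f'(1)] in simp)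
  finally show ?thesis .
qed

lemma (in prob_space) indep_var_components:
  assumes "indep_vars M' X I" "i \<in> I" "j \<in> I" "i \<noteq> j"
    and "f \<in> measurable (M' i) L" "g \<in> measurable (M' j) L"
  shows "indep_var L (\<lambda>\<omega>. f (X i \<omega>)) L (\<lambda>\<omega>. g (X j \<omega>))"
proof -
  have "indep_var (PiM {i} M') (\<lambda>\<omega>. \<lambda>j\<in>{i}. X j \<omega>) (PiM {j} M') (\<lambda>\<omega>. \<lambda>j\<in>{j}. X j \<omega>)"
    by (rule indep_var_restrict) (use assms in auto)
  from indep_var_compose[OF this
      measurable_compose[OF measurable_component_singleton[of i "{i}" M'] assms(5)]
      measurable_compose[OF measurable_component_singleton[of j "{j}" M'] assms(6)]]
  show ?thesis by (simp add: comp_def)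
qed

text \<open>Independence of folds and data is given for the two generated sigma-algebras; variables
  measurable with respect to them generate smaller ones.\<close>

lemma (in prob_space) indep_varI_indep_set:
  assumes ind: "indep_set (sets A) (sets B)" and sp: "space A = space M" "space B = space M"
    and X: "X \<in> measurable A S" and Y: "Y \<in> measurable B T"
  shows "indep_var S X T Y"
proof -
  have ev: "sets A \<subseteq> events" "sets B \<subseteq> events"
    using ind by (auto dest: indep_setD_ev1 indep_setD_ev2)
  have "sigma_sets (space A) {X -` C \<inter> space A | C. C \<in> sets S} \<subseteq> sets A"
    by (rule sets.sigma_sets_subset) (use measurable_sets[OF X] in blast)
  moreover have "sigma_sets (space B) {Y -` C \<inter> space B | C. C \<in> sets T} \<subseteq> sets B"
    by (rule sets.sigma_sets_subset) (use measurable_sets[OF Y] in blast)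
  ultimately have sub: "sigma_sets (space M) {X -` C \<inter> space M | C. C \<in> sets S} \<subseteq> sets A"
    "sigma_sets (space M) {Y -` C \<inter> space M | C. C \<in> sets T} \<subseteq> sets B"
    unfolding sp by blast+
  have "random_variable S X" "random_variable T Y"
    using X Y ev sp by (auto simp: measurable_def)
  moreover have "indep_set (sigma_sets (space M) {X -` C \<inter> space M | C. C \<in> sets S})
      (sigma_sets (space M) {Y -` C \<inter> space M | C. C \<in> sets T})"
    using ind sub ev unfolding indep_sets2_eq by blast
  ultimately show ?thesis
    unfolding indep_var_eq by blast
qed

section \<open>Sample means and independent test points\<close>

locale iid_sample = prob_space M for M :: "'a measure" +
  fixes N :: nat and S :: "'b measure" and Zs :: "nat \<Rightarrow> 'a \<Rightarrow> 'b" and Q :: "'b measure"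
  assumes N_pos: "0 < N"
    and indep: "indep_vars (\<lambda>_. S) Zs {..<N}"
    and dist: "i < N \<Longrightarrow> distr M S (Zs i) = Q"
begin

lemma Zs_meas: "i < N \<Longrightarrow> Zs i \<in> measurable M S"
  using indep by (auto simp: indep_vars_def)

lemma sets_Q [measurable_cong]: "sets Q = sets S"
  using dist[OF N_pos] by (metis sets_distr)

sublocale Q: prob_space Q
  using prob_space_distr[OF Zs_meas[OF N_pos]] dist[OF N_pos] by simp

lemma train_meas: "T \<subseteq> {..<N} \<Longrightarrow> (\<lambda>\<omega>. \<lambda>i\<in>T. Zs i \<omega>) \<in> measurable M (PiM T (\<lambda>_. S))"
  by (rule measurable_restrict) (auto intro: Zs_meas)

lemma fn_meas:
  "\<lbrakk>i < N; g \<in> borel_measurable S\<rbrakk> \<Longrightarrow> (\<lambda>\<omega>. g (Zs i \<omega>)) \<in> borel_measurable M"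
  by (rule measurable_compose[OF Zs_meas])

lemma integral_fn:
  fixes g :: "'b \<Rightarrow> real"
  assumes "i < N" "g \<in> borel_measurable S"
  shows "(\<integral>\<omega>. g (Zs i \<omega>) \<partial>M) = (\<integral>z. g z \<partial>Q)"
  by (subst dist[OF assms(1), symmetric]) (rule integral_distr[OF Zs_meas[OF assms(1)] assms(2), symmetric])

lemma integrable_fn:
  fixes g :: "'b \<Rightarrow> real"
  assumes "i < N" "g \<in> borel_measurable S" "integrable Q g"
  shows "integrable M (\<lambda>\<omega>. g (Zs i \<omega>))"
  using assms(3) by (subst (asm) dist[OF assms(1), symmetric], subst (asm) integrable_distr_eq)
    (auto intro: Zs_meas assms)

text \<open>The index \<open>i\<close> lies outside \<open>T\<close>, so the test point is
  independent of the training family and can be integrated out with its law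
  \<open>Q\<close>.\<close>

lemma train_test_nn_integral:
  assumes "T \<subseteq> {..<N}" "i < N" "i \<notin> T" "f \<in> borel_measurable (PiM T (\<lambda>_. S) \<Otimes>\<^sub>M S)"
  shows "(\<integral>\<^sup>+\<omega>. f (\<lambda>j\<in>T. Zs j \<omega>, Zs i \<omega>) \<partial>M) = (\<integral>\<^sup>+\<omega>. \<integral>\<^sup>+z. f (\<lambda>j\<in>T. Zs j \<omega>, z) \<partial>Q \<partial>M)"
proof -
  \<comment> \<open>Independence of restricted families makes the test point a family over {i};
    reading off coordinate \<open>i\<close> recovers it.\<close>
  let ?B = "\<lambda>\<omega>. \<lambda>j\<in>{i}. Zs j \<omega>" and ?S1 = "PiM {i} (\<lambda>_. S)"
  have ind: "indep_var (PiM T (\<lambda>_. S)) (\<lambda>\<omega>. \<lambda>j\<in>T. Zs j \<omega>) ?S1 ?B"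
    by (rule indep_var_restrict[OF indep]) (use assms in auto)
  note [measurable] = assms(4)
  have [measurable]: "(\<lambda>v. v i) \<in> measurable ?S1 S"
    by (rule measurable_component_singleton) simp
  have "?B \<in> measurable M ?S1"
    by (rule train_meas) (use assms in auto)
  then have *: "(\<integral>\<^sup>+v. g (v i) \<partial>distr M ?S1 ?B) = (\<integral>\<^sup>+z. g z \<partial>Q)"
    if [measurable]: "g \<in> borel_measurable S" for g
    by (subst dist[OF assms(2), symmetric], subst (1 2) nn_integral_distr)
      (auto intro: Zs_meas assms measurable_compose[OF measurable_component_singleton])
  have "(\<integral>\<^sup>+\<omega>. f (\<lambda>j\<in>T. Zs j \<omega>, Zs i \<omega>) \<partial>M) =
      (\<integral>\<^sup>+\<omega>. \<integral>\<^sup>+v. f (\<lambda>j\<in>T. Zs j \<omega>, v i) \<partial>distr M ?S1 ?B \<partial>M)"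
    using indep_var_nn_integral[OF ind, of "\<lambda>(D, v). f (D, v i)"] by simp
  also have "\<dots> = (\<integral>\<^sup>+\<omega>. \<integral>\<^sup>+z. f (\<lambda>j\<in>T. Zs j \<omega>, z) \<partial>Q \<partial>M)"
  proof (intro nn_integral_cong *)
    fix \<omega> assume "\<omega> \<in> space M"
    then have [measurable]: "(\<lambda>j\<in>T. Zs j \<omega>) \<in> space (PiM T (\<lambda>_. S))"
      using measurable_space[OF train_meas[OF assms(1)]] by blast
    show "(\<lambda>z. f (\<lambda>j\<in>T. Zs j \<omega>, z)) \<in> borel_measurable S"
      by measurable
  qed
  finally show ?thesis .
qed

text \<open>Products with distinct indices are independent and centred, so only the N diagonal terms
  survive.\<close>

lemma centred_sum_square:
  fixes v :: "'b \<Rightarrow> real"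
  assumes v [measurable]: "v \<in> borel_measurable S" and v2: "integrable Q (\<lambda>z. (v z)\<^sup>2)"
    and v0: "(\<integral>z. v z \<partial>Q) = 0"
  shows "integrable M (\<lambda>\<omega>. (\<Sum>i<N. v (Zs i \<omega>))\<^sup>2)"
    and "(\<integral>\<omega>. (\<Sum>i<N. v (Zs i \<omega>))\<^sup>2 \<partial>M) = real N * (\<integral>z. (v z)\<^sup>2 \<partial>Q)"
proof -
  have v1: "integrable Q v"
    by (rule Q.square_integrable_imp_integrable[OF _ v2]) measurable
  have diag: "integrable M (\<lambda>\<omega>. v (Zs i \<omega>) * v (Zs i \<omega>)) \<and>
      (\<integral>\<omega>. v (Zs i \<omega>) * v (Zs i \<omega>) \<partial>M) = (\<integral>z. (v z)\<^sup>2 \<partial>Q)" if "i < N" for i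
    using integrable_fn[OF that _ v2] integral_fn[OF that, of "\<lambda>z. (v z)\<^sup>2"] 
    by (simp add: power2_eq_square)
  have off: "integrable M (\<lambda>\<omega>. v (Zs i \<omega>) * v (Zs j \<omega>)) \<and>
      (\<integral>\<omega>. v (Zs i \<omega>) * v (Zs j \<omega>) \<partial>M) = 0" if "i < N" "j < N" "i \<noteq> j" for i j
  proof -
    have ind: "indep_var borel (\<lambda>\<omega>. v (Zs i \<omega>)) borel (\<lambda>\<omega>. v (Zs j \<omega>))"
      by (rule indep_var_components[OF indep]) (use that in auto)
    show ?thesis
      using indep_var_integrable[OF ind] indep_var_lebesgue_integral[OF ind]
        integrable_fn[OF _ v v1] integral_fn[OF _ v] that v0 by simp
  qed
  have eq: "(\<Sum>i<N. v (Zs i \<omega>))\<^sup>2 = (\<Sum>i<N. \<Sum>j<N. v (Zs i \<omega>) * v (Zs j \<omega>))" for \<omega>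
    by (simp add: power2_eq_square sum_product)
  have int: "integrable M (\<lambda>\<omega>. v (Zs i \<omega>) * v (Zs j \<omega>))" if "i < N" "j < N" for i j
    using diag off that by (cases "i = j") auto
  show "integrable M (\<lambda>\<omega>. (\<Sum>i<N. v (Zs i \<omega>))\<^sup>2)"
    unfolding eq by (intro Bochner_Integration.integrable_sum int) auto
  have "(\<integral>\<omega>. (\<Sum>i<N. v (Zs i \<omega>))\<^sup>2 \<partial>M) = (\<Sum>i<N. \<Sum>j<N. \<integral>\<omega>. v (Zs i \<omega>) * v (Zs j \<omega>) \<partial>M)"
    unfolding eq by (subst Bochner_Integration.integral_sum Bochner_Integration.integrable_sum;
        (intro Bochner_Integration.integrable_sum int sum.cong refl Bochner_Integration.integral_sum)?; auto intro: int)
  also have "\<dots> = (\<Sum>i<N. \<Sum>j<N. if i = j then (\<integral>z. (v z)\<^sup>2 \<partial>Q) else 0)"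
    using diag off by (intro sum.cong refl) auto
  also have "\<dots> = real N * (\<integral>z. (v z)\<^sup>2 \<partial>Q)"
    by simp
  finally show "(\<integral>\<omega>. (\<Sum>i<N. v (Zs i \<omega>))\<^sup>2 \<partial>M) = real N * (\<integral>z. (v z)\<^sup>2 \<partial>Q)" .
qed

lemma mean_square_deviation:
  fixes u :: "'b \<Rightarrow> real"
  assumes u [measurable]: "u \<in> borel_measurable S" and u2: "integrable Q (\<lambda>z. (u z)\<^sup>2)"
  shows "integrable M (\<lambda>\<omega>. ((\<Sum>i<N. u (Zs i \<omega>)) / N - (\<integral>z. u z \<partial>Q))\<^sup>2)"
    and "(\<integral>\<omega>. ((\<Sum>i<N. u (Zs i \<omega>)) / N - (\<integral>z. u z \<partial>Q))\<^sup>2 \<partial>M) \<le> (\<integral>z. (u z)\<^sup>2 \<partial>Q) / N"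
proof -
  let ?m = "\<integral>z. u z \<partial>Q"
  let ?v = "\<lambda>z. u z - ?m"
  have u1: "integrable Q u"
    by (rule Q.square_integrable_imp_integrable[OF _ u2]) measurable
  have v: "?v \<in> borel_measurable S" "integrable Q (\<lambda>z. (?v z)\<^sup>2)" "(\<integral>z. ?v z \<partial>Q) = 0"
    using u1 u2 by (auto simp: power2_diff Q.prob_space)
  have eq: "((\<Sum>i<N. u (Zs i \<omega>)) / N - ?m)\<^sup>2 = (\<Sum>i<N. ?v (Zs i \<omega>))\<^sup>2 / (real N)\<^sup>2" for \<omega>
    using N_pos by (simp add: sum_subtractf power_divide[symmetric] diff_divide_distrib)
  show "integrable M (\<lambda>\<omega>. ((\<Sum>i<N. u (Zs i \<omega>)) / N - ?m)\<^sup>2)"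
    unfolding eq using centred_sum_square(1)[OF v] by simp
  have "(\<integral>\<omega>. ((\<Sum>i<N. u (Zs i \<omega>)) / N - ?m)\<^sup>2 \<partial>M) = real N * (\<integral>z. (?v z)\<^sup>2 \<partial>Q) / (real N)\<^sup>2"
    unfolding eq using centred_sum_square(2)[OF v] by simp
  also have "\<dots> = (\<integral>z. (?v z)\<^sup>2 \<partial>Q) / N"
    using N_pos by (simp add: power2_eq_square)
  also have "(\<integral>z. (?v z)\<^sup>2 \<partial>Q) = (\<integral>z. (u z)\<^sup>2 \<partial>Q) - ?m\<^sup>2"
    by (rule Q.variance_eq[OF u1 u2])
  also have "\<dots> / N \<le> (\<integral>z. (u z)\<^sup>2 \<partial>Q) / N"
    by (intro divide_right_mono) auto
  finally show "(\<integral>\<omega>. ((\<Sum>i<N. u (Zs i \<omega>)) / N - ?m)\<^sup>2 \<partial>M) \<le> (\<integral>z. (u z)\<^sup>2 \<partial>Q) / N" .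
qed

text \<open>Truncation at the level of the Lindeberg condition: the bounded part is controlled through
  its variance, the rest through its mean.\<close>

lemma truncated_law_of_large_numbers:
  fixes \<phi> :: "'b \<Rightarrow> real" and a c :: real
  assumes \<phi> [measurable]: "\<phi> \<in> borel_measurable S" and \<phi>2: "integrable Q (\<lambda>z. (\<phi> z)\<^sup>2)"
    and a: "0 < a" and c: "0 < c"
  defines "t \<equiv> \<lambda>z. (\<phi> z)\<^sup>2 * indicator {z. \<bar>\<phi> z\<bar> > c * sqrt (real N / a)} z"
  shows "integrable M (\<lambda>\<omega>. \<bar>(\<Sum>i<N. (\<phi> (Zs i \<omega>))\<^sup>2) / N - (\<integral>z. (\<phi> z)\<^sup>2 \<partial>Q)\<bar>)"
    and "a * (\<integral>\<omega>. \<bar>(\<Sum>i<N. (\<phi> (Zs i \<omega>))\<^sup>2) / N - (\<integral>z. (\<phi> z)\<^sup>2 \<partial>Q)\<bar> \<partial>M) \<le>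
      c / 2 * (1 + a * (\<integral>z. (\<phi> z)\<^sup>2 \<partial>Q)) + 2 * a * (\<integral>z. t z \<partial>Q)"
proof -
  define l where "l = c * sqrt (real N / a)"
  define u where "u z = (\<phi> z)\<^sup>2 * indicator {z. \<bar>\<phi> z\<bar> \<le> l} z" for z
  have [measurable]: "u \<in> borel_measurable S" "t \<in> borel_measurable S"
    unfolding u_def t_def by measurable
  have split: "(\<phi> z)\<^sup>2 = u z + t z" and t0: "0 \<le> t z" for z
    by (auto simp: u_def t_def l_def split: split_indicator)
  have t1: "integrable Q t"
    by (rule Bochner_Integration.integrable_bound[OF \<phi>2])
      (auto simp: t_def split: split_indicator)
  have l2: "l\<^sup>2 = c\<^sup>2 * real N / a"
    using a by (simp add: l_def power_mult_distrib)
  \<comment> \<open>On the part that is kept, a fourth power costs only l^2 times a square, so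
    second moments suffice to bound the variance.\<close>
  have u_le: "(u z)\<^sup>2 \<le> l\<^sup>2 * (\<phi> z)\<^sup>2" for z
  proof (cases "\<bar>\<phi> z\<bar> \<le> l")
    case True
    then have "(\<phi> z)\<^sup>2 \<le> l\<^sup>2"
      by (metis abs_ge_zero power2_abs power_mono)
    then have "(\<phi> z)\<^sup>2 * (\<phi> z)\<^sup>2 \<le> l\<^sup>2 * (\<phi> z)\<^sup>2"
      by (rule mult_right_mono) simp
    then show ?thesis
      using True by (simp add: u_def power2_eq_square)
  qed (simp add: u_def)
  have u2: "integrable Q (\<lambda>z. (u z)\<^sup>2)"
    by (rule Bochner_Integration.integrable_bound[of Q "\<lambda>z. l\<^sup>2 * (\<phi> z)\<^sup>2"])
      (use \<phi>2 u_le in auto)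
  have u1: "integrable Q u"
    by (rule Q.square_integrable_imp_integrable[OF _ u2]) measurable
  let ?Eu = "\<integral>z. u z \<partial>Q" and ?Et = "\<integral>z. t z \<partial>Q" and ?E = "\<integral>z. (\<phi> z)\<^sup>2 \<partial>Q"
  let ?U = "\<lambda>\<omega>. (\<Sum>i<N. u (Zs i \<omega>)) / N" and ?T = "\<lambda>\<omega>. (\<Sum>i<N. t (Zs i \<omega>)) / N"
    and ?P = "\<lambda>\<omega>. (\<Sum>i<N. (\<phi> (Zs i \<omega>))\<^sup>2) / N"
  have E: "?E = ?Eu + ?Et"
    using u1 t1 by (simp add: split)
  have P: "?P \<omega> = ?U \<omega> + ?T \<omega>" for \<omega>
    by (simp add: split sum.distrib add_divide_distrib)
  have Pint: "integrable M ?P"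
    by (intro integrable_divide_zero Bochner_Integration.integrable_sum integrable_fn[where g="\<lambda>z. (\<phi> z)\<^sup>2"] \<phi>2) auto
  then show "integrable M (\<lambda>\<omega>. \<bar>?P \<omega> - ?E\<bar>)"
    by simp
  have Tint: "integrable M ?T"
    by (intro integrable_divide_zero Bochner_Integration.integrable_sum integrable_fn[where g=t] t1) auto
  have TE: "(\<integral>\<omega>. ?T \<omega> \<partial>M) = ?Et"
    using N_pos integral_fn[where g=t] integrable_fn[where g=t] t1 by simp
  note dev = mean_square_deviation[OF _ u2]
  have le: "\<bar>?P \<omega> - ?E\<bar> \<le> (a / c * (?U \<omega> - ?Eu)\<^sup>2 + c / a) / 2 + (?T \<omega> + ?Et)" for \<omega>
  proof -
    \<comment> \<open>The weights a / c and c / a are balanced for l^2 = c^2 N / a: after the final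
      multiplication by \<open>a\<close>, the two terms become c / 2 times a E and c / 2.\<close>
    have amgm: "\<bar>x\<bar> \<le> (a / c * x\<^sup>2 + c / a) / 2" for x :: real
    proof -
      have "0 \<le> a / c * (\<bar>x\<bar> - c / a)\<^sup>2"
        using a c by simp
      also have "\<dots> = a / c * x\<^sup>2 + c / a - 2 * \<bar>x\<bar>"
        using a c by (simp add: power2_diff field_simps) (simp add: power2_eq_square)
      finally show ?thesis by simp
    qed
    \<comment> \<open>By nonnegativity the tail deviates from its mean by at most the sum of the
      two, which has expectation \<open>2 * ?Et\<close>.\<close>
    have "0 \<le> ?T \<omega>" "0 \<le> ?Et"
      by (auto intro!: divide_nonneg_nonneg sum_nonneg t0 Bochner_Integration.integral_nonneg)
    then have "\<bar>?P \<omega> - ?E\<bar> \<le> \<bar>?U \<omega> - ?Eu\<bar> + (?T \<omega> + ?Et)"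
      unfolding P E by linarith
    also note amgm
    finally show ?thesis by simp
  qed
  have "(\<integral>\<omega>. \<bar>?P \<omega> - ?E\<bar> \<partial>M) \<le> (\<integral>\<omega>. (a / c * (?U \<omega> - ?Eu)\<^sup>2 + c / a) / 2 + (?T \<omega> + ?Et) \<partial>M)"
    using Pint dev(1) Tint le by (intro integral_mono) auto
  also have "\<dots> = (a / c * (\<integral>\<omega>. (?U \<omega> - ?Eu)\<^sup>2 \<partial>M) + c / a) / 2 + 2 * ?Et"
    using dev(1) Tint TE by (simp add: prob_space)
  also have "\<dots> \<le> (a / c * (l\<^sup>2 * ?E / N) + c / a) / 2 + 2 * ?Et"
  proof -
    have "(\<integral>z. (u z)\<^sup>2 \<partial>Q) \<le> l\<^sup>2 * ?E"
      using integral_mono[OF u2 _ u_le] \<phi>2 by simp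
    then have "(\<integral>\<omega>. (?U \<omega> - ?Eu)\<^sup>2 \<partial>M) \<le> l\<^sup>2 * ?E / N"
      by (intro order_trans[OF dev(2)] divide_right_mono) auto
    then show ?thesis
      using a c by (intro add_mono divide_right_mono mult_left_mono) auto
  qed
  finally have "a * (\<integral>\<omega>. \<bar>?P \<omega> - ?E\<bar> \<partial>M) \<le> a * ((a / c * (l\<^sup>2 * ?E / N) + c / a) / 2 + 2 * ?Et)"
    using a by (intro mult_left_mono) auto
  also have "\<dots> = c / 2 * (1 + a * ?E) + 2 * a * ?Et"
    unfolding l2 using a c N_pos by (simp add: field_simps power2_eq_square)
  finally show "a * (\<integral>\<omega>. \<bar>?P \<omega> - ?E\<bar> \<partial>M) \<le> c / 2 * (1 + a * ?E) + 2 * a * ?Et" .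
qed

end

section \<open>Losses on random folds\<close>

locale cross_fitting = iid_sample M N "obs_space p" Zs Q
  for M :: "'a measure" and N p :: nat and Zs :: "nat \<Rightarrow> 'a \<Rightarrow> obs" and Q :: "obs measure" +
  fixes K :: nat and I :: "nat \<Rightarrow> 'a \<Rightarrow> nat set"
  assumes folds: "folds K N M p Zs I"
begin

text \<open>The argument \<open>T\<close> is the held-out fold; training uses its
  complement.\<close>

definition train :: "nat set \<Rightarrow> 'a \<Rightarrow> nat \<Rightarrow> obs" where
  "train T \<omega> = (\<lambda>i\<in>{..<N} - T. Zs i \<omega>)"

abbreviation train_space :: "nat set \<Rightarrow> (nat \<Rightarrow> obs) measure" where
  "train_space T \<equiv> PiM ({..<N} - T) (\<lambda>_. obs_space p)"

lemma train_measurable [measurable]: "train T \<in> measurable M (train_space T)"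
  unfolding train_def by (rule train_meas) auto

lemma fold_meas: "k < K \<Longrightarrow> I k \<in> measurable M (count_space UNIV)"
  and fold_union: "\<omega> \<in> space M \<Longrightarrow> (\<Union>k<K. I k \<omega>) = {..<N}"
  and fold_disjoint: "\<omega> \<in> space M \<Longrightarrow> disjoint_family_on (\<lambda>k. I k \<omega>) {..<K}"
  using folds by (auto simp: folds_def)

lemma fold_subset: "\<omega> \<in> space M \<Longrightarrow> k < K \<Longrightarrow> I k \<omega> \<subseteq> {..<N}"
  using fold_union by blast

lemma fold_meas_Pow: "k < K \<Longrightarrow> I k \<in> measurable M (count_space (Pow {..<N}))"
  by (rule measurable_count_space_extend[OF subset_UNIV _ fold_meas]) (use fold_subset in auto)

text \<open>A fold takes values in the finite set \<open>Pow {..<N}\<close>, so measurability may be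
  checked for each fixed value.\<close>

lemma by_fold_measurable:
  assumes "k < K" "\<And>T. T \<subseteq> {..<N} \<Longrightarrow> f T \<in> measurable M L"
  shows "(\<lambda>\<omega>. f (I k \<omega>) \<omega>) \<in> measurable M L"
  by (rule measurable_compose_countable'[OF _ fold_meas_Pow[OF assms(1)]])
    (auto intro: assms(2) countable_finite)

text \<open>This permits treating the fold as a deterministic set: on the event that it equals
  \<open>T\<close>, the data keep their law.\<close>

lemma fold_independent:
  assumes k: "k < K" and f [measurable]: "f \<in> borel_measurable (PiM {..<N} (\<lambda>_. obs_space p))"
  shows "(\<integral>\<^sup>+\<omega>. indicator {T} (I k \<omega>) * f (\<lambda>i\<in>{..<N}. Zs i \<omega>) \<partial>M) =
    (\<integral>\<^sup>+\<omega>. indicator {T} (I k \<omega>) \<partial>M) * (\<integral>\<^sup>+\<omega>. f (\<lambda>i\<in>{..<N}. Zs i \<omega>) \<partial>M)"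
proof -
  let ?P = "PiM {..<K} (\<lambda>_. count_space UNIV :: nat set measure)" and ?S = "PiM {..<N} (\<lambda>_. obs_space p)"
  let ?I = "\<lambda>\<omega>. \<lambda>k\<in>{..<K}. I k \<omega>" and ?Z = "\<lambda>\<omega>. \<lambda>i\<in>{..<N}. Zs i \<omega>"
  let ?A = "vimage_algebra (space M) ?I ?P" and ?B = "vimage_algebra (space M) ?Z ?S"
  have kP: "(\<lambda>v. v k) \<in> measurable ?P (count_space UNIV)"
    by (rule measurable_component_singleton) (use k in simp)
  have "(\<lambda>\<omega>. indicator {T} (?I \<omega> k) :: ennreal) \<in> borel_measurable ?A"
    by (rule measurable_compose[OF measurable_compose[OF measurable_vimage_algebra1 kP]])
      (auto simp: space_PiM)
  moreover have "(\<lambda>\<omega>. f (?Z \<omega>)) \<in> borel_measurable ?B"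
    by (rule measurable_compose[OF measurable_vimage_algebra1 f])
      (use measurable_space[OF train_meas[of "{..<N}"]] in auto)
  ultimately have ind: "indep_var borel (\<lambda>\<omega>. indicator {T} (I k \<omega>) :: ennreal) borel (\<lambda>\<omega>. f (?Z \<omega>))"
    using folds k by (intro indep_varI_indep_set[of ?A ?B]) (auto simp: folds_def)
  have gI: "(\<lambda>\<omega>. indicator {T} (I k \<omega>) :: ennreal) \<in> borel_measurable M"
    and fZ: "(\<lambda>\<omega>. f (?Z \<omega>)) \<in> borel_measurable M"
    using ind by (auto dest: indep_var_rv1 indep_var_rv2)
  have "(\<integral>\<^sup>+\<omega>. indicator {T} (I k \<omega>) * f (?Z \<omega>) \<partial>M) =
      (\<integral>\<^sup>+\<omega>. \<integral>\<^sup>+y. indicator {T} (I k \<omega>) * y \<partial>distr M borel (\<lambda>\<omega>. f (?Z \<omega>)) \<partial>M)"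
    using indep_var_nn_integral[OF ind, of "\<lambda>z. fst z * snd z"] by simp
  also have "\<dots> = (\<integral>\<^sup>+\<omega>. indicator {T} (I k \<omega>) * (\<integral>\<^sup>+\<omega>. f (?Z \<omega>) \<partial>M) \<partial>M)"
    by (simp add: nn_integral_cmult nn_integral_distr[OF fZ])
  also have "\<dots> = (\<integral>\<^sup>+\<omega>. indicator {T} (I k \<omega>) \<partial>M) * (\<integral>\<^sup>+\<omega>. f (?Z \<omega>) \<partial>M)"
    by (rule nn_integral_multc[OF gI])
  finally show ?thesis .
qed

text \<open>The conditional expectation of the loss at a fresh observation, given the training
  data.\<close>

definition risk :: "(nat set \<Rightarrow> (nat \<Rightarrow> obs) \<times> obs \<Rightarrow> ennreal) \<Rightarrow> nat set \<Rightarrow> 'a \<Rightarrow> ennreal" where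
  "risk f T \<omega> = (\<integral>\<^sup>+z. f T (train T \<omega>, z) \<partial>Q)"

lemma risk_meas:
  assumes [measurable]: "f T \<in> borel_measurable (train_space T \<Otimes>\<^sub>M obs_space p)"
  shows "risk f T \<in> borel_measurable M"
proof -
  have "(\<lambda>D. \<integral>\<^sup>+z. f T (D, z) \<partial>Q) \<in> borel_measurable (train_space T)"
    by (rule Q.borel_measurable_nn_integral_fst) measurable
  then show ?thesis
    unfolding risk_def by measurable
qed

text \<open>Restricted to a value T of fold k, the event that the risk is at most h depends on the training
  data only, so each test point contributes its risk, hence at most h.\<close>

lemma cross_fit_loss_le:
  assumes k: "k < K"
    and f: "\<And>T. T \<subseteq> {..<N} \<Longrightarrow> f T \<in> borel_measurable (train_space T \<Otimes>\<^sub>M obs_space p)"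
  shows "(\<integral>\<^sup>+\<omega>. (\<Sum>i\<in>I k \<omega>. f (I k \<omega>) (train (I k \<omega>) \<omega>, Zs i \<omega>)) * indicator {\<omega>. risk f (I k \<omega>) \<omega> \<le> h} \<omega> \<partial>M)
    \<le> of_nat N * h"
proof -
  let ?A = "\<lambda>T. \<integral>\<^sup>+\<omega>. indicator {T} (I k \<omega>) \<partial>M"
  define g where "g T = (\<lambda>(D, z). f T (D, z) * indicator {D. (\<integral>\<^sup>+z. f T (D, z) \<partial>Q) \<le> h} D)" for T
  have g: "g T \<in> borel_measurable (train_space T \<Otimes>\<^sub>M obs_space p)" if "T \<subseteq> {..<N}" for T
  proof -
    have [measurable]: "f T \<in> borel_measurable (train_space T \<Otimes>\<^sub>M obs_space p)"
      by (rule f[OF that])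
    have [measurable]: "(\<lambda>D. \<integral>\<^sup>+z. f T (D, z) \<partial>Q) \<in> borel_measurable (train_space T)"
      by (rule Q.borel_measurable_nn_integral_fst) measurable
    show ?thesis unfolding g_def by measurable
  qed
  have gI: "(\<lambda>\<omega>. indicator {T} (I k \<omega>) :: ennreal) \<in> borel_measurable M" for T
    by (rule measurable_compose[OF fold_meas[OF k]]) simp
  have gm: "(\<lambda>\<omega>. g T (train T \<omega>, Zs i \<omega>)) \<in> borel_measurable M" if "T \<subseteq> {..<N}" "i \<in> T" for T i
  proof -
    have [measurable]: "Zs i \<in> measurable M (obs_space p)"
      using that by (intro Zs_meas) auto
    note [measurable] = g[OF that(1)]
    show ?thesis by measurable
  qed
  have cell: "(\<integral>\<^sup>+\<omega>. indicator {T} (I k \<omega>) * g T (train T \<omega>, Zs i \<omega>) \<partial>M) \<le> ?A T * h"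
    if T: "T \<subseteq> {..<N}" and i: "i \<in> T" for T i
  proof -
    let ?S = "PiM {..<N} (\<lambda>_. obs_space p)"
    have iN: "i \<in> {..<N}" using T i by auto
    have [measurable]: "(\<lambda>v. restrict v ({..<N} - T)) \<in> measurable ?S (train_space T)"
      by (rule measurable_restrict_subset) auto
    note [measurable] = measurable_component_singleton[OF iN, of "\<lambda>_. obs_space p"] g[OF T]
    let ?f = "\<lambda>v. g T (restrict v ({..<N} - T), v i)"
    have fm: "?f \<in> borel_measurable ?S" by measurable
    have eq: "?f (\<lambda>i\<in>{..<N}. Zs i \<omega>) = g T (train T \<omega>, Zs i \<omega>)" for \<omega>
      using iN by (auto simp: train_def restrict_def intro!: arg_cong[where f="g T"])
    have "(\<integral>\<^sup>+\<omega>. g T (train T \<omega>, Zs i \<omega>) \<partial>M) = (\<integral>\<^sup>+\<omega>. \<integral>\<^sup>+z. g T (train T \<omega>, z) \<partial>Q \<partial>M)"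
      unfolding train_def by (rule train_test_nn_integral) (use iN i g[OF T] in auto)
    \<comment> \<open>Where the risk exceeds \<open>h\<close>, the indicator inside \<open>g\<close>
      makes the inner integral 0.\<close>
    also have "\<dots> \<le> (\<integral>\<^sup>+\<omega>. h \<partial>M)"
    proof (rule nn_integral_mono)
      fix \<omega> assume \<omega>: "\<omega> \<in> space M"
      show "(\<integral>\<^sup>+z. g T (train T \<omega>, z) \<partial>Q) \<le> h"
        by (cases "(\<integral>\<^sup>+z. f T (train T \<omega>, z) \<partial>Q) \<le> h") (auto simp: g_def)
    qed
    also have "\<dots> = h"
      by (simp add: emeasure_space_1)
    finally show ?thesis
      using fold_independent[OF k fm, of T] unfolding eq by (simp add: mult_left_mono)
  qed
  have "(\<integral>\<^sup>+\<omega>. (\<Sum>i\<in>I k \<omega>. f (I k \<omega>) (train (I k \<omega>) \<omega>, Zs i \<omega>)) * indicator {\<omega>. risk f (I k \<omega>) \<omega> \<le> h} \<omega> \<partial>M) =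
      (\<integral>\<^sup>+\<omega>. (\<Sum>T\<in>Pow {..<N}. \<Sum>i\<in>T. indicator {T} (I k \<omega>) * g T (train T \<omega>, Zs i \<omega>)) \<partial>M)"
  proof (rule nn_integral_cong)
    fix \<omega> assume \<omega>: "\<omega> \<in> space M"
    have "(\<Sum>T\<in>Pow {..<N}. \<Sum>i\<in>T. indicator {T} (I k \<omega>) * g T (train T \<omega>, Zs i \<omega>)) =
        (\<Sum>T\<in>Pow {..<N}. if T = I k \<omega> then \<Sum>i\<in>T. g T (train T \<omega>, Zs i \<omega>) else 0)"
      by (intro sum.cong refl) (auto split: split_indicator)
    also have "\<dots> = (\<Sum>i\<in>I k \<omega>. g (I k \<omega>) (train (I k \<omega>) \<omega>, Zs i \<omega>))"
      using fold_subset[OF \<omega> k] by (subst sum.delta) auto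
    also have "\<dots> = (\<Sum>i\<in>I k \<omega>. f (I k \<omega>) (train (I k \<omega>) \<omega>, Zs i \<omega>)) * indicator {\<omega>. risk f (I k \<omega>) \<omega> \<le> h} \<omega>"
      by (simp add: g_def risk_def sum_distrib_right indicator_def)
    finally show "(\<Sum>i\<in>I k \<omega>. f (I k \<omega>) (train (I k \<omega>) \<omega>, Zs i \<omega>)) * indicator {\<omega>. risk f (I k \<omega>) \<omega> \<le> h} \<omega> =
        (\<Sum>T\<in>Pow {..<N}. \<Sum>i\<in>T. indicator {T} (I k \<omega>) * g T (train T \<omega>, Zs i \<omega>))" ..
  qed
  also have "\<dots> = (\<Sum>T\<in>Pow {..<N}. \<Sum>i\<in>T. \<integral>\<^sup>+\<omega>. indicator {T} (I k \<omega>) * g T (train T \<omega>, Zs i \<omega>) \<partial>M)"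
    by (subst nn_integral_sum; (intro borel_measurable_sum borel_measurable_times_ennreal gI gm sum.cong refl nn_integral_sum)?) auto
  also have "\<dots> \<le> (\<Sum>T\<in>Pow {..<N}. \<Sum>i\<in>T. ?A T * h)"
    by (intro sum_mono cell) auto
  \<comment> \<open>The size of a fold is bounded by N, which makes the factor independent of
    \<open>T\<close>; the probabilities of the values of fold k then add up to 1.\<close>
  also have "\<dots> \<le> (\<Sum>T\<in>Pow {..<N}. of_nat N * (?A T * h))"
  proof (rule sum_mono)
    fix T assume "T \<in> Pow {..<N}"
    then have "card T \<le> N"
      using card_mono[of "{..<N}" T] by simp
    then show "(\<Sum>i\<in>T. ?A T * h) \<le> of_nat N * (?A T * h)"
      by (simp add: mult_right_mono)
  qed
  also have "\<dots> = of_nat N * ((\<Sum>T\<in>Pow {..<N}. ?A T) * h)"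
    by (simp add: sum_distrib_left sum_distrib_right)
  also have "(\<Sum>T\<in>Pow {..<N}. ?A T) = (\<integral>\<^sup>+\<omega>. (\<Sum>T\<in>Pow {..<N}. indicator {T} (I k \<omega>)) \<partial>M)"
    by (rule nn_integral_sum[symmetric]) (rule gI)
  also have "\<dots> = (\<integral>\<^sup>+\<omega>. 1 \<partial>M)"
    by (rule nn_integral_cong) (use fold_subset[OF _ k] in \<open>auto simp: indicator_def\<close>)
  also have "\<dots> = 1"
    by (simp add: emeasure_space_1)
  finally show ?thesis by simp
qed

text \<open>Restricted to small risk, the loss has mean at most N h, so by Markov's inequality it
  reaches N \<epsilon> with probability at most h / \<epsilon>.\<close>

lemma cross_fit_loss_prob:
  fixes \<epsilon> h :: real
  assumes k: "k < K"
    and f: "\<And>T. T \<subseteq> {..<N} \<Longrightarrow> f T \<in> borel_measurable (train_space T \<Otimes>\<^sub>M obs_space p)"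
    and eps: "0 < \<epsilon>" and h: "0 \<le> h"
  shows "prob {\<omega> \<in> space M. ennreal (N * \<epsilon>) < (\<Sum>i\<in>I k \<omega>. f (I k \<omega>) (train (I k \<omega>) \<omega>, Zs i \<omega>))} \<le>
    prob {\<omega> \<in> space M. ennreal h < risk f (I k \<omega>) \<omega>} + h / \<epsilon>"
proof -
  let ?L = "\<lambda>\<omega>. \<Sum>i\<in>I k \<omega>. f (I k \<omega>) (train (I k \<omega>) \<omega>, Zs i \<omega>)" and ?H = "\<lambda>\<omega>. risk f (I k \<omega>) \<omega>"
  let ?G = "\<lambda>\<omega>. ?L \<omega> * indicator {\<omega>. ?H \<omega> \<le> ennreal h} \<omega>"
  have [measurable]: "?H \<in> borel_measurable M"
    by (rule by_fold_measurable[OF k]) (rule risk_meas[OF f])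
  have [measurable]: "?L \<in> borel_measurable M"
  proof (rule by_fold_measurable[OF k, where f="\<lambda>T \<omega>. \<Sum>i\<in>T. f T (train T \<omega>, Zs i \<omega>)"])
    fix T :: "nat set" assume T: "T \<subseteq> {..<N}"
    show "(\<lambda>\<omega>. \<Sum>i\<in>T. f T (train T \<omega>, Zs i \<omega>)) \<in> borel_measurable M"
    proof (rule borel_measurable_sum)
      fix i assume "i \<in> T"
      then have [measurable]: "Zs i \<in> measurable M (obs_space p)"
        using T by (intro Zs_meas) auto
      note [measurable] = f[OF T]
      show "(\<lambda>\<omega>. f T (train T \<omega>, Zs i \<omega>)) \<in> borel_measurable M" by measurable
    qed
  qed
  have "emeasure M {\<omega> \<in> space M. 1 \<le> ennreal (1 / (N * \<epsilon>)) * ?G \<omega>} \<le>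
      ennreal (1 / (N * \<epsilon>)) * (\<integral>\<^sup>+\<omega>. ?G \<omega> * indicator (space M) \<omega> \<partial>M)"
    by (rule nn_integral_Markov_inequality) measurable
  also have "(\<integral>\<^sup>+\<omega>. ?G \<omega> * indicator (space M) \<omega> \<partial>M) = (\<integral>\<^sup>+\<omega>. ?G \<omega> \<partial>M)"
    by (rule nn_integral_cong) simp
  also have "ennreal (1 / (N * \<epsilon>)) * \<dots> \<le> ennreal (1 / (N * \<epsilon>)) * (of_nat N * ennreal h)"
    by (intro mult_left_mono cross_fit_loss_le[OF k f]) auto
  also have "\<dots> = ennreal (h / \<epsilon>)"
    using N_pos eps h by (simp add: ennreal_of_nat_eq_real_of_nat ennreal_mult[symmetric])
  finally have *: "prob {\<omega> \<in> space M. 1 \<le> ennreal (1 / (N * \<epsilon>)) * ?G \<omega>} \<le> h / \<epsilon>"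
    using eps h by (simp add: emeasure_eq_measure)
  \<comment> \<open>Where the risk is at most \<open>h\<close>, the restricted loss is the full
    loss.\<close>
  have "{\<omega> \<in> space M. ennreal (N * \<epsilon>) < ?L \<omega>} \<subseteq>
      {\<omega> \<in> space M. ennreal h < ?H \<omega>} \<union> {\<omega> \<in> space M. 1 \<le> ennreal (1 / (N * \<epsilon>)) * ?G \<omega>}"
  proof safe
    fix \<omega> assume L: "ennreal (N * \<epsilon>) < ?L \<omega>" and "\<not> 1 \<le> ennreal (1 / (N * \<epsilon>)) * ?G \<omega>"
    moreover have "1 \<le> ennreal (1 / (N * \<epsilon>)) * ?L \<omega>"
    proof -
      have "1 = ennreal (1 / (N * \<epsilon>)) * ennreal (N * \<epsilon>)"
        using N_pos eps by (simp add: ennreal_mult[symmetric])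
      also have "\<dots> \<le> ennreal (1 / (N * \<epsilon>)) * ?L \<omega>"
        using L by (intro mult_left_mono) auto
      finally show ?thesis .
    qed
    ultimately show "ennreal h < ?H \<omega>"
      by (cases "?H \<omega> \<le> ennreal h") auto
  qed
  then have "prob {\<omega> \<in> space M. ennreal (N * \<epsilon>) < ?L \<omega>} \<le>
      prob ({\<omega> \<in> space M. ennreal h < ?H \<omega>} \<union> {\<omega> \<in> space M. 1 \<le> ennreal (1 / (N * \<epsilon>)) * ?G \<omega>})"
    by (intro finite_measure_mono) measurable
  also have "\<dots> \<le> prob {\<omega> \<in> space M. ennreal h < ?H \<omega>} +
      prob {\<omega> \<in> space M. 1 \<le> ennreal (1 / (N * \<epsilon>)) * ?G \<omega>}"
    by (intro measure_Un_le) measurable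
  finally show ?thesis using * by linarith
qed

end

subsection \<open>Error of the variance estimator\<close>

lemma sum_square_le:
  fixes x :: "nat \<Rightarrow> real"
  shows "((\<Sum>i<n. x i) / n)\<^sup>2 \<le> (\<Sum>i<n. (x i)\<^sup>2) / n"
proof (cases "n = 0")
  case False
  have "(\<Sum>i<n. x i * 1)\<^sup>2 \<le> (\<Sum>i<n. (x i)\<^sup>2) * (\<Sum>i<n. 1\<^sup>2)"
    by (rule Cauchy_Schwarz_ineq_sum)
  then have "(\<Sum>i<n. x i)\<^sup>2 / (real n)\<^sup>2 \<le> ((\<Sum>i<n. (x i)\<^sup>2) * n) / (real n)\<^sup>2"
    by (intro divide_right_mono) auto
  then show ?thesis
    using False by (simp add: power_divide) (simp add: power2_eq_square)
qed simp

text \<open>Write P and D for the mean squares of u and q - u, and m for the mean of u. The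
  empirical variance of q is P plus a cross term plus D minus c^2. The cross term is at most
  \<kappa> P + D / \<kappa>, and c^2 \<le> 2 m^2 + 2 D, so D is collected 1 + 1 / \<kappa> + 2
  times. Finally \<kappa> P \<le> \<kappa> v + \<kappa> |P - v|.\<close>

lemma empirical_variance_perturbation:
  fixes u q :: "nat \<Rightarrow> real" and v \<kappa> :: real
  assumes n: "0 < n" and k: "0 < \<kappa>" and v: "0 \<le> v"
  defines "c \<equiv> (\<Sum>i<n. q i) / n"
  shows "\<bar>(\<Sum>i<n. (q i - c)\<^sup>2) / n - v\<bar> \<le> (1 + \<kappa>) * \<bar>(\<Sum>i<n. (u i)\<^sup>2) / n - v\<bar> + \<kappa> * v +
    (3 + 1 / \<kappa>) * ((\<Sum>i<n. (q i - u i)\<^sup>2) / n) + 2 * ((\<Sum>i<n. u i) / n)\<^sup>2"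
proof -
  let ?d = "\<lambda>i. q i - u i"
  let ?P = "(\<Sum>i<n. (u i)\<^sup>2) / n" and ?D = "(\<Sum>i<n. (?d i)\<^sup>2) / n" and ?C = "(\<Sum>i<n. 2 * (u i * ?d i)) / n"
    and ?m = "(\<Sum>i<n. u i) / n" and ?e = "(\<Sum>i<n. ?d i) / n"
  have "(\<Sum>i<n. (q i - c)\<^sup>2) = (\<Sum>i<n. (q i)\<^sup>2 - 2 * c * q i + c\<^sup>2)"
    by (intro sum.cong refl) (simp add: power2_diff)
  also have "\<dots> = (\<Sum>i<n. (q i)\<^sup>2) - 2 * c * (\<Sum>i<n. q i) + n * c\<^sup>2"
    by (simp add: sum.distrib sum_subtractf sum_distrib_left)
  also have "(\<Sum>i<n. q i) = n * c"
    using n by (simp add: c_def)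
  finally have "(\<Sum>i<n. (q i - c)\<^sup>2) / n = (\<Sum>i<n. (q i)\<^sup>2) / n - c\<^sup>2"
    using n by (simp add: power2_eq_square field_simps)
  also have "(\<Sum>i<n. (q i)\<^sup>2) = (\<Sum>i<n. (u i)\<^sup>2 + 2 * (u i * ?d i) + (?d i)\<^sup>2)"
    by (intro sum.cong refl) (simp add: power2_eq_square algebra_simps)
  also have "\<dots> / n = ?P + ?C + ?D"
    by (simp add: sum.distrib add_divide_distrib)
  finally have V: "(\<Sum>i<n. (q i - c)\<^sup>2) / n = ?P + ?C + ?D - c\<^sup>2" .
  have "\<bar>2 * (x * y)\<bar> \<le> \<kappa> * x\<^sup>2 + y\<^sup>2 / \<kappa>" for x y
  proof -
    have "0 \<le> (\<kappa> * \<bar>x\<bar> - \<bar>y\<bar>)\<^sup>2 / \<kappa>"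
      using k by simp
    also have "\<dots> = \<kappa> * x\<^sup>2 + y\<^sup>2 / \<kappa> - \<bar>2 * (x * y)\<bar>"
      using k by (simp add: power2_diff abs_mult field_simps) (simp add: power2_eq_square)
    finally show ?thesis by simp
  qed
  then have "\<bar>\<Sum>i<n. 2 * (u i * ?d i)\<bar> \<le> (\<Sum>i<n. \<kappa> * (u i)\<^sup>2 + (?d i)\<^sup>2 / \<kappa>)"
    by (intro order_trans[OF sum_abs] sum_mono)
  also have "\<dots> = \<kappa> * (\<Sum>i<n. (u i)\<^sup>2) + (\<Sum>i<n. (?d i)\<^sup>2) / \<kappa>"
    by (simp add: sum.distrib sum_distrib_left sum_divide_distrib)
  finally have "\<bar>?C\<bar> \<le> (\<kappa> * (\<Sum>i<n. (u i)\<^sup>2) + (\<Sum>i<n. (?d i)\<^sup>2) / \<kappa>) / n"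
    unfolding abs_divide by (simp add: divide_right_mono)
  also have "\<dots> = \<kappa> * ?P + 1 / \<kappa> * ?D"
    by (simp add: add_divide_distrib)
  finally have C: "\<bar>?C\<bar> \<le> \<kappa> * ?P + 1 / \<kappa> * ?D" .
  have "c = ?m + ?e"
    by (simp add: c_def sum_subtractf diff_divide_distrib)
  then have "c\<^sup>2 \<le> 2 * ?m\<^sup>2 + 2 * ?e\<^sup>2"
    using zero_le_power2[of "?m - ?e"] by (simp add: power2_eq_square algebra_simps)
  also have "?e\<^sup>2 \<le> ?D"
    by (rule sum_square_le)
  finally have c: "c\<^sup>2 \<le> 2 * ?m\<^sup>2 + 2 * ?D" by simp
  have D: "0 \<le> ?D"
    by (intro divide_nonneg_nonneg sum_nonneg) auto
  have "\<kappa> * ?P \<le> \<kappa> * v + \<kappa> * \<bar>?P - v\<bar>"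
    using k mult_left_mono[of ?P "v + \<bar>?P - v\<bar>" \<kappa>] by (simp add: distrib_left)
  moreover have "(1 + \<kappa>) * \<bar>?P - v\<bar> = \<bar>?P - v\<bar> + \<kappa> * \<bar>?P - v\<bar>"
    "(3 + 1 / \<kappa>) * ?D = 3 * ?D + 1 / \<kappa> * ?D"
    by (simp_all only: distrib_right mult_1_left)
  ultimately show ?thesis
    unfolding V using C c D zero_le_power2[of c] by linarith
qed

section \<open>Probability bounds at a fixed sample size\<close>

locale dr_sample = dr_population M p R Y X m ps mu s1 s2 +
  cross_fitting M N p Zs "distr M (obs_space p) (obs R Y X)" K I
  for M :: "'a measure" and p R Y X m ps mu s1 s2 N Zs K I +
  fixes f g :: estimator
  assumes est_f: "estimator N p f" and est_g: "estimator N p g"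
begin

abbreviation Q where "Q \<equiv> distr M (obs_space p) (obs R Y X)"

lemma obs_measurable [measurable]: "obs R Y X \<in> measurable M (obs_space p)"
  unfolding obs_def obs_space_def by measurable

text \<open>This is \<open>psi\<close> as a function on the space of observed triples, the form to
  which the results on i.i.d. samples apply.\<close>

definition influence :: "obs \<Rightarrow> real" where
  "influence z = score mu ps z - \<theta>"

lemma influence_measurable [measurable]: "influence \<in> borel_measurable (obs_space p)"
  unfolding influence_def by measurable

lemma influence_obs: "influence (obs R Y X \<omega>) = \<psi> \<omega>"
  by (simp add: influence_def score_obs psi_def)

lemma influence_square_integrable: "integrable Q (\<lambda>z. (influence z)\<^sup>2)"
  by (subst integrable_distr_eq) (use psi2_int in \<open>auto simp: influence_obs\<close>)

lemma influence_square: "(\<integral>z. (influence z)\<^sup>2 \<partial>Q) = variance \<psi>"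
  by (subst integral_distr) (auto simp: influence_obs var_psi)

lemma influence_mean: "(\<integral>z. influence z \<partial>Q) = 0"
  by (subst integral_distr) (auto simp: influence_obs psi_mean)

abbreviation fk where "fk k \<omega> \<equiv> trained f N Zs I k \<omega>"
abbreviation gk where "gk k \<omega> \<equiv> trained g N Zs I k \<omega>"

lemma trained_eq: "trained e N Zs I k \<omega> = e ({..<N} - I k \<omega>) (train (I k \<omega>) \<omega>)"
  by (simp add: trained_def train_def)

lemma estimator_measurable:
  "(\<lambda>(D, x). f ({..<N} - T) D x) \<in> borel_measurable (train_space T \<Otimes>\<^sub>M cov_space p)"
  "(\<lambda>(D, x). g ({..<N} - T) D x) \<in> borel_measurable (train_space T \<Otimes>\<^sub>M cov_space p)"
  using est_f est_g by (auto simp: estimator_def)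

lemma trained_measurable:
  assumes "\<omega> \<in> space M"
  shows "fk k \<omega> \<in> borel_measurable (cov_space p)" "gk k \<omega> \<in> borel_measurable (cov_space p)"
proof -
  let ?T = "I k \<omega>"
  have D: "train ?T \<omega> \<in> space (train_space ?T)"
    using measurable_space[OF train_measurable assms] .
  show "fk k \<omega> \<in> borel_measurable (cov_space p)" "gk k \<omega> \<in> borel_measurable (cov_space p)"
    unfolding trained_eq
    using measurable_compose[OF measurable_Pair1'[OF D] estimator_measurable(1)[of ?T]]
      measurable_compose[OF measurable_Pair1'[OF D] estimator_measurable(2)[of ?T]]
    by simp_all
qed

definition loss :: "nat set \<Rightarrow> (nat \<Rightarrow> obs) \<times> obs \<Rightarrow> ennreal" where
  "loss T = (\<lambda>(D, z). ennreal ((score (f ({..<N} - T) D) (g ({..<N} - T) D) z - score mu ps z)\<^sup>2))"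

lemma score_trained_measurable:
  "(\<lambda>(D, z). score (f ({..<N} - T) D) (g ({..<N} - T) D) z) \<in>
    borel_measurable (train_space T \<Otimes>\<^sub>M obs_space p)"
proof -
  let ?L = "train_space T \<Otimes>\<^sub>M obs_space p"
  have x: "(\<lambda>z. (fst z, snd (snd (snd z)))) \<in> measurable ?L (train_space T \<Otimes>\<^sub>M cov_space p)"
    unfolding obs_space_def by measurable
  have [measurable]: "(\<lambda>z. f ({..<N} - T) (fst z) (snd (snd (snd z)))) \<in> borel_measurable ?L"
    "(\<lambda>z. g ({..<N} - T) (fst z) (snd (snd (snd z)))) \<in> borel_measurable ?L"
    using measurable_compose[OF x estimator_measurable(1)] measurable_compose[OF x estimator_measurable(2)]
    by simp_all
  have [measurable]: "(\<lambda>z. fst (snd z)) \<in> borel_measurable ?L" "(\<lambda>z. fst (snd (snd z))) \<in> borel_measurable ?L"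
    unfolding obs_space_def by measurable
  show ?thesis
    unfolding score_def case_prod_beta by measurable
qed

lemma loss_measurable: "loss T \<in> borel_measurable (train_space T \<Otimes>\<^sub>M obs_space p)"
proof -
  have [measurable]: "(\<lambda>z. score (f ({..<N} - T) (fst z)) (g ({..<N} - T) (fst z)) (snd z)) \<in>
      borel_measurable (train_space T \<Otimes>\<^sub>M obs_space p)"
    using score_trained_measurable by (simp add: case_prod_beta)
  show ?thesis
    unfolding loss_def case_prod_beta by measurable
qed

definition risk_f where
  "risk_f k \<omega> = E_X M p X (\<lambda>x. a / ps x * (fk k \<omega> x - mu x)\<^sup>2)"
definition risk_g where
  "risk_g k \<omega> = E_X M p X (\<lambda>x. a / ps x * (1 - ps x / gk k \<omega> x)\<^sup>2)"
definition risk_fg where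
  "risk_fg k \<omega> = E_X M p X (\<lambda>x. a / ps x * (1 - ps x / gk k \<omega> x)\<^sup>2 * (fk k \<omega> x - mu x)\<^sup>2)"

lemma E_X_fold_measurable:
  assumes "k < K" "\<And>T. F T \<in> borel_measurable (train_space T \<Otimes>\<^sub>M cov_space p)"
  shows "(\<lambda>\<omega>. E_X M p X (\<lambda>x. F (I k \<omega>) (train (I k \<omega>) \<omega>, x))) \<in> borel_measurable M"
proof (rule by_fold_measurable[OF assms(1), where f="\<lambda>T \<omega>. E_X M p X (\<lambda>x. F T (train T \<omega>, x))"])
  fix T :: "nat set"
  interpret D: prob_space "distr M (cov_space p) X"
    by (rule prob_space_distr) measurable
  note [measurable] = assms(2)[of T]
  have "(\<lambda>D. \<integral>\<^sup>+x. ennreal (F T (D, x)) \<partial>distr M (cov_space p) X) \<in> borel_measurable (train_space T)"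
    by (rule D.borel_measurable_nn_integral_fst[of "\<lambda>z. ennreal (F T z)", simplified]) measurable
  then show "(\<lambda>\<omega>. E_X M p X (\<lambda>x. F T (train T \<omega>, x))) \<in> borel_measurable M"
    unfolding E_X_def by (rule measurable_compose[OF train_measurable])
qed

lemma risk_measurable [measurable]:
  assumes "k < K"
  shows "risk_f k \<in> borel_measurable M" "risk_g k \<in> borel_measurable M" "risk_fg k \<in> borel_measurable M"
proof -
  let ?L = "\<lambda>T. train_space T \<Otimes>\<^sub>M cov_space p"
  have [measurable]: "(\<lambda>z. f ({..<N} - T) (fst z) (snd z)) \<in> borel_measurable (?L T)"
    "(\<lambda>z. g ({..<N} - T) (fst z) (snd z)) \<in> borel_measurable (?L T)" for T
    using estimator_measurable[of T] by (simp_all add: case_prod_beta)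
  let ?f = "\<lambda>T z. f ({..<N} - T) (fst z) (snd z)" and ?g = "\<lambda>T z. g ({..<N} - T) (fst z) (snd z)"
  have "(\<lambda>\<omega>. E_X M p X (\<lambda>x. (\<lambda>z. a / ps (snd z) * (?f (I k \<omega>) z - mu (snd z))\<^sup>2) (train (I k \<omega>) \<omega>, x)))
      \<in> borel_measurable M"
    by (rule E_X_fold_measurable[OF assms]) measurable
  then show "risk_f k \<in> borel_measurable M"
    unfolding risk_f_def trained_eq by simp
  have "(\<lambda>\<omega>. E_X M p X (\<lambda>x. (\<lambda>z. a / ps (snd z) * (1 - ps (snd z) / ?g (I k \<omega>) z)\<^sup>2) (train (I k \<omega>) \<omega>, x)))
      \<in> borel_measurable M"
    by (rule E_X_fold_measurable[OF assms]) measurable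
  then show "risk_g k \<in> borel_measurable M"
    unfolding risk_g_def trained_eq by simp
  have "(\<lambda>\<omega>. E_X M p X (\<lambda>x. (\<lambda>z. a / ps (snd z) * (1 - ps (snd z) / ?g (I k \<omega>) z)\<^sup>2 *
      (?f (I k \<omega>) z - mu (snd z))\<^sup>2) (train (I k \<omega>) \<omega>, x))) \<in> borel_measurable M"
    by (rule E_X_fold_measurable[OF assms]) measurable
  then show "risk_fg k \<in> borel_measurable M"
    unfolding risk_fg_def trained_eq by simp
qed

lemma E_X_scaled:
  assumes [measurable]: "h \<in> borel_measurable (cov_space p)"
  shows "E_X M p X (\<lambda>x. a / ps x * h x) = ennreal a * (\<integral>\<^sup>+\<omega>. ennreal (1 / ps (X \<omega>) * h (X \<omega>)) \<partial>M)"
proof -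
  have "E_X M p X (\<lambda>x. a / ps x * h x) = (\<integral>\<^sup>+\<omega>. ennreal (a / ps (X \<omega>) * h (X \<omega>)) \<partial>M)"
    unfolding E_X_def by (rule nn_integral_distr) measurable
  also have "\<dots> = (\<integral>\<^sup>+\<omega>. ennreal a * ennreal (1 / ps (X \<omega>) * h (X \<omega>)) \<partial>M)"
    using a_pos by (subst ennreal_mult'[symmetric]) simp_all
  also have "\<dots> = ennreal a * (\<integral>\<^sup>+\<omega>. ennreal (1 / ps (X \<omega>) * h (X \<omega>)) \<partial>M)"
    by (rule nn_integral_cmult) measurable
  finally show ?thesis .
qed

text \<open>At a fixed \<omega> the trained estimators are fixed measurable functions, so the
  population bound for score differences applies to them.\<close>

lemma risk_le:
  assumes \<omega>: "\<omega> \<in> space M"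
  shows "ennreal a * risk loss (I k \<omega>) \<omega> \<le>
    6 * risk_f k \<omega> + 3 * ennreal s2 * risk_g k \<omega> + 3 * risk_fg k \<omega>"
proof -
  note [measurable] = trained_measurable[OF \<omega>, of k]
  have "risk loss (I k \<omega>) \<omega> =
      (\<integral>\<^sup>+z. ennreal ((score (fk k \<omega>) (gk k \<omega>) z - score mu ps z)\<^sup>2) \<partial>Q)"
    by (simp add: risk_def loss_def trained_eq)
  also have "\<dots> = (\<integral>\<^sup>+\<omega>'. ennreal ((score (fk k \<omega>) (gk k \<omega>) (obs R Y X \<omega>') - score mu ps (obs R Y X \<omega>'))\<^sup>2) \<partial>M)"
    by (rule nn_integral_distr) measurable
  also note score_diff_bound[OF trained_measurable[OF \<omega>, of k]]
  finally have "ennreal a * risk loss (I k \<omega>) \<omega> \<le> ennreal a * (6 *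
      (\<integral>\<^sup>+\<omega>'. ennreal (1 / ps (X \<omega>') * (fk k \<omega> (X \<omega>') - mu (X \<omega>'))\<^sup>2) \<partial>M) +
    3 * ennreal s2 * (\<integral>\<^sup>+\<omega>'. ennreal (1 / ps (X \<omega>') * (1 - ps (X \<omega>') / gk k \<omega> (X \<omega>'))\<^sup>2) \<partial>M) +
    3 * (\<integral>\<^sup>+\<omega>'. ennreal (1 / ps (X \<omega>') * (1 - ps (X \<omega>') / gk k \<omega> (X \<omega>'))\<^sup>2 * (fk k \<omega> (X \<omega>') - mu (X \<omega>'))\<^sup>2) \<partial>M))"
    by (auto intro!: mult_left_mono)
  also have "\<dots> = 6 * risk_f k \<omega> + 3 * ennreal s2 * risk_g k \<omega> + 3 * risk_fg k \<omega>"
    unfolding risk_f_def risk_g_def risk_fg_def mult.assoc[of "a / _"] mult.assoc[of "1 / _"]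
    by (subst (1 2 3) E_X_scaled) (measurable, simp add: distrib_left ac_simps)
  finally show ?thesis .
qed

text \<open>Disjointness of the folds leaves one nonzero summand at most. A finite sum in place of a
  definite description reduces measurability to that of each fold.\<close>

definition score_hat :: "nat \<Rightarrow> 'a \<Rightarrow> real" where
  "score_hat i \<omega> = (\<Sum>k<K. if i \<in> I k \<omega> then score (fk k \<omega>) (gk k \<omega>) (Zs i \<omega>) else 0)"

lemma score_hat_eq:
  assumes "\<omega> \<in> space M" "k < K" "i \<in> I k \<omega>"
  shows "score_hat i \<omega> = score (fk k \<omega>) (gk k \<omega>) (Zs i \<omega>)"
proof -
  have "(i \<in> I l \<omega>) = (l = k)" if "l < K" for l
    using fold_disjoint[OF assms(1)] assms that by (auto simp: disjoint_family_on_def)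
  then have "score_hat i \<omega> = (\<Sum>l<K. if l = k then score (fk l \<omega>) (gk l \<omega>) (Zs i \<omega>) else 0)"
    unfolding score_hat_def by (intro sum.cong refl) auto
  then show ?thesis
    using assms by simp
qed

lemma score_hat_cross_fit:
  assumes "\<omega> \<in> space M" "i < N" and Zs: "Zs i = obs (Rs i) (Ys i) (Xs i)"
  shows "score_hat i \<omega> = cross_fit f K N Zs I Xs \<omega> i +
    Rs i \<omega> / cross_fit g K N Zs I Xs \<omega> i * (Ys i \<omega> - cross_fit f K N Zs I Xs \<omega> i)"
proof -
  obtain k where k: "k < K" "i \<in> I k \<omega>"
    using fold_union[OF assms(1)] assms(2) by blast
  have "(THE k. k < K \<and> i \<in> I k \<omega>) = k"
    using fold_disjoint[OF assms(1)] k by (intro the_equality) (auto simp: disjoint_family_on_def)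
  then show ?thesis
    unfolding score_hat_eq[OF assms(1) k] cross_fit_def Zs by (simp add: score_obs)
qed

lemma score_hat_measurable:
  assumes "i < N"
  shows "score_hat i \<in> borel_measurable M"
  unfolding score_hat_def
proof (rule borel_measurable_sum)
  fix k assume "k \<in> {..<K}"
  then have k: "k < K" by simp
  show "(\<lambda>\<omega>. if i \<in> I k \<omega> then score (fk k \<omega>) (gk k \<omega>) (Zs i \<omega>) else 0) \<in> borel_measurable M"
    unfolding trained_eq
  proof (rule by_fold_measurable[OF k, where f="\<lambda>T \<omega>. if i \<in> T then score (f ({..<N} - T) (train T \<omega>))
      (g ({..<N} - T) (train T \<omega>)) (Zs i \<omega>) else 0"])
    fix T :: "nat set"
    have "(\<lambda>\<omega>. (train T \<omega>, Zs i \<omega>)) \<in> measurable M (train_space T \<Otimes>\<^sub>M obs_space p)"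
      by (intro measurable_Pair train_measurable Zs_meas assms)
    from measurable_compose[OF this score_trained_measurable]
    show "(\<lambda>\<omega>. if i \<in> T then score (f ({..<N} - T) (train T \<omega>))
      (g ({..<N} - T) (train T \<omega>)) (Zs i \<omega>) else 0) \<in> borel_measurable M"
      by (cases "i \<in> T") auto
  qed
qed

definition variance_hat :: "'a \<Rightarrow> real" where
  "variance_hat \<omega> = (\<Sum>i<N. (score_hat i \<omega> - (\<Sum>j<N. score_hat j \<omega>) / N)\<^sup>2) / N"

lemma variance_hat_measurable [measurable]: "variance_hat \<in> borel_measurable M"
  unfolding variance_hat_def
  by (intro borel_measurable_divide borel_measurable_sum borel_measurable_power borel_measurable_diff
      borel_measurable_const score_hat_measurable) auto

text \<open>\<open>theta_hat\<close> is the mean of the estimated scores, which turns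
  \<open>V_hat\<close> into their empirical variance about their own mean.\<close>

lemma V_hat_eq:
  assumes \<omega>: "\<omega> \<in> space M" and Zs: "\<And>i. Zs i = obs (Rs i) (Ys i) (Xs i)"
  shows "V_hat N (\<lambda>i. Rs i \<omega>) (\<lambda>i. Ys i \<omega>) (cross_fit f K N Zs I Xs \<omega>) (cross_fit g K N Zs I Xs \<omega>)
    (theta_hat N (\<lambda>i. Rs i \<omega>) (\<lambda>i. Ys i \<omega>) (cross_fit f K N Zs I Xs \<omega>) (cross_fit g K N Zs I Xs \<omega>)) =
    variance_hat \<omega>"
proof -
  note eq = score_hat_cross_fit[where Rs=Rs and Ys=Ys and Xs=Xs, OF \<omega> _ Zs]
  have "theta_hat N (\<lambda>i. Rs i \<omega>) (\<lambda>i. Ys i \<omega>) (cross_fit f K N Zs I Xs \<omega>) (cross_fit g K N Zs I Xs \<omega>) =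
      (\<Sum>j<N. score_hat j \<omega>) / N"
    unfolding theta_hat_def by (intro arg_cong2[where f="(/)"] sum.cong refl) (simp add: eq)
  then show ?thesis
    unfolding V_hat_def variance_hat_def
    by (intro arg_cong2[where f="(/)"] sum.cong refl) (simp add: eq algebra_simps)
qed

abbreviation mean_square_dev where
  "mean_square_dev \<omega> \<equiv> \<bar>(\<Sum>i<N. (influence (Zs i \<omega>))\<^sup>2) / N - variance \<psi>\<bar>"
abbreviation square_mean where
  "square_mean \<omega> \<equiv> ((\<Sum>i<N. influence (Zs i \<omega>)) / N)\<^sup>2"
abbreviation mean_square_error where
  "mean_square_error \<omega> \<equiv> (\<Sum>i<N. (score_hat i \<omega> - score mu ps (Zs i \<omega>))\<^sup>2) / N"

lemma component_measurable:
  "mean_square_dev \<in> borel_measurable M" "square_mean \<in> borel_measurable M"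
  "mean_square_error \<in> borel_measurable M"
proof -
  have [measurable]: "(\<lambda>\<omega>. influence (Zs i \<omega>)) \<in> borel_measurable M"
    "(\<lambda>\<omega>. score mu ps (Zs i \<omega>)) \<in> borel_measurable M" "score_hat i \<in> borel_measurable M"
    if "i \<in> {..<N}" for i
    using that by (auto intro: fn_meas score_hat_measurable)
  show "mean_square_dev \<in> borel_measurable M" "square_mean \<in> borel_measurable M"
    "mean_square_error \<in> borel_measurable M"
    by measurable
qed

text \<open>An empirical variance does not change when \<theta> is subtracted from all scores, which
  makes them comparable with the centred influence values. The term 2 s2 \<kappa> comes from a V
  \<le> 2 s2.\<close>

lemma variance_hat_error:
  assumes "0 < \<kappa>"
  shows "a * \<bar>variance_hat \<omega> - variance \<psi>\<bar> \<le> (1 + \<kappa>) * (a * mean_square_dev \<omega>) + 2 * s2 * \<kappa> +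
    (3 + 1 / \<kappa>) * (a * mean_square_error \<omega>) + 2 * (a * square_mean \<omega>)"
proof -
  let ?q = "\<lambda>i. score_hat i \<omega> - \<theta>"
  have c: "(\<Sum>i<N. ?q i) / N = (\<Sum>i<N. score_hat i \<omega>) / N - \<theta>"
    using N_pos by (simp add: sum_subtractf diff_divide_distrib)
  have vh: "variance_hat \<omega> = (\<Sum>i<N. (?q i - (\<Sum>j<N. ?q j) / N)\<^sup>2) / N"
    unfolding variance_hat_def c by simp
  have mse: "mean_square_error \<omega> = (\<Sum>i<N. (?q i - influence (Zs i \<omega>))\<^sup>2) / N"
    by (simp add: influence_def)
  have "\<bar>variance_hat \<omega> - variance \<psi>\<bar> \<le> (1 + \<kappa>) * mean_square_dev \<omega> + \<kappa> * variance \<psi> +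
      (3 + 1 / \<kappa>) * mean_square_error \<omega> + 2 * square_mean \<omega>"
    unfolding vh mse by (rule empirical_variance_perturbation[OF N_pos assms variance_positive])
  then have "a * \<bar>variance_hat \<omega> - variance \<psi>\<bar> \<le> a * ((1 + \<kappa>) * mean_square_dev \<omega> + \<kappa> * variance \<psi> +
      (3 + 1 / \<kappa>) * mean_square_error \<omega> + 2 * square_mean \<omega>)"
    using a_pos by (intro mult_left_mono) auto
  also have "\<dots> = (1 + \<kappa>) * (a * mean_square_dev \<omega>) + \<kappa> * (a * variance \<psi>) +
      (3 + 1 / \<kappa>) * (a * mean_square_error \<omega>) + 2 * (a * square_mean \<omega>)"
    by (simp add: algebra_simps)
  also have "\<kappa> * (a * variance \<psi>) \<le> 2 * s2 * \<kappa>"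
  proof -
    have "a * variance \<psi> \<le> 2 * s2"
      using var_psi_upper a_pos by (simp add: field_simps)
    then have "\<kappa> * (a * variance \<psi>) \<le> \<kappa> * (2 * s2)"
      using assms by (intro mult_left_mono) auto
    then show ?thesis by (simp add: mult.commute)
  qed
  finally show ?thesis by simp
qed

lemma prob_mean_square_dev:
  assumes c: "0 < c" and b: "0 < b"
  shows "prob {\<omega> \<in> space M. b < a * mean_square_dev \<omega>} \<le> (c / 2 * (1 + 2 * s2) + 2 *
    enn2real (ennreal (1 / a) * (\<integral>\<^sup>+\<omega>. ennreal ((\<psi> \<omega>)\<^sup>2) * indicator {\<omega>. \<bar>\<psi> \<omega>\<bar> > c * sqrt (N / a)} \<omega> \<partial>M))) / b"
    (is "_ \<le> (_ + 2 * enn2real (_ * ?I)) / b")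
proof -
  let ?t = "\<lambda>z. (influence z)\<^sup>2 * indicator {z. \<bar>influence z\<bar> > c * sqrt (N / a)} z"
  note lln = truncated_law_of_large_numbers[OF influence_measurable influence_square_integrable a_pos c,
      unfolded influence_square]
  have t: "integrable M (\<lambda>\<omega>. (\<psi> \<omega>)\<^sup>2 * indicator {\<omega>. \<bar>\<psi> \<omega>\<bar> > c * sqrt (N / a)} \<omega>)"
    by (rule Bochner_Integration.integrable_bound[OF psi2_int]) (auto split: split_indicator)
  have tQ: "(\<integral>z. ?t z \<partial>Q) = (\<integral>\<omega>. (\<psi> \<omega>)\<^sup>2 * indicator {\<omega>. \<bar>\<psi> \<omega>\<bar> > c * sqrt (N / a)} \<omega> \<partial>M)"
    by (subst integral_distr) (auto simp: influence_obs indicator_def)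
  have "?I = (\<integral>\<^sup>+\<omega>. ennreal ((\<psi> \<omega>)\<^sup>2 * indicator {\<omega>. \<bar>\<psi> \<omega>\<bar> > c * sqrt (N / a)} \<omega>) \<partial>M)"
    by (intro nn_integral_cong) (auto split: split_indicator)
  also have "\<dots> = ennreal (\<integral>\<omega>. (\<psi> \<omega>)\<^sup>2 * indicator {\<omega>. \<bar>\<psi> \<omega>\<bar> > c * sqrt (N / a)} \<omega> \<partial>M)"
    by (rule nn_integral_eq_integral[OF t]) auto
  finally have I: "?I = ennreal (\<integral>z. ?t z \<partial>Q)"
    unfolding tQ .
  have t0: "0 \<le> (\<integral>z. ?t z \<partial>Q)"
    by (intro Bochner_Integration.integral_nonneg) auto
  have "enn2real (ennreal (1 / a) * ?I) = 1 / a * (\<integral>z. ?t z \<partial>Q)"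
    unfolding I using t0 a_pos by (simp add: enn2real_mult)
  \<comment> \<open>The law of large numbers produces the factor \<open>a\<close>, the Tail
    Condition has 1 / a, and a \<le> 1 \<le> 1 / a.\<close>
  moreover have "a * (\<integral>z. ?t z \<partial>Q) \<le> 1 / a * (\<integral>z. ?t z \<partial>Q)"
    by (intro mult_right_mono order_trans[OF a_le_1 inverse_a] t0)
  moreover have "c / 2 * (1 + a * variance \<psi>) \<le> c / 2 * (1 + 2 * s2)"
    using var_psi_upper a_pos c by (intro mult_left_mono) (auto simp: field_simps)
  ultimately have "(\<integral>\<omega>. a * mean_square_dev \<omega> \<partial>M) \<le> c / 2 * (1 + 2 * s2) + 2 * enn2real (ennreal (1 / a) * ?I)"
    using lln(2) by simp
  moreover have "prob {\<omega> \<in> space M. b \<le> a * mean_square_dev \<omega>} \<le> (\<integral>\<omega>. a * mean_square_dev \<omega> \<partial>M) / b"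
    by (rule integral_Markov_inequality_measure[where A="{}"]) (use lln(1) a_pos b in auto)
  moreover have "prob {\<omega> \<in> space M. b < a * mean_square_dev \<omega>} \<le> prob {\<omega> \<in> space M. b \<le> a * mean_square_dev \<omega>}"
    using component_measurable(1) by (intro finite_measure_mono) auto
  ultimately show ?thesis
    using b by (meson divide_right_mono less_imp_le order_trans)
qed

text \<open>The sample mean has variance V / N, and multiplication by \<open>a\<close> leaves at
  most 2 s2 / N.\<close>

lemma prob_square_mean:
  assumes b: "0 < b"
  shows "prob {\<omega> \<in> space M. b < a * square_mean \<omega>} \<le> 2 * s2 / b * (1 / N)"
proof -
  note dev = mean_square_deviation[OF influence_measurable influence_square_integrable,
      unfolded influence_square influence_mean, simplified]
  have "prob {\<omega> \<in> space M. b < a * square_mean \<omega>} \<le> prob {\<omega> \<in> space M. b \<le> a * square_mean \<omega>}"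
    using component_measurable(2) by (intro finite_measure_mono) auto
  also have "\<dots> \<le> (\<integral>\<omega>. a * square_mean \<omega> \<partial>M) / b"
    by (rule integral_Markov_inequality_measure[where A="{}"]) (use dev(1) a_pos b in auto)
  also have "(\<integral>\<omega>. a * square_mean \<omega> \<partial>M) \<le> 2 * s2 * (1 / N)"
  proof -
    have "(\<integral>\<omega>. a * square_mean \<omega> \<partial>M) = a * (\<integral>\<omega>. square_mean \<omega> \<partial>M)"
      by simp
    also have "\<dots> \<le> a * (variance \<psi> / N)"
      by (rule mult_left_mono[OF dev(2)]) (use a_pos in simp)
    also have "\<dots> \<le> a * (2 * s2 / a / N)"
      using a_pos var_psi_upper by (intro mult_left_mono divide_right_mono) auto
    also have "\<dots> = 2 * s2 * (1 / N)"
      using a_pos by simp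
    finally show ?thesis .
  qed
  finally show ?thesis
    using b by (simp add: divide_right_mono mult.commute)
qed

lemma K_pos: "0 < K"
  using not_empty fold_union N_pos by (cases "K = 0") force+

lemma prob_mean_square_error:
  assumes b: "0 < b" and h: "0 \<le> h"
  shows "prob {\<omega> \<in> space M. b < a * mean_square_error \<omega>} \<le>
    (\<Sum>k<K. prob {\<omega> \<in> space M. ennreal h < risk_f k \<omega>} + prob {\<omega> \<in> space M. ennreal h < risk_g k \<omega>} +
      prob {\<omega> \<in> space M. ennreal h < risk_fg k \<omega>}) + (real K)\<^sup>2 * (9 + 3 * s2) * h / b"
proof -
  \<comment> \<open>An equal share of \<open>b\<close> for each of the K folds, before
    multiplication by \<open>a\<close>.\<close>
  define \<epsilon> where "\<epsilon> = b / (K * a)"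
  \<comment> \<open>If all three weighted risks are at most \<open>h\<close>, then \<open>a\<close>
    times the loss risk is at most (6 + 3 s2 + 3) h. Summing h' / \<epsilon> over the K folds
    produces the factor K^2.\<close>
  define h' where "h' = (9 + 3 * s2) * h / a"
  have pos: "0 < \<epsilon>" "0 \<le> h'"
    using b h s2 a_pos K_pos by (auto simp: \<epsilon>_def h'_def)
  let ?d = "\<lambda>i \<omega>. (score_hat i \<omega> - score mu ps (Zs i \<omega>))\<^sup>2"
  let ?L = "\<lambda>k \<omega>. \<Sum>i\<in>I k \<omega>. loss (I k \<omega>) (train (I k \<omega>) \<omega>, Zs i \<omega>)"
  let ?B = "\<lambda>k. {\<omega> \<in> space M. ennreal (N * \<epsilon>) < ?L k \<omega>}"
  have L: "?L k \<omega> = ennreal (\<Sum>i\<in>I k \<omega>. ?d i \<omega>)" if "\<omega> \<in> space M" "k < K" for k \<omega>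
  proof -
    have "?L k \<omega> = (\<Sum>i\<in>I k \<omega>. ennreal (?d i \<omega>))"
      using that by (intro sum.cong refl) (simp add: loss_def score_hat_eq trained_eq)
    then show ?thesis
      by (simp add: sum_ennreal)
  qed
  have Lm: "?L k \<in> borel_measurable M" if "k < K" for k
  proof -
    have "(\<lambda>\<omega>. \<Sum>i\<in>T. loss T (train T \<omega>, Zs i \<omega>)) \<in> borel_measurable M" if T: "T \<subseteq> {..<N}" for T
    proof (rule borel_measurable_sum)
      fix i assume "i \<in> T"
      then have "(\<lambda>\<omega>. (train T \<omega>, Zs i \<omega>)) \<in> measurable M (train_space T \<Otimes>\<^sub>M obs_space p)"
        using T by (intro measurable_Pair train_measurable Zs_meas) auto
      from measurable_compose[OF this loss_measurable]
      show "(\<lambda>\<omega>. loss T (train T \<omega>, Zs i \<omega>)) \<in> borel_measurable M" .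
    qed
    from by_fold_measurable[OF that, where f="\<lambda>T \<omega>. \<Sum>i\<in>T. loss T (train T \<omega>, Zs i \<omega>)", OF this]
    show ?thesis .
  qed
  have Bm: "?B k \<in> events" if "k < K" for k
    using Lm[OF that] by measurable
  have "{\<omega> \<in> space M. b < a * mean_square_error \<omega>} \<subseteq> (\<Union>k<K. ?B k)"
  proof (rule subsetI, rule ccontr)
    fix \<omega> assume \<omega>: "\<omega> \<in> {\<omega> \<in> space M. b < a * mean_square_error \<omega>}" and notB: "\<omega> \<notin> (\<Union>k<K. ?B k)"
    then have sp: "\<omega> \<in> space M" by simp
    have le: "(\<Sum>i\<in>I k \<omega>. ?d i \<omega>) \<le> N * \<epsilon>" if "k < K" for k
    proof -
      have "ennreal (\<Sum>i\<in>I k \<omega>. ?d i \<omega>) \<le> ennreal (N * \<epsilon>)"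
        unfolding L[OF sp that, symmetric] using notB that sp by (auto simp: not_less)
      then show ?thesis
        using pos by (simp add: ennreal_le_iff)
    qed
    have "(\<Sum>i<N. ?d i \<omega>) = (\<Sum>k<K. \<Sum>i\<in>I k \<omega>. ?d i \<omega>)"
      unfolding fold_union[OF sp, symmetric]
      by (rule sum.UNION_disjoint)
        (use fold_disjoint[OF sp] fold_subset[OF sp] in
          \<open>auto simp: disjoint_family_on_def intro!: finite_subset[OF _ finite_lessThan[of N]]\<close>)
    also have "\<dots> \<le> (\<Sum>k<K. N * \<epsilon>)"
      by (intro sum_mono le) auto
    also have "\<dots> = N * (b / a)"
      using K_pos a_pos by (simp add: \<epsilon>_def)
    finally have "a * mean_square_error \<omega> \<le> b"
      using a_pos N_pos by (simp add: field_simps)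
    with \<omega> show False by simp
  qed
  then have "prob {\<omega> \<in> space M. b < a * mean_square_error \<omega>} \<le> prob (\<Union>k<K. ?B k)"
    using Bm by (intro finite_measure_mono) auto
  also have "\<dots> \<le> (\<Sum>k<K. prob (?B k))"
    using Bm by (intro finite_measure_subadditive_finite) auto
  also have "\<dots> \<le> (\<Sum>k<K. (prob {\<omega> \<in> space M. ennreal h < risk_f k \<omega>} + prob {\<omega> \<in> space M. ennreal h < risk_g k \<omega>} +
      prob {\<omega> \<in> space M. ennreal h < risk_fg k \<omega>}) + h' / \<epsilon>)"
  proof (rule sum_mono)
    fix k assume "k \<in> {..<K}"
    then have k: "k < K" by simp
    note [measurable] = risk_measurable[OF k]
    let ?F = "{\<omega> \<in> space M. ennreal h < risk_f k \<omega>}" and ?G = "{\<omega> \<in> space M. ennreal h < risk_g k \<omega>}"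
      and ?H = "{\<omega> \<in> space M. ennreal h < risk_fg k \<omega>}"
    have "{\<omega> \<in> space M. ennreal h' < risk loss (I k \<omega>) \<omega>} \<subseteq> ?F \<union> ?G \<union> ?H"
    proof (rule subsetI, rule ccontr)
      fix \<omega> assume \<omega>: "\<omega> \<in> {\<omega> \<in> space M. ennreal h' < risk loss (I k \<omega>) \<omega>}" and "\<omega> \<notin> ?F \<union> ?G \<union> ?H"
      then have sp: "\<omega> \<in> space M" and r: "risk_f k \<omega> \<le> ennreal h" "risk_g k \<omega> \<le> ennreal h" "risk_fg k \<omega> \<le> ennreal h"
        by auto
      have "ennreal a * ennreal h' < ennreal a * risk loss (I k \<omega>) \<omega>"
        using \<omega> a_pos by (intro ennreal_mult_strict_left_mono) auto
      also have "\<dots> \<le> 6 * risk_f k \<omega> + 3 * ennreal s2 * risk_g k \<omega> + 3 * risk_fg k \<omega>"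
        by (rule risk_le[OF sp])
      also have "\<dots> \<le> 6 * ennreal h + 3 * ennreal s2 * ennreal h + 3 * ennreal h"
        by (intro add_mono mult_left_mono r) auto
      also have "\<dots> = ennreal ((9 + 3 * s2) * h)"
        using h s2 by (simp add: ennreal_mult[symmetric] ennreal_plus[symmetric] ennreal_numeral[symmetric]
            algebra_simps del: ennreal_plus ennreal_numeral)
      also have "\<dots> = ennreal a * ennreal h'"
        using a_pos pos by (simp add: h'_def ennreal_mult[symmetric])
      finally show False by simp
    qed
    then have "prob {\<omega> \<in> space M. ennreal h' < risk loss (I k \<omega>) \<omega>} \<le> prob (?F \<union> ?G \<union> ?H)"
      by (intro finite_measure_mono) auto
    also have "\<dots> \<le> prob ?F + prob ?G + prob ?H"
      by (intro order_trans[OF measure_Un_le] add_mono measure_Un_le order.refl) auto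
    finally show "prob (?B k) \<le> (prob ?F + prob ?G + prob ?H) + h' / \<epsilon>"
      using cross_fit_loss_prob[where f=loss, OF k loss_measurable pos] by linarith
  qed
  also have "\<dots> = (\<Sum>k<K. prob {\<omega> \<in> space M. ennreal h < risk_f k \<omega>} + prob {\<omega> \<in> space M. ennreal h < risk_g k \<omega>} +
      prob {\<omega> \<in> space M. ennreal h < risk_fg k \<omega>}) + K * (h' / \<epsilon>)"
    by (simp add: sum.distrib)
  also have "K * (h' / \<epsilon>) = (real K)\<^sup>2 * (9 + 3 * s2) * h / b"
    using a_pos b by (simp add: h'_def \<epsilon>_def power2_eq_square)
  finally show ?thesis .
qed

text \<open>Since a V \<ge> s1, a relative error above \<epsilon> forces the scaled error
  \<open>a * \<bar>variance_hat \<omega> - variance \<psi>\<bar>\<close> above s1 \<epsilon>. By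
  \<open>budget\<close> this is impossible when the three random terms stay below b1, b2 and
  b3.\<close>

lemma prob_variance_ratio:
  assumes pos: "0 < \<epsilon>" "0 < \<kappa>" "0 < b1" "0 < b2" "0 < b3" "0 < c" "0 \<le> h"
    and budget: "(1 + \<kappa>) * b1 + 2 * s2 * \<kappa> + (3 + 1 / \<kappa>) * b2 + 2 * b3 \<le> s1 * \<epsilon>"
  shows "prob {\<omega> \<in> space M. \<epsilon> < \<bar>variance_hat \<omega> / variance \<psi> - 1\<bar>} \<le>
    (c / 2 * (1 + 2 * s2) + 2 *
      enn2real (ennreal (1 / a) * (\<integral>\<^sup>+\<omega>. ennreal ((\<psi> \<omega>)\<^sup>2) * indicator {\<omega>. \<bar>\<psi> \<omega>\<bar> > c * sqrt (N / a)} \<omega> \<partial>M))) / b1 +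
    2 * s2 / b3 * (1 / N) +
    ((\<Sum>k<K. prob {\<omega> \<in> space M. ennreal h < risk_f k \<omega>} + prob {\<omega> \<in> space M. ennreal h < risk_g k \<omega>} +
      prob {\<omega> \<in> space M. ennreal h < risk_fg k \<omega>}) + (real K)\<^sup>2 * (9 + 3 * s2) * h / b2)"
proof -
  let ?A = "{\<omega> \<in> space M. b1 < a * mean_square_dev \<omega>}" and ?B = "{\<omega> \<in> space M. b3 < a * square_mean \<omega>}"
    and ?C = "{\<omega> \<in> space M. b2 < a * mean_square_error \<omega>}"
  have events: "?A \<in> events" "?B \<in> events" "?C \<in> events"
    by (rule borel_measurable_less borel_measurable_const borel_measurable_times component_measurable)+
  have V: "s1 \<le> a * variance \<psi>" "0 < variance \<psi>"
  proof -
    show "s1 \<le> a * variance \<psi>"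
      using var_psi_lower a_pos by (simp add: field_simps)
    then show "0 < variance \<psi>"
      using s1 a_pos by (metis less_le_trans zero_less_mult_pos)
  qed
  have "{\<omega> \<in> space M. \<epsilon> < \<bar>variance_hat \<omega> / variance \<psi> - 1\<bar>} \<subseteq> ?A \<union> ?B \<union> ?C"
  proof (rule subsetI, rule ccontr)
    fix \<omega> assume \<omega>: "\<omega> \<in> {\<omega> \<in> space M. \<epsilon> < \<bar>variance_hat \<omega> / variance \<psi> - 1\<bar>}" and "\<omega> \<notin> ?A \<union> ?B \<union> ?C"
    then have le: "a * mean_square_dev \<omega> \<le> b1" "a * square_mean \<omega> \<le> b3" "a * mean_square_error \<omega> \<le> b2"
      by auto
    have "\<bar>variance_hat \<omega> / variance \<psi> - 1\<bar> = \<bar>variance_hat \<omega> - variance \<psi>\<bar> / variance \<psi>"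
      using V(2) by (simp add: divide_simps)
    then have "\<epsilon> * variance \<psi> < \<bar>variance_hat \<omega> - variance \<psi>\<bar>"
      using \<omega> V(2) by (simp add: less_divide_eq)
    then have "a * (\<epsilon> * variance \<psi>) < a * \<bar>variance_hat \<omega> - variance \<psi>\<bar>"
      using a_pos by simp
    also have "\<dots> \<le> (1 + \<kappa>) * (a * mean_square_dev \<omega>) + 2 * s2 * \<kappa> +
      (3 + 1 / \<kappa>) * (a * mean_square_error \<omega>) + 2 * (a * square_mean \<omega>)"
      by (rule variance_hat_error[OF pos(2)])
    also have "\<dots> \<le> (1 + \<kappa>) * b1 + 2 * s2 * \<kappa> + (3 + 1 / \<kappa>) * b2 + 2 * b3"
      using pos by (intro add_mono mult_left_mono le order.refl) auto
    also note budget
    also have "s1 * \<epsilon> \<le> (a * variance \<psi>) * \<epsilon>"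
      using V(1) pos(1) by (intro mult_right_mono) auto
    finally show False by (simp add: ac_simps)
  qed
  then have "prob {\<omega> \<in> space M. \<epsilon> < \<bar>variance_hat \<omega> / variance \<psi> - 1\<bar>} \<le> prob (?A \<union> ?B \<union> ?C)"
    by (rule finite_measure_mono) (intro sets.Un events)
  also have "\<dots> \<le> prob ?A + prob ?B + prob ?C"
    using measure_Un_le[OF sets.Un[OF events(1,2)] events(3)] measure_Un_le[OF events(1,2)] by linarith
  finally show ?thesis
    using prob_mean_square_dev[OF pos(6,3)] prob_square_mean[OF pos(5)] prob_mean_square_error[OF pos(4,7)]
    by linarith
qed

end

subsection \<open>Asymptotics\<close>

lemma eventually_multiples:
  assumes "\<And>N. N > 0 \<Longrightarrow> K dvd N \<Longrightarrow> P N"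
  shows "eventually P (multiples K)"
  unfolding multiples_def eventually_inf_principal
  using eventually_gt_at_top[of 0] by eventually_elim (use assms in auto)

lemma filterlim_multiples: "filterlim (\<lambda>N. N) at_top (multiples K)"
  unfolding multiples_def by (rule filterlim_mono[OF filterlim_ident order.refl]) simp

text \<open>For a given \<eta> the constant C is fixed first, and then C c^2 < \<epsilon>
  eventually. Measurability secures monotonicity of \<open>measure\<close>, which is 0 on
  nonmeasurable sets.\<close>

lemma op1_Op:
  assumes Op: "Op F M W (\<lambda>N. (c N)\<^sup>2)" and c: "c \<in> o[F](\<lambda>_. 1)"
    and meas: "\<forall>\<^sub>F N in F. prob_space (M N) \<and> W N \<in> borel_measurable (M N)"
  shows "op1 F M W"
  unfolding op1_def
proof (intro allI impI tendstoI)
  fix \<epsilon> \<eta> :: real assume pos: "0 < \<epsilon>" "0 < \<eta>"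
  obtain C where C: "0 < C"
      "\<forall>\<^sub>F N in F. measure (M N) {\<omega> \<in> space (M N). W N \<omega> > ennreal (C * (c N)\<^sup>2)} < \<eta>"
    using Op pos unfolding Op_def by blast
  have "(c \<longlongrightarrow> 0) F"
    using smalloD_tendsto[OF c] by simp
  then have "((\<lambda>N. C * (c N)\<^sup>2) \<longlongrightarrow> C * 0\<^sup>2) F"
    by (intro tendsto_intros)
  then have "\<forall>\<^sub>F N in F. C * (c N)\<^sup>2 < \<epsilon>"
    using pos by (intro order_tendstoD(2)) auto
  with C(2) meas
  show "\<forall>\<^sub>F N in F. dist (measure (M N) {\<omega> \<in> space (M N). W N \<omega> > ennreal \<epsilon>}) 0 < \<eta>"
  proof eventually_elim
    case (elim N)
    then interpret prob_space "M N" by simp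
    have [measurable]: "W N \<in> borel_measurable (M N)" using elim by simp
    have "ennreal (C * (c N)\<^sup>2) \<le> ennreal \<epsilon>"
      using elim by (intro ennreal_leI) simp
    then have "prob {\<omega> \<in> space (M N). W N \<omega> > ennreal \<epsilon>} \<le> prob {\<omega> \<in> space (M N). W N \<omega> > ennreal (C * (c N)\<^sup>2)}"
      by (intro finite_measure_mono) (auto dest: le_less_trans)
    then show ?case
      using elim(1) by (simp add: dist_real_def measure_nonneg)
  qed
qed

section \<open>Identities that hold on the covariate space or almost surely\<close>

context dr_population
begin

text \<open>Where \<open>ps\<close> vanishes, 1 - ps / ps would be 1, so the integrand is 0 only
  almost surely, by positivity of the propensity score.\<close>

lemma E_X_exact_propensity: "E_X M p X (\<lambda>x. h x * (1 - ps x / ps x)\<^sup>2 * w x) = 0"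
proof -
  have "AE x in distr M (cov_space p) X. 0 < ps x"
    using ps_pos by (subst AE_distr_iff) auto
  then have "E_X M p X (\<lambda>x. h x * (1 - ps x / ps x)\<^sup>2 * w x) = (\<integral>\<^sup>+x. 0 \<partial>distr M (cov_space p) X)"
    unfolding E_X_def by (intro nn_integral_cong_AE) auto
  then show ?thesis by simp
qed

lemma E_X_cong: "(\<And>x. x \<in> space (cov_space p) \<Longrightarrow> h x = w x) \<Longrightarrow> E_X M p X h = E_X M p X w"
  unfolding E_X_def by (intro nn_integral_cong) simp

lemma var_psi_cong:
  assumes "\<And>x. x \<in> space (cov_space p) \<Longrightarrow> e x = ps x"
  shows "variance (psi M R Y X mu e) = variance \<psi>"
proof -
  have eq: "psi M R Y X mu e \<omega> = \<psi> \<omega>" if "\<omega> \<in> space M" for \<omega>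
    using assms[OF measurable_space[OF X_meas that]] by (simp add: psi_def)
  then have "expectation (psi M R Y X mu e) = expectation \<psi>"
    by (intro Bochner_Integration.integral_cong) auto
  then show ?thesis
    by (intro Bochner_Integration.integral_cong) (auto simp: eq)
qed

end

text \<open>Common to both parts, which differ in the estimator \<open>g\<close> of the propensity
  score and in how the risks involving it are seen to vanish.\<close>

lemma cross_fit_variance_consistent:
  fixes M :: "nat \<Rightarrow> 'a measure" and F :: "nat filter" and s1 s2 :: real
  assumes F: "filterlim (\<lambda>N. N) at_top F"
    and s: "s1 > 0" "s2 > 0"
    and a: "\<And>N. a N = aN (M N) (X N) (ps N)"
    and Zs: "\<And>N i. Zs N i = obs (Rs N i) (Ys N i) (Xs N i)"
    and K: "0 < K"
    and sample: "\<forall>\<^sub>F N in F. dr_sample (M N) (p N) (R N) (Y N) (X N) (m N) (ps N) (mu N) s1 s2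
      N (Zs N) K (I N) (f N) (g N)"
    and tail: "\<And>c. c > 0 \<Longrightarrow>
      ((\<lambda>N. ennreal (1 / a N) *
         (\<integral>\<^sup>+\<omega>. ennreal ((psi (M N) (R N) (Y N) (X N) (mu N) (ps N) \<omega>)\<^sup>2) *
            indicator {\<omega>. \<bar>psi (M N) (R N) (Y N) (X N) (mu N) (ps N) \<omega>\<bar> > c * sqrt (real N / a N)} \<omega>
          \<partial>M N)) \<longlongrightarrow> 0) F"
    and risk_f: "\<And>k. k < K \<Longrightarrow> op1 F M (\<lambda>N \<omega>. E_X (M N) (p N) (X N)
        (\<lambda>x. a N / ps N x * (trained (f N) N (Zs N) (I N) k \<omega> x - mu N x)\<^sup>2))"
    and risk_g: "\<And>k. k < K \<Longrightarrow> op1 F M (\<lambda>N \<omega>. E_X (M N) (p N) (X N)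
        (\<lambda>x. a N / ps N x * (1 - ps N x / trained (g N) N (Zs N) (I N) k \<omega> x)\<^sup>2))"
    and risk_fg: "\<And>k. k < K \<Longrightarrow> op1 F M (\<lambda>N \<omega>. E_X (M N) (p N) (X N)
        (\<lambda>x. a N / ps N x * (1 - ps N x / trained (g N) N (Zs N) (I N) k \<omega> x)\<^sup>2 *
          (trained (f N) N (Zs N) (I N) k \<omega> x - mu N x)\<^sup>2))"
  shows "ratio_consistent F M
      (\<lambda>N \<omega>. let r = (\<lambda>i. Rs N i \<omega>); y = (\<lambda>i. Ys N i \<omega>);
                 fh = cross_fit (f N) K N (Zs N) (I N) (Xs N) \<omega>;
                 gh = cross_fit (g N) K N (Zs N) (I N) (Xs N) \<omega>
             in V_hat N r y fh gh (theta_hat N r y fh gh))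
      (\<lambda>N. prob_space.variance (M N) (psi (M N) (R N) (Y N) (X N) (mu N) (ps N)))"
proof -
  define Vh where "Vh N \<omega> = (let r = (\<lambda>i. Rs N i \<omega>); y = (\<lambda>i. Ys N i \<omega>);
                 fh = cross_fit (f N) K N (Zs N) (I N) (Xs N) \<omega>;
                 gh = cross_fit (g N) K N (Zs N) (I N) (Xs N) \<omega>
             in V_hat N r y fh gh (theta_hat N r y fh gh))" for N \<omega>
  define V where "V N = prob_space.variance (M N) (psi (M N) (R N) (Y N) (X N) (mu N) (ps N))" for N
  \<comment> \<open>Dividing by \<open>V\<close> is harmless wherever \<open>dr_sample\<close>
    holds, because there \<open>V\<close> is at least s1 / a and hence positive.\<close>
  define W where "W N \<omega> = Vh N \<omega> / V N - 1" for N \<omega>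
  define T where "T c N = ennreal (1 / a N) *
         (\<integral>\<^sup>+\<omega>. ennreal ((psi (M N) (R N) (Y N) (X N) (mu N) (ps N) \<omega>)\<^sup>2) *
            indicator {\<omega>. \<bar>psi (M N) (R N) (Y N) (X N) (mu N) (ps N) \<omega>\<bar> > c * sqrt (real N / a N)} \<omega>
          \<partial>M N)" for c N
  define P where "P h N = (\<Sum>k<K.
      measure (M N) {\<omega> \<in> space (M N). ennreal h < E_X (M N) (p N) (X N)
        (\<lambda>x. a N / ps N x * (trained (f N) N (Zs N) (I N) k \<omega> x - mu N x)\<^sup>2)} +
      measure (M N) {\<omega> \<in> space (M N). ennreal h < E_X (M N) (p N) (X N)
        (\<lambda>x. a N / ps N x * (1 - ps N x / trained (g N) N (Zs N) (I N) k \<omega> x)\<^sup>2)} +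
      measure (M N) {\<omega> \<in> space (M N). ennreal h < E_X (M N) (p N) (X N)
        (\<lambda>x. a N / ps N x * (1 - ps N x / trained (g N) N (Zs N) (I N) k \<omega> x)\<^sup>2 *
          (trained (f N) N (Zs N) (I N) k \<omega> x - mu N x)\<^sup>2)})" for h N
  have W: "W N \<in> borel_measurable (M N) \<and> (\<forall>\<omega>\<in>space (M N). Vh N \<omega> = V N * (1 + W N \<omega>))"
    and bound: "\<lbrakk>0 < \<epsilon>; 0 < \<kappa>; 0 < b1; 0 < b2; 0 < b3; 0 < c; 0 \<le> h;
        (1 + \<kappa>) * b1 + 2 * s2 * \<kappa> + (3 + 1 / \<kappa>) * b2 + 2 * b3 \<le> s1 * \<epsilon>\<rbrakk> \<Longrightarrow>
      measure (M N) {\<omega> \<in> space (M N). \<epsilon> < \<bar>W N \<omega>\<bar>} \<le>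
        (c / 2 * (1 + 2 * s2) + 2 * enn2real (T c N)) / b1 + 2 * s2 / b3 * (1 / N) +
        (P h N + (real K)\<^sup>2 * (9 + 3 * s2) * h / b2)"
    if D: "dr_sample (M N) (p N) (R N) (Y N) (X N) (m N) (ps N) (mu N) s1 s2 N (Zs N) K (I N) (f N) (g N)"
    for N \<epsilon> \<kappa> b1 b2 b3 c h
  proof -
    interpret dr_sample "M N" "p N" "R N" "Y N" "X N" "m N" "ps N" "mu N" s1 s2 N "Zs N" K "I N" "f N" "g N"
      by (rule D)
    have Vh: "Vh N \<omega> = variance_hat \<omega>" if "\<omega> \<in> space (M N)" for \<omega>
      unfolding Vh_def Let_def by (rule V_hat_eq[OF that Zs])
    have "0 < s1 / a N"
      using s a_pos by (simp add: a)
    then have "0 < V N"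
      using var_psi_lower by (simp add: V_def a)
    then have eq: "Vh N \<omega> = V N * (1 + W N \<omega>)" for \<omega>
      by (simp add: W_def)
    have W: "W N \<omega> = variance_hat \<omega> / V N - 1" if "\<omega> \<in> space (M N)" for \<omega>
      unfolding W_def Vh[OF that] ..
    have "W N \<in> borel_measurable (M N)"
      by (subst measurable_cong[OF W]) measurable
    then show "W N \<in> borel_measurable (M N) \<and> (\<forall>\<omega>\<in>space (M N). Vh N \<omega> = V N * (1 + W N \<omega>))"
      using eq by blast
    assume pos: "0 < \<epsilon>" "0 < \<kappa>" "0 < b1" "0 < b2" "0 < b3" "0 < c" "0 \<le> h"
      and budget: "(1 + \<kappa>) * b1 + 2 * s2 * \<kappa> + (3 + 1 / \<kappa>) * b2 + 2 * b3 \<le> s1 * \<epsilon>"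
    have "{\<omega> \<in> space (M N). \<epsilon> < \<bar>W N \<omega>\<bar>} = {\<omega> \<in> space (M N). \<epsilon> < \<bar>variance_hat \<omega> / V N - 1\<bar>}"
      using W by auto
    then show "measure (M N) {\<omega> \<in> space (M N). \<epsilon> < \<bar>W N \<omega>\<bar>} \<le>
        (c / 2 * (1 + 2 * s2) + 2 * enn2real (T c N)) / b1 + 2 * s2 / b3 * (1 / N) +
        (P h N + (real K)\<^sup>2 * (9 + 3 * s2) * h / b2)"
      using prob_variance_ratio[OF pos budget]
      unfolding V_def T_def P_def a risk_f_def risk_g_def risk_fg_def by simp
  qed
  have P0: "(P h \<longlongrightarrow> 0) F" if "0 < h" for h
  proof -
    have "((\<lambda>N. P h N) \<longlongrightarrow> (\<Sum>k<K. 0 + 0 + 0)) F"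
      unfolding P_def using risk_f risk_g risk_fg that
      by (intro tendsto_sum tendsto_add) (auto simp: op1_def)
    then show ?thesis by simp
  qed
  have N0: "((\<lambda>N. 1 / real N) \<longlongrightarrow> 0) F"
    by (rule filterlim_compose[OF lim_1_over_n F])
  have T0: "((\<lambda>N. enn2real (T c N)) \<longlongrightarrow> 0) F" if "0 < c" for c
    using tail[OF that] by (intro tendsto_enn2real) (simp_all add: T_def)
  have "op1 F M (\<lambda>N \<omega>. ennreal \<bar>W N \<omega>\<bar>)"
    unfolding op1_def
  proof (intro allI impI tendstoI)
    fix \<epsilon> \<eta> :: real assume pos: "0 < \<epsilon>" "0 < \<eta>"
    \<comment> \<open>\<kappa>, b1, b2 and b3 give each of the four terms of the budget the share s1
      \<epsilon> / 4.\<close>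
    define \<kappa> where "\<kappa> = s1 * \<epsilon> / (8 * s2)"
    define b1 where "b1 = s1 * \<epsilon> / (4 * (1 + \<kappa>))"
    define b2 where "b2 = s1 * \<epsilon> / (4 * (3 + 1 / \<kappa>))"
    define b3 where "b3 = s1 * \<epsilon> / 8"
    \<comment> \<open>Given b1 and b2, \<open>c\<close> and \<open>h\<close> are chosen so that the
      two parts of the bound that do not vanish as N grows are \<eta> / 4 each.\<close>
    define c where "c = \<eta> * b1 / (2 * (1 + 2 * s2))"
    define h where "h = \<eta> * b2 / (4 * ((real K)\<^sup>2 * (9 + 3 * s2)))"
    have \<kappa>: "0 < \<kappa>"
      using pos s by (simp add: \<kappa>_def)
    then have \<kappa>': "0 < 1 + \<kappa>" "0 < 3 + 1 / \<kappa>"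
      by (auto intro: add_pos_pos)
    then have b: "0 < b1" "0 < b2" "0 < b3"
      using pos s by (auto simp: b1_def b2_def b3_def)
    then have ch: "0 < c" "0 < h"
      using pos s K by (auto simp: c_def h_def)
    have "x * (y / (4 * x)) = y / 4" if "0 < x" for x y :: real
      using that by simp
    then have "(1 + \<kappa>) * b1 = s1 * \<epsilon> / 4" "(3 + 1 / \<kappa>) * b2 = s1 * \<epsilon> / 4"
      using \<kappa>' unfolding b1_def b2_def by blast+
    moreover have "2 * b3 = s1 * \<epsilon> / 4"
      by (simp add: b3_def)
    moreover have "2 * s2 * \<kappa> = s1 * \<epsilon> / 4"
      using s by (simp add: \<kappa>_def)
    ultimately have budget: "(1 + \<kappa>) * b1 + 2 * s2 * \<kappa> + (3 + 1 / \<kappa>) * b2 + 2 * b3 \<le> s1 * \<epsilon>"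
      by linarith
    have quarter: "\<eta> * y / (2 * x) / 2 * x / y = \<eta> / 4" "x * (\<eta> * y / (4 * x)) / y = \<eta> / 4" if "0 < x" "0 < y" for x y :: real
      using that by simp_all
    have "0 < 1 + 2 * s2" "0 < (real K)\<^sup>2 * (9 + 3 * s2)"
      using s K by auto
    note lim' = quarter(1)[OF this(1) b(1)] quarter(2)[OF this(2) b(2)]
    have lim: "c / 2 * (1 + 2 * s2) / b1 = \<eta> / 4" "(real K)\<^sup>2 * (9 + 3 * s2) * h / b2 = \<eta> / 4"
      unfolding c_def h_def by (rule lim')+
    have "((\<lambda>N. (c / 2 * (1 + 2 * s2) + 2 * enn2real (T c N)) / b1 + 2 * s2 / b3 * (1 / N) +
        (P h N + (real K)\<^sup>2 * (9 + 3 * s2) * h / b2)) \<longlongrightarrow>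
        (c / 2 * (1 + 2 * s2) + 2 * 0) / b1 + 2 * s2 / b3 * 0 + (0 + (real K)\<^sup>2 * (9 + 3 * s2) * h / b2)) F"
      using b by (intro tendsto_intros T0 N0 P0 ch) auto
    moreover have "(c / 2 * (1 + 2 * s2) + 2 * 0) / b1 + 2 * s2 / b3 * 0 +
        (0 + (real K)\<^sup>2 * (9 + 3 * s2) * h / b2) < \<eta>"
      by (simp only: mult_zero_right add_0_right add_0_left lim) (use pos in simp)
    ultimately have "\<forall>\<^sub>F N in F. (c / 2 * (1 + 2 * s2) + 2 * enn2real (T c N)) / b1 + 2 * s2 / b3 * (1 / N) +
        (P h N + (real K)\<^sup>2 * (9 + 3 * s2) * h / b2) < \<eta>"
      by (rule order_tendstoD(2))
    with sample show "\<forall>\<^sub>F N in F. dist (measure (M N) {\<omega> \<in> space (M N). ennreal \<bar>W N \<omega>\<bar> > ennreal \<epsilon>}) 0 < \<eta>"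
    proof eventually_elim
      case (elim N)
      have "{\<omega> \<in> space (M N). ennreal \<bar>W N \<omega>\<bar> > ennreal \<epsilon>} = {\<omega> \<in> space (M N). \<epsilon> < \<bar>W N \<omega>\<bar>}"
        using pos by (auto simp: ennreal_less_iff)
      then show ?case
        using bound[OF elim(1) pos(1) \<kappa> b ch(1) less_imp_le[OF ch(2)] budget] elim(2)
        by (simp add: dist_real_def measure_nonneg)
    qed
  qed
  moreover have "\<forall>\<^sub>F N in F. W N \<in> borel_measurable (M N) \<and> (\<forall>\<omega>\<in>space (M N). Vh N \<omega> = V N * (1 + W N \<omega>))"
    using sample by eventually_elim (rule W)
  ultimately have "ratio_consistent F M Vh V"
    unfolding ratio_consistent_def by blast
  then show ?thesis
    unfolding Vh_def[abs_def] V_def[abs_def] .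
qed

section \<open>Known and unknown propensity score as two instances of one consistency result\<close>

theorem theorem3p3:
  fixes K :: nat and p :: "nat \<Rightarrow> nat"
    and M :: "nat \<Rightarrow> 'a measure"
    and R Y :: "nat \<Rightarrow> 'a \<Rightarrow> real" and X :: "nat \<Rightarrow> 'a \<Rightarrow> covariate"
    and Rs Ys :: "nat \<Rightarrow> nat \<Rightarrow> 'a \<Rightarrow> real" and Xs :: "nat \<Rightarrow> nat \<Rightarrow> 'a \<Rightarrow> covariate"
    and Zs :: "nat \<Rightarrow> nat \<Rightarrow> 'a \<Rightarrow> obs"
    and I :: "nat \<Rightarrow> nat \<Rightarrow> 'a \<Rightarrow> nat set"
    and m ps mu e :: "nat \<Rightarrow> covariate \<Rightarrow> real"
    and mhat pihat :: "nat \<Rightarrow> estimator"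
    and s1 s2 :: real and a :: "nat \<Rightarrow> real"
    and cmu ce rmu re :: "nat \<Rightarrow> real"
    and F :: "nat filter"
  assumes K: "K \<ge> 2"
    and F: "F = multiples K"
    and a: "\<And>N. a N = aN (M N) (X N) (ps N)"
    and Zs: "\<And>N i. Zs N i = obs (Rs N i) (Ys N i) (Xs N i)"
    and s: "s1 > 0" "s2 > 0"
    and population: "\<And>N. N > 0 \<Longrightarrow> K dvd N \<Longrightarrow>
      population (M N) (p N) (R N) (Y N) (X N) (m N) (ps N)"
    and sample: "\<And>N. N > 0 \<Longrightarrow> K dvd N \<Longrightarrow>
      sample N (M N) (p N) (obs (R N) (Y N) (X N)) (Zs N)"
    and folds: "\<And>N. N > 0 \<Longrightarrow> K dvd N \<Longrightarrow> folds K N (M N) (p N) (Zs N) (I N)"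
    and mhat: "\<And>N. N > 0 \<Longrightarrow> K dvd N \<Longrightarrow> estimator N (p N) (mhat N)"
    and mu: "\<And>N. N > 0 \<Longrightarrow> K dvd N \<Longrightarrow> mu N \<in> borel_measurable (cov_space (p N))"
    and ignorable: "\<And>N. N > 0 \<Longrightarrow> K dvd N \<Longrightarrow> ignorable (M N) (p N) (R N) (Y N) (X N)"
    and basic: "\<And>N. N > 0 \<Longrightarrow> K dvd N \<Longrightarrow>
      basic_assumption s1 s2 (M N) (p N) (R N) (Y N) (X N) (m N) (mu N)"
    and tail: "\<And>c. c > 0 \<Longrightarrow>
      ((\<lambda>N. ennreal (1 / a N) *
         (\<integral>\<^sup>+\<omega>. ennreal ((psi (M N) (R N) (Y N) (X N) (mu N) (ps N) \<omega>)\<^sup>2) *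
            indicator {\<omega>. \<bar>psi (M N) (R N) (Y N) (X N) (mu N) (ps N) \<omega>\<bar> > c * sqrt (real N / a N)} \<omega>
          \<partial>M N)) \<longlongrightarrow> 0) F"
    and Na: "filterlim (\<lambda>N. real N * a N) at_top F"
    and cmu: "cmu \<in> o[F](\<lambda>_. 1)"
    and mhat_rate: "\<And>k. k < K \<Longrightarrow>
      Op F M (\<lambda>N \<omega>. E_X (M N) (p N) (X N)
        (\<lambda>x. a N / ps N x * (trained (mhat N) N (Zs N) (I N) k \<omega> x - mu N x)\<^sup>2)) (\<lambda>N. (cmu N)\<^sup>2)"
  shows "ratio_consistent F M
      (\<lambda>N \<omega>. let r = (\<lambda>i. Rs N i \<omega>); y = (\<lambda>i. Ys N i \<omega>);
                 mh = cross_fit (mhat N) K N (Zs N) (I N) (Xs N) \<omega>;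
                 pv = (\<lambda>i. ps N (Xs N i \<omega>))
             in V_hat N r y mh pv (theta_hat N r y mh pv))
      (\<lambda>N. prob_space.variance (M N) (psi (M N) (R N) (Y N) (X N) (mu N) (ps N)))
    \<and> ((\<forall>N. N > 0 \<and> K dvd N \<longrightarrow> estimator N (p N) (pihat N)) \<and>
       (\<forall>N. N > 0 \<and> K dvd N \<longrightarrow>
          (\<forall>x\<in>space (cov_space (p N)). mu N x = m N x \<and> e N x = ps N x)) \<and>
       ce \<in> o[F](\<lambda>_. 1) \<and> rmu \<in> o[F](\<lambda>_. 1) \<and> re \<in> o[F](\<lambda>_. 1) \<and>
       (\<lambda>N. rmu N * re N) \<in> o[F](\<lambda>N. 1 / sqrt (real N * a N)) \<and>
       (\<forall>k<K. Op F M (\<lambda>N \<omega>. E_X (M N) (p N) (X N)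
          (\<lambda>x. a N / ps N x * (1 - e N x / trained (pihat N) N (Zs N) (I N) k \<omega> x)\<^sup>2))
          (\<lambda>N. (ce N)\<^sup>2)) \<and>
       (\<forall>k<K. Op F M (\<lambda>N \<omega>. E_X (M N) (p N) (X N)
          (\<lambda>x. (trained (mhat N) N (Zs N) (I N) k \<omega> x - mu N x)\<^sup>2)) (\<lambda>N. (rmu N)\<^sup>2)) \<and>
       (\<forall>k<K. Op F M (\<lambda>N \<omega>. E_X (M N) (p N) (X N)
          (\<lambda>x. (1 - e N x / trained (pihat N) N (Zs N) (I N) k \<omega> x)\<^sup>2)) (\<lambda>N. (re N)\<^sup>2)) \<and>
       (\<exists>\<delta>>0. ((\<lambda>N. ennreal (real N powr (- \<delta> / 2) * a N powr (1 + \<delta> / 2)) *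
          (\<integral>\<^sup>+\<omega>. ennreal (\<bar>psi (M N) (R N) (Y N) (X N) (mu N) (ps N) \<omega>\<bar> powr (2 + \<delta>)) \<partial>M N))
          \<longlongrightarrow> 0) F) \<and>
       (\<forall>k<K. op1 F M (\<lambda>N \<omega>. E_X (M N) (p N) (X N)
          (\<lambda>x. a N / ps N x * (1 - ps N x / trained (pihat N) N (Zs N) (I N) k \<omega> x)\<^sup>2 *
               (trained (mhat N) N (Zs N) (I N) k \<omega> x - m N x)\<^sup>2)))
     \<longrightarrow> ratio_consistent F M
      (\<lambda>N \<omega>. let r = (\<lambda>i. Rs N i \<omega>); y = (\<lambda>i. Ys N i \<omega>);
                 mh = cross_fit (mhat N) K N (Zs N) (I N) (Xs N) \<omega>;
                 ph = cross_fit (pihat N) K N (Zs N) (I N) (Xs N) \<omega>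
             in V_hat N r y mh ph (theta_hat N r y mh ph))
      (\<lambda>N. prob_space.variance (M N) (psi (M N) (R N) (Y N) (X N) (mu N) (e N))))"
proof -
  have pop: "dr_population (M N) (p N) (R N) (Y N) (X N) (m N) (ps N) (mu N) s1 s2" if "N > 0" "K dvd N" for N
    using population[OF that] ignorable[OF that] basic[OF that] mu[OF that] s
    by (intro dr_population.intro dr_population_axioms.intro) (auto simp: population_def)
  have smp: "dr_sample (M N) (p N) (R N) (Y N) (X N) (m N) (ps N) (mu N) s1 s2 N (Zs N) K (I N) (mhat N) g"
    if N: "N > 0" "K dvd N" and g: "estimator N (p N) g" for N g
    using pop[OF N] sample[OF N] folds[OF N] mhat[OF N] g N
    by (intro dr_sample.intro cross_fitting.intro iid_sample.intro dr_sample_axioms.intro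
        cross_fitting_axioms.intro iid_sample_axioms.intro)
      (auto simp: sample_def dr_population_def)
  have known: "estimator N (p N) (\<lambda>_ _. ps N)" if "N > 0" "K dvd N" for N
  proof -
    interpret dr_population "M N" "p N" "R N" "Y N" "X N" "m N" "ps N" "mu N" s1 s2
      by (rule pop[OF that])
    show ?thesis
      unfolding estimator_def by measurable
  qed
  have FN: "filterlim (\<lambda>N. N) at_top F" and Kpos: "0 < K"
    using filterlim_multiples K by (auto simp: F)
  have ev: "eventually P F" if "\<And>N. N > 0 \<Longrightarrow> K dvd N \<Longrightarrow> P N" for P
    unfolding F by (rule eventually_multiples) (rule that)
  have risk_f: "op1 F M (\<lambda>N \<omega>. E_X (M N) (p N) (X N)
      (\<lambda>x. a N / ps N x * (trained (mhat N) N (Zs N) (I N) k \<omega> x - mu N x)\<^sup>2))" if k: "k < K" for k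
  proof (rule op1_Op[OF mhat_rate[OF k] cmu ev])
    fix N assume N: "N > 0" "K dvd N"
    interpret dr_sample "M N" "p N" "R N" "Y N" "X N" "m N" "ps N" "mu N" s1 s2 N "Zs N" K "I N" "mhat N" "\<lambda>_ _. ps N"
      by (rule smp[OF N known[OF N]])
    show "prob_space (M N) \<and> (\<lambda>\<omega>. E_X (M N) (p N) (X N)
      (\<lambda>x. a N / ps N x * (trained (mhat N) N (Zs N) (I N) k \<omega> x - mu N x)\<^sup>2)) \<in> borel_measurable (M N)"
      using risk_measurable(1)[OF k] prob_space_axioms unfolding risk_f_def[abs_def] a by blast
  qed
  \<comment> \<open>For the known score, D = 0 makes two of the risks identically 0.\<close>
  have zero: "op1 F M U" if "\<And>N \<omega>. N > 0 \<Longrightarrow> K dvd N \<Longrightarrow> U N \<omega> = 0" for U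
    unfolding op1_def
    by (intro allI impI tendsto_eventually ev) (simp add: that)
  have exact: "E_X (M N) (p N) (X N) (\<lambda>x. h x * (1 - ps N x / ps N x)\<^sup>2 * w x) = 0"
    if "N > 0" "K dvd N" for N h w
    by (rule dr_population.E_X_exact_propensity[OF pop[OF that]])
  \<comment> \<open>A known propensity score is a constant estimator.\<close>
  have "ratio_consistent F M
      (\<lambda>N \<omega>. let r = (\<lambda>i. Rs N i \<omega>); y = (\<lambda>i. Ys N i \<omega>);
                 fh = cross_fit (mhat N) K N (Zs N) (I N) (Xs N) \<omega>;
                 gh = cross_fit (\<lambda>_ _. ps N) K N (Zs N) (I N) (Xs N) \<omega>
             in V_hat N r y fh gh (theta_hat N r y fh gh))
      (\<lambda>N. prob_space.variance (M N) (psi (M N) (R N) (Y N) (X N) (mu N) (ps N)))"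
  proof (rule cross_fit_variance_consistent[OF FN s a Zs Kpos ev tail risk_f])
    show "dr_sample (M N) (p N) (R N) (Y N) (X N) (m N) (ps N) (mu N) s1 s2 N (Zs N) K (I N) (mhat N) (\<lambda>_ _. ps N)"
      if "N > 0" "K dvd N" for N
      by (rule smp[OF that known[OF that]])
    show "op1 F M (\<lambda>N \<omega>. E_X (M N) (p N) (X N)
        (\<lambda>x. a N / ps N x * (1 - ps N x / trained (\<lambda>_ _. ps N) N (Zs N) (I N) k \<omega> x)\<^sup>2))" for k
      unfolding trained_def by (intro zero exact[where w="\<lambda>_. 1", unfolded mult_1_right])
    show "op1 F M (\<lambda>N \<omega>. E_X (M N) (p N) (X N)
        (\<lambda>x. a N / ps N x * (1 - ps N x / trained (\<lambda>_ _. ps N) N (Zs N) (I N) k \<omega> x)\<^sup>2 *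
          (trained (mhat N) N (Zs N) (I N) k \<omega> x - mu N x)\<^sup>2))" for k
      unfolding trained_def by (intro zero exact)
  qed
  then have part_a: "ratio_consistent F M
      (\<lambda>N \<omega>. let r = (\<lambda>i. Rs N i \<omega>); y = (\<lambda>i. Ys N i \<omega>);
                 mh = cross_fit (mhat N) K N (Zs N) (I N) (Xs N) \<omega>;
                 pv = (\<lambda>i. ps N (Xs N i \<omega>))
             in V_hat N r y mh pv (theta_hat N r y mh pv))
      (\<lambda>N. prob_space.variance (M N) (psi (M N) (R N) (Y N) (X N) (mu N) (ps N)))"
    unfolding cross_fit_def trained_def[of "\<lambda>_ _. ps _"] .
  show ?thesis
  proof (intro conjI part_a impI, elim conjE)
    assume est: "\<forall>N. N > 0 \<and> K dvd N \<longrightarrow> estimator N (p N) (pihat N)"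
      and eq: "\<forall>N. N > 0 \<and> K dvd N \<longrightarrow> (\<forall>x\<in>space (cov_space (p N)). mu N x = m N x \<and> e N x = ps N x)"
      and ce: "ce \<in> o[F](\<lambda>_. 1)"
      and pihat_rate: "\<forall>k<K. Op F M (\<lambda>N \<omega>. E_X (M N) (p N) (X N)
          (\<lambda>x. a N / ps N x * (1 - e N x / trained (pihat N) N (Zs N) (I N) k \<omega> x)\<^sup>2)) (\<lambda>N. (ce N)\<^sup>2)"
      and product: "\<forall>k<K. op1 F M (\<lambda>N \<omega>. E_X (M N) (p N) (X N)
          (\<lambda>x. a N / ps N x * (1 - ps N x / trained (pihat N) N (Zs N) (I N) k \<omega> x)\<^sup>2 *
               (trained (mhat N) N (Zs N) (I N) k \<omega> x - m N x)\<^sup>2))"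
    have E_X_eq: "E_X (M N) (p N) (X N) h = E_X (M N) (p N) (X N) w"
      if "N > 0" "K dvd N" "\<And>x. x \<in> space (cov_space (p N)) \<Longrightarrow> h x = w x" for N h w
      by (rule dr_population.E_X_cong[OF pop[OF that(1,2)] that(3)])
    \<comment> \<open>mu = m and e = ps are given for positive multiples of K and on the covariate
      space. The risks agree for these \<open>N\<close>, and \<open>op1\<close> along
      \<open>F\<close> depends on no others.\<close>
    have transfer: "op1 F M U" if "op1 F M U'" "\<And>N \<omega>. N > 0 \<Longrightarrow> K dvd N \<Longrightarrow> U N \<omega> = U' N \<omega>" for U U'
      unfolding op1_def
    proof (intro allI impI)
      fix \<epsilon> :: real assume "0 < \<epsilon>"
      then have "((\<lambda>N. measure (M N) {\<omega> \<in> space (M N). U' N \<omega> > ennreal \<epsilon>}) \<longlongrightarrow> 0) F"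
        using that(1) by (simp add: op1_def)
      moreover have "\<forall>\<^sub>F N in F. measure (M N) {\<omega> \<in> space (M N). U' N \<omega> > ennreal \<epsilon>} =
          measure (M N) {\<omega> \<in> space (M N). U N \<omega> > ennreal \<epsilon>}"
        by (rule ev) (simp add: that(2))
      ultimately show "((\<lambda>N. measure (M N) {\<omega> \<in> space (M N). U N \<omega> > ennreal \<epsilon>}) \<longlongrightarrow> 0) F"
        by (rule Lim_transform_eventually)
    qed
    have unknown: "dr_sample (M N) (p N) (R N) (Y N) (X N) (m N) (ps N) (mu N) s1 s2 N (Zs N) K (I N) (mhat N) (pihat N)"
      if "N > 0" "K dvd N" for N
      using smp[OF that] est that by blast
    have risk_e: "E_X (M N) (p N) (X N) (\<lambda>x. a N / ps N x * (1 - e N x / trained (pihat N) N (Zs N) (I N) k \<omega> x)\<^sup>2) =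
        E_X (M N) (p N) (X N) (\<lambda>x. a N / ps N x * (1 - ps N x / trained (pihat N) N (Zs N) (I N) k \<omega> x)\<^sup>2)"
      if "N > 0" "K dvd N" for N k \<omega>
      by (rule E_X_eq[OF that]) (use eq that in simp)
    have risk_g: "op1 F M (\<lambda>N \<omega>. E_X (M N) (p N) (X N)
          (\<lambda>x. a N / ps N x * (1 - ps N x / trained (pihat N) N (Zs N) (I N) k \<omega> x)\<^sup>2))" if k: "k < K" for k
    proof (rule transfer)
      show "op1 F M (\<lambda>N \<omega>. E_X (M N) (p N) (X N)
          (\<lambda>x. a N / ps N x * (1 - e N x / trained (pihat N) N (Zs N) (I N) k \<omega> x)\<^sup>2))"
      proof (rule op1_Op[OF pihat_rate[rule_format, OF k] ce ev])
        fix N assume N: "N > 0" "K dvd N"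
        interpret dr_sample "M N" "p N" "R N" "Y N" "X N" "m N" "ps N" "mu N" s1 s2 N "Zs N" K "I N" "mhat N" "pihat N"
          by (rule unknown[OF N])
        show "prob_space (M N) \<and> (\<lambda>\<omega>. E_X (M N) (p N) (X N)
            (\<lambda>x. a N / ps N x * (1 - e N x / trained (pihat N) N (Zs N) (I N) k \<omega> x)\<^sup>2)) \<in> borel_measurable (M N)"
          using risk_measurable(2)[OF k] prob_space_axioms unfolding risk_e[OF N] unfolding risk_g_def[abs_def] a by blast
      qed
    qed (rule risk_e[symmetric])
    have risk_fg: "op1 F M (\<lambda>N \<omega>. E_X (M N) (p N) (X N)
          (\<lambda>x. a N / ps N x * (1 - ps N x / trained (pihat N) N (Zs N) (I N) k \<omega> x)\<^sup>2 *
               (trained (mhat N) N (Zs N) (I N) k \<omega> x - mu N x)\<^sup>2))" if k: "k < K" for k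
      by (rule transfer[OF product[rule_format, OF k]], rule E_X_eq) (use eq in auto)
    have "ratio_consistent F M
      (\<lambda>N \<omega>. let r = (\<lambda>i. Rs N i \<omega>); y = (\<lambda>i. Ys N i \<omega>);
                 mh = cross_fit (mhat N) K N (Zs N) (I N) (Xs N) \<omega>;
                 ph = cross_fit (pihat N) K N (Zs N) (I N) (Xs N) \<omega>
             in V_hat N r y mh ph (theta_hat N r y mh ph))
      (\<lambda>N. prob_space.variance (M N) (psi (M N) (R N) (Y N) (X N) (mu N) (ps N)))"
      by (rule cross_fit_variance_consistent[OF FN s a Zs Kpos ev tail risk_f risk_g risk_fg]) (rule unknown)
    then obtain W where W: "\<forall>\<^sub>F N in F. W N \<in> borel_measurable (M N) \<and> (\<forall>\<omega>\<in>space (M N).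
          (let r = (\<lambda>i. Rs N i \<omega>); y = (\<lambda>i. Ys N i \<omega>);
                 mh = cross_fit (mhat N) K N (Zs N) (I N) (Xs N) \<omega>;
                 ph = cross_fit (pihat N) K N (Zs N) (I N) (Xs N) \<omega>
             in V_hat N r y mh ph (theta_hat N r y mh ph)) =
          prob_space.variance (M N) (psi (M N) (R N) (Y N) (X N) (mu N) (ps N)) * (1 + W N \<omega>))"
        "op1 F M (\<lambda>N \<omega>. ennreal \<bar>W N \<omega>\<bar>)"
      unfolding ratio_consistent_def by blast
    \<comment> \<open>The variances for \<open>ps\<close> and \<open>e\<close> agree eventually, so
      the same \<open>W\<close> witnesses consistency for the latter.\<close>
    have "\<forall>\<^sub>F N in F. prob_space.variance (M N) (psi (M N) (R N) (Y N) (X N) (mu N) (ps N)) =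
        prob_space.variance (M N) (psi (M N) (R N) (Y N) (X N) (mu N) (e N))"
      by (rule ev, rule dr_population.var_psi_cong[OF pop, symmetric]) (use eq in auto)
    with W(1) have "\<forall>\<^sub>F N in F. W N \<in> borel_measurable (M N) \<and> (\<forall>\<omega>\<in>space (M N).
          (let r = (\<lambda>i. Rs N i \<omega>); y = (\<lambda>i. Ys N i \<omega>);
                 mh = cross_fit (mhat N) K N (Zs N) (I N) (Xs N) \<omega>;
                 ph = cross_fit (pihat N) K N (Zs N) (I N) (Xs N) \<omega>
             in V_hat N r y mh ph (theta_hat N r y mh ph)) =
          prob_space.variance (M N) (psi (M N) (R N) (Y N) (X N) (mu N) (e N)) * (1 + W N \<omega>))"
    proof eventually_elim
      case (elim N)
      show ?case using elim(1) unfolding elim(2) .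
    qed
    with W(2) show "ratio_consistent F M
      (\<lambda>N \<omega>. let r = (\<lambda>i. Rs N i \<omega>); y = (\<lambda>i. Ys N i \<omega>);
                 mh = cross_fit (mhat N) K N (Zs N) (I N) (Xs N) \<omega>;
                 ph = cross_fit (pihat N) K N (Zs N) (I N) (Xs N) \<omega>
             in V_hat N r y mh ph (theta_hat N r y mh ph))
      (\<lambda>N. prob_space.variance (M N) (psi (M N) (R N) (Y N) (X N) (mu N) (e N)))"
      unfolding ratio_consistent_def by blast
  qed
qed

end
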